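(* (Real case) Let $X\subset\mathbb R^n$ be open and let $F\subset J^2(X)$ be a primitive subequation that satisfies the Negativity Property, is convex, and is constant coefficient. Then $F$ satisfies the minimum principle (real version). (Complex case) Let $X\subset\mathbb C^n$ be open and let $F\subset J^{2,\mathbb C}(X)$ be a complex primitive subequation that satisfies the Negativity Property, is convex, and is constant coefficient. Then $F$ satisfies the minimum principle (complex version).
   Context: **Real jets.** $\mathrm{Sym}^2_n$ is the space of real symmetric $n\times n$ matrices, $\mathrm{Pos}_n\subset \mathrm{Sym}^2_n$ the semipositive ones. For $X\subset\mathbb R^n$ open, $J^2_n=\mathbb R\times\mathbb R^n\times\mathrm{Sym}^2_n$ and $J^2(X)=X\times J^2_n$. For $F\subset J^2(X)$, $x\in X$: $F_x=\{(r,p,A):(x,r,p,A)\in F\}$. $F$ is a *primitive subequation* if it is closed and has Positivity: $(r,p,A)\in F_x$, $P\in\mathrm{Pos}_n$ imply $(r,p,A+P)\in F_x$. *Negativity Property*: $(r,p,A)\in F_x$, $r'\le r$ imply $(r',p,A)\in F_x$. *Constant coefficient*: $F_x$ is independent of $x$. *Convex*: each $F_x$ is convex. An upper-semicontinuous $f:X\to\mathbb R\cup\{-\infty\}$ has *upper contact jet* $(p,A)\in\mathbb R^n\times\mathrm{Sym}^2_n$ at $x$ if $f(x)\ne-\infty$ and $f(y)\le f(x)+p\cdot(y-x)+\frac12(y-x)^tA(y-x)$ for all $y$ near $x$. $f$ is *$F$-subharmonic* if $(f(x),p,A)\in F_x$ for every $x$ and every upper contact jet $(p,A)$ of $f$ at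 $x$ (same definition on open subsets of $X$). **Real products.** For $\Gamma\in\mathrm{Hom}(\mathbb R^n,\mathbb R^m)$, $p=(p_1,p_2)\in\mathbb R^{n+m}$ and $A=\begin{pmatrix}B&C\\C^t&D\end{pmatrix}\in\mathrm{Sym}^2_{n+m}$ (blocks of sizes $n,m$) put $i_\Gamma^*(r,p,A)=(r,p_1+\Gamma^tp_2,B+C\Gamma+\Gamma^tC^t+\Gamma^tD\Gamma)$ and $j^*(r,p,A)=(r,p_2,D)$. For $F\subset J^2(X)$, $G\subset J^2(Y)$, $Y\subset\mathbb R^m$ open, $F\#G\subset J^2(X\times Y)$ is given by $(F\#G)_{(x,y)}=\{\alpha\in J^2_{n+m}: i_\Gamma^*\alpha\in F_x\text{ and }j^*\alpha\in G_y\text{ for all }\Gamma\}$. $\mathcal P\subset J^2(\mathbb R^m)$ is $\{(y,r,p,A):A\in\mathrm{Pos}_m\}$. **Pseudoconvexity.** A function $u:\Omega\to\mathbb R$ is *exhaustive* if $\{u<a\}$ is relatively compact in $\Omega$ for each $a\in\mathbb R$. An open set $\Omega$ is *$F$-pseudoconvex* if it admits a continuous exhaustive $F$-subharmonic function $\Omega\to\mathbb R$. $\pi$ denotes projection to the first factor $X$, $\Omega_x=\{y:(x,y)\in\Omega\}$, and $\Omega$ has *connected fibres* if $\Omega_x$ is connected for each $x\in\pi(\Omega)$. **Minimum principle (real).** $F$ satisfies it if for every $m\ge1$ and every $F\#\mathcal P$-pseudoconvex domain $\Omega\subset X\times\mathbb R^m$ with connected fibres: $\pi(\Omega)$ is $F$-pseudoconvex,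 and for every $F\#\mathcal P$-subharmonic $f$ on $\Omega$ the marginal function $g(x)=\inf_{y\in\Omega_x}f(x,y)$ is $F$-subharmonic on $\pi(\Omega)$. **Complex jets.** Identify $\mathbb C^n\simeq\mathbb R^{2n}$ via $z=x+iy\leftrightarrow(x,y)$. Let $J^{2,\mathbb C}_n=\mathbb R\times\mathbb C^n\times\mathrm{Herm}_n$ ($\mathrm{Herm}_n$ = hermitian $n\times n$ matrices, $\mathrm{Pos}^{\mathbb C}_n$ the semipositive ones) and $J^{2,\mathbb C}(X)=X\times J^{2,\mathbb C}_n$. A *complex primitive subequation* is a closed $F\subset J^{2,\mathbb C}(X)$ with $(r,p,A)\in F_x$, $P\in\mathrm{Pos}_n^{\mathbb C}$ $\Rightarrow(r,p,A+P)\in F_x$; Negativity, convexity and constant coefficient are defined as in the real case. For real symmetric $A=\begin{pmatrix}a&c\\ b&d\end{pmatrix}$ ($n\times n$ blocks) let $A_{\mathbb C}=\frac12(a+d)+\frac i2(b-c)\in\mathrm{Herm}_n$. An upper-semicontinuous $f:X\to\mathbb R\cup\{-\infty\}$ is *$F$-subharmonic* if $(f(z),p,A_{\mathbb C})\in F_z$ for every (real) upper contact jet $(p,A)$ of $f$ at every $z$, with $p\in\mathbb R^{2n}\simeq\mathbb C^n$. **Complex products.** For $\Gamma\in\mathrm{Hom}_{\mathbb C}(\mathbb C^n,\mathbb C^m)$ and $A=\begin{pmatrix}B&C\\C^*&D\end{pmatrix}\in\mathrm{Herm}_{n+m}$, $i_\Gamma^*(r,p,A)=(r,p_1+\Gamma^*p_2,B+C\Gamma+\Gamma^*C^*+\Gamma^*D\Gamma)$,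 $j^*(r,p,A)=(r,p_2,D)$, and $(F\#_{\mathbb C}G)_{(z,w)}=\{\alpha: i_\Gamma^*\alpha\in F_z\text{ and }j^*\alpha\in G_w\ \text{for all }\Gamma\in\mathrm{Hom}_{\mathbb C}(\mathbb C^n,\mathbb C^m)\}$. $\mathcal P^{\mathbb C}\subset J^{2,\mathbb C}(\mathbb C^m)$ is $\{(w,r,p,A):A\in\mathrm{Pos}^{\mathbb C}_m\}$. **Minimum principle (complex).** $\mathbb T^m=\{(e^{i\theta_1},\dots,e^{i\theta_m})\}$ acts on $\mathbb C^m$ coordinatewise. $\Omega\subset\mathbb C^n\times\mathbb C^m$ is $\mathbb T^m$-invariant if $(z,w)\in\Omega\Rightarrow(z,e^{i\theta}w)\in\Omega$, and then $f$ on $\Omega$ is $\mathbb T^m$-invariant if $f(z,e^{i\theta}w)=f(z,w)$, for all $e^{i\theta}\in\mathbb T^m$. $F$ satisfies the minimum principle if for every $m\ge1$ and every $\mathbb T^m$-invariant $F\#_{\mathbb C}\mathcal P^{\mathbb C}$-pseudoconvex domain $\Omega\subset X\times\mathbb C^m$ with connected fibres: $\pi(\Omega)$ is $F$-pseudoconvex, and for every $\mathbb T^m$-invariant $F\#_{\mathbb C}\mathcal P^{\mathbb C}$-subharmonic $f$ on $\Omega$ the function $g(z)=\inf_{w\in\Omega_z}f(z,w)$ is $F$-subharmonic on $\pi(\Omega)$. *)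

theory Defs
  imports "HOL-Analysis.Analysis"
begin

section \<open>The product \<open>k\<^sup>n \<times> k\<^sup>m\<close> and block matrices\<close>

text \<open>
  The space \<open>k\<^sup>n \<times> k\<^sup>m = k\<^bsup>n+m\<^esup>\<close> (with \<open>k\<close> the reals or the complex numbers) is rendered as
  vectors indexed by the sum type \<open>'n + 'm\<close>.
\<close>

definition vec_pair :: "'a^'n \<Rightarrow> 'a^'m \<Rightarrow> 'a^('n + 'm)" where
  "vec_pair x y = (\<chi> k. case k of Inl i \<Rightarrow> x $ i | Inr j \<Rightarrow> y $ j)"

definition vec_fst :: "'a^('n::finite + 'm::finite) \<Rightarrow> 'a^'n" where
  "vec_fst z = (\<chi> i. z $ Inl i)"

definition vec_snd :: "'a^('n::finite + 'm::finite) \<Rightarrow> 'a^'m" where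
  "vec_snd z = (\<chi> j. z $ Inr j)"

definition block_11 :: "'a^('n::finite + 'm::finite)^('n + 'm) \<Rightarrow> 'a^'n^'n" where
  "block_11 A = (\<chi> i j. A $ Inl i $ Inl j)"

definition block_12 :: "'a^('n::finite + 'm::finite)^('n + 'm) \<Rightarrow> 'a^'m^'n" where
  "block_12 A = (\<chi> i j. A $ Inl i $ Inr j)"

definition block_21 :: "'a^('n::finite + 'm::finite)^('n + 'm) \<Rightarrow> 'a^'n^'m" where
  "block_21 A = (\<chi> i j. A $ Inr i $ Inl j)"

definition block_22 :: "'a^('n::finite + 'm::finite)^('n + 'm) \<Rightarrow> 'a^'m^'m" where
  "block_22 A = (\<chi> i j. A $ Inr i $ Inr j)"

definition slice :: "('a^('n + 'm)) set \<Rightarrow> 'a^'n \<Rightarrow> ('a^'m) set" where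
  "slice \<Omega> x = {y. vec_pair x y \<in> \<Omega>}"

definition connected_fibres :: "('a::topological_space^('n::finite + 'm::finite)) set \<Rightarrow> bool" where
  "connected_fibres \<Omega> \<longleftrightarrow> (\<forall>x\<in>vec_fst ` \<Omega>. connected (slice \<Omega> x))"

definition marginal ::
  "('a^('n::finite + 'm::finite)) set \<Rightarrow> ('a^('n + 'm) \<Rightarrow> ereal) \<Rightarrow> 'a^'n \<Rightarrow> ereal" where
  "marginal \<Omega> f x = (INF y\<in>slice \<Omega> x. f (vec_pair x y))"


section \<open>Notions common to the real and the complex case\<close>

definition jet_fibre :: "('x \<times> 'j) set \<Rightarrow> 'x \<Rightarrow> 'j set" where
  "jet_fibre F x = {\<alpha>. (x, \<alpha>) \<in> F}"

definition negativity :: "'x set \<Rightarrow> ('x \<times> real \<times> 'p \<times> 'm) set \<Rightarrow> bool" where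
  "negativity X F \<longleftrightarrow>
     (\<forall>x\<in>X. \<forall>r r' p A. (r, p, A) \<in> jet_fibre F x \<longrightarrow> r' \<le> r \<longrightarrow> (r', p, A) \<in> jet_fibre F x)"

definition constant_coefficient :: "'x set \<Rightarrow> ('x \<times> 'j) set \<Rightarrow> bool" where
  "constant_coefficient X F \<longleftrightarrow> (\<forall>x\<in>X. \<forall>x'\<in>X. jet_fibre F x = jet_fibre F x')"

definition convex_fibres :: "'x set \<Rightarrow> ('x \<times> 'j::real_vector) set \<Rightarrow> bool" where
  "convex_fibres X F \<longleftrightarrow> (\<forall>x\<in>X. convex (jet_fibre F x))"

definition usc_on :: "'x::topological_space set \<Rightarrow> ('x \<Rightarrow> ereal) \<Rightarrow> bool" where
  "usc_on \<Omega> f \<longleftrightarrow> (\<forall>a. openin (top_of_set \<Omega>) {x \<in> \<Omega>. f x < a})"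

definition exhaustive :: "'x::topological_space set \<Rightarrow> ('x \<Rightarrow> real) \<Rightarrow> bool" where
  "exhaustive \<Omega> u \<longleftrightarrow>
     (\<forall>a. compact (closure {x \<in> \<Omega>. u x < a}) \<and> closure {x \<in> \<Omega>. u x < a} \<subseteq> \<Omega>)"


section \<open>Real jets\<close>

type_synonym 'n real_jet = "real \<times> (real^'n) \<times> (real^'n^'n)"

definition Sym :: "(real^'n^'n) set" where
  "Sym = {A. transpose A = A}"

definition Pos :: "(real^'n^'n) set" where
  "Pos = {A \<in> Sym. \<forall>v. 0 \<le> v \<bullet> (A *v v)}"

definition real_jets :: "(real^'n) set \<Rightarrow> ((real^'n) \<times> 'n real_jet) set" where
  "real_jets X = {(x, r, p, A). x \<in> X \<and> A \<in> Sym}"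

definition real_primitive_subequation ::
  "(real^'n) set \<Rightarrow> ((real^'n) \<times> 'n real_jet) set \<Rightarrow> bool" where
  "real_primitive_subequation X F \<longleftrightarrow>
     closedin (top_of_set (real_jets X)) F \<and>
     (\<forall>x\<in>X. \<forall>r p A P. (r, p, A) \<in> jet_fibre F x \<longrightarrow> P \<in> Pos \<longrightarrow> (r, p, A + P) \<in> jet_fibre F x)"

text \<open>
  The condition only involves the germ of \<open>f\<close> at \<open>x\<close>; it is used for \<open>x\<close> in an open set \<open>\<Omega>\<close>,
  so the values of \<open>f\<close> outside \<open>\<Omega>\<close> are irrelevant.
\<close>

definition upper_contact_jet ::
  "(real^'n \<Rightarrow> ereal) \<Rightarrow> real^'n \<Rightarrow> real^'n \<Rightarrow> real^'n^'n \<Rightarrow> bool" where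
  "upper_contact_jet f x p A \<longleftrightarrow>
     A \<in> Sym \<and> f x \<noteq> -\<infinity> \<and>
     (\<forall>\<^sub>F y in nhds x. f y \<le> f x + ereal (p \<bullet> (y - x) + 1/2 * ((y - x) \<bullet> (A *v (y - x)))))"

definition real_subharmonic ::
  "((real^'n) \<times> 'n real_jet) set \<Rightarrow> (real^'n) set \<Rightarrow> (real^'n \<Rightarrow> ereal) \<Rightarrow> bool" where
  "real_subharmonic F \<Omega> f \<longleftrightarrow>
     (\<forall>x\<in>\<Omega>. f x \<noteq> \<infinity>) \<and> usc_on \<Omega> f \<and>
     (\<forall>x\<in>\<Omega>. \<forall>p A. upper_contact_jet f x p A \<longrightarrow> (real_of_ereal (f x), p, A) \<in> jet_fibre F x)"

definition real_pseudoconvex ::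
  "((real^'n) \<times> 'n real_jet) set \<Rightarrow> (real^'n) set \<Rightarrow> bool" where
  "real_pseudoconvex F \<Omega> \<longleftrightarrow>
     open \<Omega> \<and>
     (\<exists>u. continuous_on \<Omega> u \<and> exhaustive \<Omega> u \<and> real_subharmonic F \<Omega> (\<lambda>x. ereal (u x)))"

definition real_graph_pullback ::
  "real^'n^'m \<Rightarrow> ('n + 'm) real_jet \<Rightarrow> 'n real_jet" where
  "real_graph_pullback \<Gamma> = (\<lambda>(r, p, A).
     (r, vec_fst p + transpose \<Gamma> *v vec_snd p,
      block_11 A + block_12 A ** \<Gamma> + transpose \<Gamma> ** transpose (block_12 A)
        + transpose \<Gamma> ** block_22 A ** \<Gamma>))"

definition real_fibre_pullback :: "('n::finite + 'm::finite) real_jet \<Rightarrow> 'm real_jet" where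
  "real_fibre_pullback = (\<lambda>(r, p, A). (r, vec_snd p, block_22 A))"

definition real_product ::
  "((real^'n) \<times> 'n real_jet) set \<Rightarrow> ((real^'m) \<times> 'm real_jet) set
     \<Rightarrow> ((real^('n + 'm)) \<times> ('n + 'm) real_jet) set" where
  "real_product F G = {(z, r, p, A). A \<in> Sym \<and>
     (\<forall>\<Gamma>. real_graph_pullback \<Gamma> (r, p, A) \<in> jet_fibre F (vec_fst z) \<and>
          real_fibre_pullback (r, p, A) \<in> jet_fibre G (vec_snd z))}"

definition real_convexity_subequation :: "((real^'m) \<times> 'm real_jet) set" where
  "real_convexity_subequation = {(y, r, p, A). A \<in> Pos}"

text \<open>
  The minimum principle for the fibre dimension \<open>m = CARD('m)\<close>; "for every \<open>m \<ge> 1\<close>" is the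
  universal quantification over the type variable \<open>'m\<close> in the theorem.
\<close>

definition real_minimum_principle ::
  "'m::finite itself \<Rightarrow> (real^'n) set \<Rightarrow> ((real^'n) \<times> 'n real_jet) set \<Rightarrow> bool" where
  "real_minimum_principle _ X F \<longleftrightarrow>
     (\<forall>\<Omega> :: (real^('n + 'm)) set.
        vec_fst ` \<Omega> \<subseteq> X \<and> \<Omega> \<noteq> {} \<and> open \<Omega> \<and> connected \<Omega> \<and>
        real_pseudoconvex (real_product F real_convexity_subequation) \<Omega> \<and>
        connected_fibres \<Omega>
        \<longrightarrow>
        real_pseudoconvex F (vec_fst ` \<Omega>) \<and>
        (\<forall>f. real_subharmonic (real_product F real_convexity_subequation) \<Omega> f
           \<longrightarrow> real_subharmonic F (vec_fst ` \<Omega>) (marginal \<Omega> f)))"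


section \<open>Complex jets\<close>

type_synonym 'n complex_jet = "real \<times> (complex^'n) \<times> (complex^'n^'n)"

definition adjoint_matrix :: "complex^'n^'m \<Rightarrow> complex^'m^'n" where
  "adjoint_matrix A = (\<chi> i j. cnj (A $ j $ i))"

definition Herm :: "(complex^'n^'n) set" where
  "Herm = {A. adjoint_matrix A = A}"

text \<open>The quadratic form \<open>v\<^sup>* A v\<close> of a hermitian matrix is real, so taking \<open>Re\<close> loses nothing.\<close>

definition PosC :: "(complex^'n^'n) set" where
  "PosC = {A \<in> Herm. \<forall>v. 0 \<le> Re (\<Sum>i\<in>UNIV. cnj (v $ i) * (A *v v) $ i)}"

definition complex_jets :: "(complex^'n) set \<Rightarrow> ((complex^'n) \<times> 'n complex_jet) set" where
  "complex_jets X = {(z, r, p, A). z \<in> X \<and> A \<in> Herm}"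

definition complex_primitive_subequation ::
  "(complex^'n) set \<Rightarrow> ((complex^'n) \<times> 'n complex_jet) set \<Rightarrow> bool" where
  "complex_primitive_subequation X F \<longleftrightarrow>
     closedin (top_of_set (complex_jets X)) F \<and>
     (\<forall>z\<in>X. \<forall>r p A P. (r, p, A) \<in> jet_fibre F z \<longrightarrow> P \<in> PosC \<longrightarrow> (r, p, A + P) \<in> jet_fibre F z)"

text \<open>
  The identification of \<open>\<complex>\<^sup>n\<close> with \<open>\<real>\<^bsup>2n\<^esup>\<close>, \<open>x + iy \<leftrightarrow> (x, y)\<close>: the index \<open>Inl k\<close> carries the
  real part and \<open>Inr k\<close> the imaginary part of the \<open>k\<close>-th coordinate.
\<close>

definition realify :: "complex^'n \<Rightarrow> real^('n + 'n)" where
  "realify z = vec_pair (\<chi> k. Re (z $ k)) (\<chi> k. Im (z $ k))"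

definition complexify :: "real^('n + 'n) \<Rightarrow> complex^'n" where
  "complexify v = (\<chi> k. Complex (vec_fst v $ k) (vec_snd v $ k))"

definition complex_part :: "real^('n + 'n)^('n + 'n) \<Rightarrow> complex^'n^'n" where
  "complex_part A = (\<chi> i j.
     1/2 * complex_of_real (block_11 A $ i $ j + block_22 A $ i $ j)
     + \<i>/2 * complex_of_real (block_21 A $ i $ j - block_12 A $ i $ j))"

definition complex_subharmonic ::
  "((complex^'n) \<times> 'n complex_jet) set \<Rightarrow> (complex^'n) set \<Rightarrow> (complex^'n \<Rightarrow> ereal) \<Rightarrow> bool" where
  "complex_subharmonic F \<Omega> f \<longleftrightarrow>
     (\<forall>z\<in>\<Omega>. f z \<noteq> \<infinity>) \<and> usc_on \<Omega> f \<and>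
     (\<forall>z\<in>\<Omega>. \<forall>p A. upper_contact_jet (f \<circ> complexify) (realify z) p A
        \<longrightarrow> (real_of_ereal (f z), complexify p, complex_part A) \<in> jet_fibre F z)"

definition complex_pseudoconvex ::
  "((complex^'n) \<times> 'n complex_jet) set \<Rightarrow> (complex^'n) set \<Rightarrow> bool" where
  "complex_pseudoconvex F \<Omega> \<longleftrightarrow>
     open \<Omega> \<and>
     (\<exists>u. continuous_on \<Omega> u \<and> exhaustive \<Omega> u \<and> complex_subharmonic F \<Omega> (\<lambda>z. ereal (u z)))"

definition complex_graph_pullback ::
  "complex^'n^'m \<Rightarrow> ('n + 'm) complex_jet \<Rightarrow> 'n complex_jet" where
  "complex_graph_pullback \<Gamma> = (\<lambda>(r, p, A).
     (r, vec_fst p + adjoint_matrix \<Gamma> *v vec_snd p,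
      block_11 A + block_12 A ** \<Gamma> + adjoint_matrix \<Gamma> ** adjoint_matrix (block_12 A)
        + adjoint_matrix \<Gamma> ** block_22 A ** \<Gamma>))"

definition complex_fibre_pullback :: "('n::finite + 'm::finite) complex_jet \<Rightarrow> 'm complex_jet" where
  "complex_fibre_pullback = (\<lambda>(r, p, A). (r, vec_snd p, block_22 A))"

definition complex_product ::
  "((complex^'n) \<times> 'n complex_jet) set \<Rightarrow> ((complex^'m) \<times> 'm complex_jet) set
     \<Rightarrow> ((complex^('n + 'm)) \<times> ('n + 'm) complex_jet) set" where
  "complex_product F G = {(z, r, p, A). A \<in> Herm \<and>
     (\<forall>\<Gamma>. complex_graph_pullback \<Gamma> (r, p, A) \<in> jet_fibre F (vec_fst z) \<and>
          complex_fibre_pullback (r, p, A) \<in> jet_fibre G (vec_snd z))}"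

definition complex_convexity_subequation :: "((complex^'m) \<times> 'm complex_jet) set" where
  "complex_convexity_subequation = {(w, r, p, A). A \<in> PosC}"

definition torus_act :: "real^'m \<Rightarrow> complex^'m \<Rightarrow> complex^'m" where
  "torus_act \<theta> w = (\<chi> j. cis (\<theta> $ j) * w $ j)"

definition torus_invariant_set :: "(complex^('n::finite + 'm::finite)) set \<Rightarrow> bool" where
  "torus_invariant_set \<Omega> \<longleftrightarrow>
     (\<forall>z w \<theta>. vec_pair z w \<in> \<Omega> \<longrightarrow> vec_pair z (torus_act \<theta> w) \<in> \<Omega>)"

definition torus_invariant_fun ::
  "(complex^('n::finite + 'm::finite)) set \<Rightarrow> (complex^('n + 'm) \<Rightarrow> ereal) \<Rightarrow> bool" where
  "torus_invariant_fun \<Omega> f \<longleftrightarrow>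
     (\<forall>z w \<theta>. vec_pair z w \<in> \<Omega> \<longrightarrow> f (vec_pair z (torus_act \<theta> w)) = f (vec_pair z w))"

definition complex_minimum_principle ::
  "'m::finite itself \<Rightarrow> (complex^'n) set \<Rightarrow> ((complex^'n) \<times> 'n complex_jet) set \<Rightarrow> bool" where
  "complex_minimum_principle _ X F \<longleftrightarrow>
     (\<forall>\<Omega> :: (complex^('n + 'm)) set.
        vec_fst ` \<Omega> \<subseteq> X \<and> \<Omega> \<noteq> {} \<and> open \<Omega> \<and> connected \<Omega> \<and>
        torus_invariant_set \<Omega> \<and>
        complex_pseudoconvex (complex_product F complex_convexity_subequation) \<Omega> \<and>
        connected_fibres \<Omega>
        \<longrightarrow>
        complex_pseudoconvex F (vec_fst ` \<Omega>) \<and>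
        (\<forall>f. torus_invariant_fun \<Omega> f \<and>
           complex_subharmonic (complex_product F complex_convexity_subequation) \<Omega> f
           \<longrightarrow> complex_subharmonic F (vec_fst ` \<Omega>) (marginal \<Omega> f)))"

end

theory Submission
  imports Defs "HOL-Real_Asymp.Real_Asymp"
begin

text \<open>
  A closed convex subequation with Negativity and constant coefficients is an intersection of
  half-spaces \<open>c \<le> (\<Sum>s. A(s, s)) + p \<bullet> b - a r\<close> with \<open>a \<ge> 0\<close>, so it suffices to treat one linear
  viscosity inequality at a time. Given an exhaustion \<open>u\<close>, replacing \<open>f\<close> by \<open>max f (u - j)\<close> and letting
  \<open>j \<rightarrow> \<infinity>\<close> reduces to the case that almost-minimizers stay in a convex set.
  If a quadratic \<open>q\<close> with \<open>L q < c\<close> touches the marginal function \<open>g\<close> from above at \<open>x0\<close>, choose a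
  trigonometric polynomial \<open>Z\<close> with \<open>f(x, Z x) < q(x) + \<eta>\<close> and let \<open>U\<close> be its evolution under
  the heat equation \<open>U\<^sub>t = (\<Sum>s. U\<^sub>s\<^sub>s)\<close>. Penalizing \<open>N |y - U(t, x)|\<^sup>2\<close> and testing with
  \<open>\<Gamma> = D\<^sub>x U\<close> shows that \<open>f(x, U(t, x))\<close> is a subsolution of the parabolic equation, because along the graph
  directions the contribution of the penalty is exactly cancelled by its time derivative. Comparison with
  a supersolution starting from \<open>q + \<eta>\<close> gives \<open>f(x0, U(\<tau>, x0)) < q(x0) = g(x0)\<close>, a contradiction.
  In the complex case the coordinates \<open>s = log |w|\<close> turn \<open>f\<close> into a function on \<open>\<complex>\<^sup>n \<times> \<real>\<^sup>m\<close> to which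
  the same inequality applies: every real-linear \<open>\<Gamma>\<close> into \<open>\<real>\<^sup>m\<close> is the real part of a complex-linear map.
\<close>

section \<open>Second-order jets of functions\<close>

text \<open>For smooth data the slope \<open>\<Gamma>\<close> would be the derivative of the
  minimizer \<open>y(x)\<close>; here \<open>f\<close> is only upper semicontinuous, so there is
  neither a differentiable minimizer nor a second derivative to evaluate. Following a fixed
  approximately minimizing graph \<open>y = Z x\<close> with the penalty
  \<open>N |y - Z x|^2\<close> does not suffice: with \<open>\<Gamma> = DZ\<close> the quadratic
  part of the penalty dies on the graph directions, but
  \<open>-2 N (y - Z x) \<bullet> (\<Sum>s. D^2 Z(s, s))\<close> survives, and
  \<open>N |y - Z x|\<close> is not known to stay bounded. Letting the graph move makes this
  remainder equal to the time derivative of the penalty, and the heat equation is the law that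
  achieves it. The drift \<open>b\<close> does not enter the flow, since the first-order part of the
  penalty already vanishes for \<open>\<Gamma> b = DU b\<close>. Time is paid for by the strict gap
  in \<open>L q < c\<close>. The moving graph must stay where \<open>f\<close> is controlled: finite
  sums of cosines give explicit solutions, and averaging gives invariance of convex sets. Convexity
  in the fibres enters through convex sublevel sets.\<close>

definition quadform :: "('a::euclidean_space \<Rightarrow> 'b::euclidean_space) \<Rightarrow> bool" where
  "quadform Q \<longleftrightarrow> (\<exists>B. bilinear B \<and> (\<forall>v. Q v = B v v))"

text \<open>A pointwise Taylor expansion with remainder \<open>o(|v|^2)\<close>: \<open>P\<close> is
  the gradient and \<open>Q\<close> the Hessian form. It concerns the single point \<open>z\<close>,
  so test functions can be assembled there by sums and the chain rule; vector values are needed for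
  the moving graph.\<close>

definition jet2 ::
  "('a::euclidean_space \<Rightarrow> 'b::euclidean_space) \<Rightarrow> 'a \<Rightarrow> ('a \<Rightarrow> 'b) \<Rightarrow> ('a \<Rightarrow> 'b) \<Rightarrow> bool" where
  "jet2 F z P Q \<longleftrightarrow> linear P \<and> quadform Q \<and>
     (\<forall>e>0. \<forall>\<^sub>F v in nhds 0. norm (F (z + v) - F z - P v - (1/2) *\<^sub>R Q v) \<le> e * (norm v)\<^sup>2)"

lemma bilinearI:
  assumes "\<And>x y z. B (x + y) z = B x z + B y z" "\<And>x y z. B x (y + z) = B x y + B x z"
    "\<And>c x y. B (c *\<^sub>R x) y = c *\<^sub>R B x y" "\<And>c x y. B x (c *\<^sub>R y) = c *\<^sub>R B x y"
  shows "bilinear B"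
  unfolding bilinear_def using assms by (auto intro!: linearI)

lemma quadform_0 [simp]: "quadform (\<lambda>v. 0)"
  unfolding quadform_def by (rule exI[of _ "\<lambda>x y. 0"]) (auto intro: bilinearI)

lemma quadform_add:
  assumes "quadform Q" "quadform R" shows "quadform (\<lambda>v. Q v + R v)"
proof -
  obtain B C where "bilinear B" "\<And>v. Q v = B v v" "bilinear C" "\<And>v. R v = C v v"
    using assms unfolding quadform_def by blast
  then show ?thesis unfolding quadform_def
    by (intro exI[of _ "\<lambda>x y. B x y + C x y"])
       (auto intro!: bilinearI simp: bilinear_ladd bilinear_radd bilinear_lmul bilinear_rmul algebra_simps)
qed

lemma quadform_linear_comp:
  assumes "quadform Q" "linear L" shows "quadform (\<lambda>v. L (Q v))"
proof -
  obtain B where "bilinear B" "\<And>v. Q v = B v v"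
    using assms unfolding quadform_def by blast
  then show ?thesis using assms(2) unfolding quadform_def
    by (intro exI[of _ "\<lambda>x y. L (B x y)"])
       (auto intro!: bilinearI simp: bilinear_ladd bilinear_radd bilinear_lmul bilinear_rmul linear_add linear_cmul)
qed

lemma quadform_comp_linear:
  assumes "quadform Q" "linear L" shows "quadform (\<lambda>v. Q (L v))"
proof -
  obtain B where "bilinear B" "\<And>v. Q v = B v v"
    using assms unfolding quadform_def by blast
  then show ?thesis using assms(2) unfolding quadform_def
    by (intro exI[of _ "\<lambda>x y. B (L x) (L y)"])
       (auto intro!: bilinearI simp: bilinear_ladd bilinear_radd bilinear_lmul bilinear_rmul linear_add linear_cmul)
qed

lemma quadform_inner:
  assumes "linear L" "linear M" shows "quadform (\<lambda>v. L v \<bullet> M v)"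
  unfolding quadform_def using assms
  by (intro exI[of _ "\<lambda>x y. L x \<bullet> M y"])
     (auto intro!: bilinearI simp: linear_add linear_cmul inner_add_left inner_add_right)

lemma quadform_norm2 [simp]: "quadform (\<lambda>v::'a::euclidean_space. (norm v)\<^sup>2)"
  using quadform_inner[of "\<lambda>v::'a. v" "\<lambda>v. v"] by (simp add: linear_id[unfolded id_def] power2_norm_eq_inner)

lemma quadform_sym:
  assumes "quadform Q"
  obtains B where "bilinear B" "\<And>v w. B v w = B w v" "\<And>v. Q v = B v v"
proof -
  obtain B where B: "bilinear B" "\<And>v. Q v = B v v"
    using assms unfolding quadform_def by blast
  show ?thesis
  proof (rule that[of "\<lambda>x y. (1/2) *\<^sub>R (B x y + B y x)"])
    show "bilinear (\<lambda>x y. (1/2) *\<^sub>R (B x y + B y x))"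
      by (auto intro!: bilinearI simp: B bilinear_ladd bilinear_radd bilinear_lmul bilinear_rmul algebra_simps)
    show "Q v = (1/2) *\<^sub>R (B v v + B v v)" for v
      unfolding B(2) scaleR_2[symmetric] by simp
  qed (simp add: add.commute)
qed

lemma quadform_zero: assumes "quadform Q" shows "Q 0 = 0"
proof -
  obtain B where B: "bilinear B" "\<And>v. Q v = B v v"
    using assms unfolding quadform_def by blast
  show ?thesis using B bilinear_lzero by metis
qed

lemma quadform_scaleR: assumes "quadform Q" shows "Q (c *\<^sub>R v) = c\<^sup>2 *\<^sub>R Q v"
proof -
  obtain B where B: "bilinear B" "\<And>v. Q v = B v v"
    using assms unfolding quadform_def by blast
  show ?thesis by (simp add: B bilinear_lmul bilinear_rmul power2_eq_square)
qed

lemma quadform_bound: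
  assumes "quadform Q"
  obtains K where "K > 0" "\<And>v. norm (Q v) \<le> K * (norm v)\<^sup>2"
proof -
  obtain B where B: "bilinear B" "\<And>v. Q v = B v v"
    using assms unfolding quadform_def by blast
  obtain K where "K > 0" "\<And>x y. norm (B x y) \<le> K * norm x * norm y"
    using bilinear_bounded_pos[OF B(1)] by blast
  then show ?thesis using that[of K] B by (metis power2_eq_square mult.assoc)
qed

section \<open>Jet calculus: sums, chain rule and basic examples\<close>

lemma jet2_exact:
  assumes "linear P" "quadform Q" "\<And>v. F (z + v) = F z + P v + (1/2) *\<^sub>R Q v"
  shows "jet2 F z P Q"
  unfolding jet2_def using assms by simp

lemma jet2_const [intro]: "jet2 (\<lambda>_. c) z (\<lambda>v. 0) (\<lambda>v. 0)"
  by (rule jet2_exact) (auto simp: linear_zero)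

lemma jet2_linear: "linear L \<Longrightarrow> jet2 L z L (\<lambda>v. 0)"
  by (rule jet2_exact) (auto simp: linear_add)

lemma jet2_upper_estimate:
  fixes F :: "'a::euclidean_space \<Rightarrow> real"
  assumes "jet2 F z P Q" "e > 0"
  obtains d where "d > 0" "\<And>x. dist x z < d \<Longrightarrow> F x - F z \<le> P (x - z) + (1/2) * Q (x - z) + e * (norm (x - z))\<^sup>2"
proof -
  have "\<forall>\<^sub>F v in nhds 0. norm (F (z + v) - F z - P v - (1/2) *\<^sub>R Q v) \<le> e * (norm v)\<^sup>2"
    using assms unfolding jet2_def by blast
  then obtain d where d: "d > 0" "\<And>v. norm v < d \<Longrightarrow> norm (F (z + v) - F z - P v - (1/2) *\<^sub>R Q v) \<le> e * (norm v)\<^sup>2"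
    unfolding eventually_nhds_metric by (auto simp: dist_norm)
  show ?thesis
  proof (rule that[OF d(1)])
    fix x assume "dist x z < d"
    then have "norm (F (z + (x - z)) - F z - P (x - z) - (1/2) *\<^sub>R Q (x - z)) \<le> e * (norm (x - z))\<^sup>2"
      by (intro d(2)) (simp add: dist_norm)
    moreover have "z + (x - z) = x" by simp
    ultimately have "F x - F z - P (x - z) - (1/2) * Q (x - z) \<le> e * (norm (x - z))\<^sup>2"
      unfolding real_norm_def real_scaleR_def by (metis abs_le_D1)
    then show "F x - F z \<le> P (x - z) + (1/2) * Q (x - z) + e * (norm (x - z))\<^sup>2" by argo
  qed
qed

lemma jet2_add:
  assumes "jet2 F z P Q" "jet2 G z P' Q'"
  shows "jet2 (\<lambda>x. F x + G x) z (\<lambda>v. P v + P' v) (\<lambda>v. Q v + Q' v)"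
  unfolding jet2_def
proof (intro conjI allI impI)
  show "linear (\<lambda>v. P v + P' v)" "quadform (\<lambda>v. Q v + Q' v)"
    using assms unfolding jet2_def by (auto intro: linear_compose_add quadform_add)
  fix e :: real assume "e > 0"
  then have "e/2 > 0" by simp
  then have "\<forall>\<^sub>F v in nhds 0. norm (F (z + v) - F z - P v - (1/2) *\<^sub>R Q v) \<le> (e/2) * (norm v)\<^sup>2"
    "\<forall>\<^sub>F v in nhds 0. norm (G (z + v) - G z - P' v - (1/2) *\<^sub>R Q' v) \<le> (e/2) * (norm v)\<^sup>2"
    using assms unfolding jet2_def by blast+
  then show "\<forall>\<^sub>F v in nhds 0. norm (F (z + v) + G (z + v) - (F z + G z) - (P v + P' v) - (1/2) *\<^sub>R (Q v + Q' v)) \<le> e * (norm v)\<^sup>2"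
  proof eventually_elim
    case (elim v)
    have "F (z + v) + G (z + v) - (F z + G z) - (P v + P' v) - (1/2) *\<^sub>R (Q v + Q' v)
       = (F (z + v) - F z - P v - (1/2) *\<^sub>R Q v) + (G (z + v) - G z - P' v - (1/2) *\<^sub>R Q' v)"
      by (simp add: algebra_simps)
    then show ?case using elim
      by (smt (verit, best) norm_triangle_ineq field_sum_of_halves distrib_right)
  qed
qed

lemma eventually_norm_small:
  fixes d :: real assumes "d > 0" shows "\<forall>\<^sub>F v::'a::real_normed_vector in nhds 0. norm v < d"
  unfolding eventually_nhds_metric using assms by auto

text \<open>With \<open>w = F (z + v) - F z\<close>, the error consists of the remainder of
  \<open>H\<close> at \<open>w\<close>, of \<open>P'\<close> applied to the remainder of
  \<open>F\<close>, and of half of \<open>B' w w - B' (P v) (P v)\<close>. The last is cubic in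
  \<open>v\<close>, since \<open>w - P v\<close> is quadratic. Each is kept below \<open>e/3\<close>
  times \<open>|v|^2\<close>.\<close>

lemma jet2_compose:
  assumes F: "jet2 F z P Q" and H: "jet2 H (F z) P' Q'"
    and B': "bilinear B'" "\<And>v. Q' v = B' v v"
  shows "jet2 (\<lambda>x. H (F x)) z (\<lambda>v. P' (P v)) (\<lambda>v. P' (Q v) + Q' (P v))"
  unfolding jet2_def
proof (intro conjI allI impI)
  have lin: "linear P" "linear P'" and q: "quadform Q" "quadform Q'"
    using F H unfolding jet2_def by auto
  show "linear (\<lambda>v. P' (P v))" using linear_compose[OF lin] by (simp add: o_def)
  show "quadform (\<lambda>v. P' (Q v) + Q' (P v))"
    by (rule quadform_add[OF quadform_linear_comp[OF q(1) lin(2)] quadform_comp_linear[OF q(2) lin(1)]])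
  fix e :: real assume e: "e > 0"
  obtain K1 where K1: "K1 > 0" "\<And>v. norm (P v) \<le> K1 * norm v"
    using linear_bounded_pos[OF lin(1)] by blast
  obtain K3 where K3: "K3 > 0" "\<And>v. norm (P' v) \<le> K3 * norm v"
    using linear_bounded_pos[OF lin(2)] by blast
  obtain K2 where K2: "K2 > 0" "\<And>v. norm (Q v) \<le> K2 * (norm v)\<^sup>2"
    using quadform_bound[OF q(1)] by blast
  obtain K4 where K4: "K4 > 0" "\<And>x y. norm (B' x y) \<le> K4 * norm x * norm y"
    using bilinear_bounded_pos[OF B'(1)] by blast
  \<comment> \<open>The cap 1 in \<open>e1\<close> and \<open>1 / (K2+1)\<close> in \<open>d\<close>
    give the linear bound \<open>|w| <= (K1+1) |v|\<close>; the other quotients are what the three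
    error terms require.\<close>
  define e1 where "e1 = min 1 (e / (3 * K3))"
  define e2 where "e2 = e / (3 * (K1+1)\<^sup>2)"
  define d where "d = min (1 / (K2+1)) (e / (3 * K4 * (K2+1) * (2*K1+1)))"
  have pos: "e1 > 0" "e2 > 0" "d > 0" using e K1 K2 K3 K4 by (auto simp: e1_def e2_def d_def)
  have ev1: "\<forall>\<^sub>F v in nhds 0. norm (F (z + v) - F z - P v - (1/2) *\<^sub>R Q v) \<le> e1 * (norm v)\<^sup>2"
    using F pos unfolding jet2_def by auto
  have wb: "norm (F (z+v) - F z) \<le> (K1+1) * norm v" and wb2: "norm (F (z+v) - F z - P v) \<le> (K2+1) * (norm v)\<^sup>2"
    if "norm (F (z + v) - F z - P v - (1/2) *\<^sub>R Q v) \<le> e1 * (norm v)\<^sup>2" "norm v < d" for v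
  proof -
    have "F (z+v) - F z - P v = (F (z + v) - F z - P v - (1/2) *\<^sub>R Q v) + (1/2) *\<^sub>R Q v" by simp
    then have "norm (F (z+v) - F z - P v) \<le> e1 * (norm v)\<^sup>2 + norm ((1/2) *\<^sub>R Q v)"
      using that norm_triangle_ineq by (smt (verit))
    also have "norm ((1/2) *\<^sub>R Q v) \<le> K2 * (norm v)\<^sup>2"
      using K2(2)[of v] norm_ge_zero[of "Q v"] by (simp del: norm_ge_zero)
    also have "e1 * (norm v)\<^sup>2 \<le> 1 * (norm v)\<^sup>2" by (rule mult_right_mono) (auto simp: e1_def)
    finally show 2: "norm (F (z+v) - F z - P v) \<le> (K2+1) * (norm v)\<^sup>2" by (simp add: algebra_simps)
    have "(K2+1) * norm v \<le> 1"
    proof -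
      have "norm v \<le> 1/(K2+1)" using that unfolding d_def by simp
      then show ?thesis using K2 by (simp add: field_simps)
    qed
    then have "(K2+1) * (norm v)\<^sup>2 \<le> norm v"
      using mult_right_mono[of "(K2+1) * norm v" 1 "norm v"] by (simp add: power2_eq_square)
    moreover have "norm (F (z+v) - F z) \<le> norm (F (z+v) - F z - P v) + norm (P v)"
      using norm_triangle_ineq[of "F (z+v) - F z - P v" "P v"] by simp
    ultimately show "norm (F (z+v) - F z) \<le> (K1+1) * norm v"
      using 2 K1(2)[of v] by (simp add: algebra_simps)
  qed
  have small: "\<forall>\<^sub>F v::'a in nhds 0. norm v < d" by (rule eventually_norm_small) (rule pos)
  have H2: "\<forall>\<^sub>F w in nhds 0. norm (H (F z + w) - H (F z) - P' w - (1/2) *\<^sub>R Q' w) \<le> e2 * (norm w)\<^sup>2"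
    using H pos unfolding jet2_def by auto
  then obtain d2 where d2: "d2 > 0" "\<And>w. norm w < d2 \<Longrightarrow> norm (H (F z + w) - H (F z) - P' w - (1/2) *\<^sub>R Q' w) \<le> e2 * (norm w)\<^sup>2"
    unfolding eventually_nhds_metric by (auto simp: dist_norm)
  have small2: "\<forall>\<^sub>F v::'a in nhds 0. norm v < d2 / (K1+1)"
    by (rule eventually_norm_small) (use d2 K1 in auto)
  show "\<forall>\<^sub>F v in nhds 0. norm (H (F (z + v)) - H (F z) - P' (P v) - (1/2) *\<^sub>R (P' (Q v) + Q' (P v))) \<le> e * (norm v)\<^sup>2"
    using ev1 small small2
  proof eventually_elim
    case (elim v)
    define w where "w = F (z+v) - F z"
    define R where "R = w - P v - (1/2) *\<^sub>R Q v"
    have w1: "norm w \<le> (K1+1) * norm v" and w2: "norm (w - P v) \<le> (K2+1) * (norm v)\<^sup>2"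
      using wb wb2 elim unfolding w_def by blast+
    have "norm w < d2" using w1 elim(3) K1 by (simp add: pos_less_divide_eq mult.commute)
    then have a: "norm (H (F z + w) - H (F z) - P' w - (1/2) *\<^sub>R Q' w) \<le> e2 * (norm w)\<^sup>2" by (rule d2)
    also have "\<dots> \<le> e2 * ((K1+1) * norm v)\<^sup>2"
      using w1 pos by (intro mult_left_mono power_mono) auto
    also have "\<dots> = (e/3) * (norm v)\<^sup>2" unfolding e2_def power_mult_distrib using K1 by (simp add: field_simps)
    finally have a: "norm (H (F z + w) - H (F z) - P' w - (1/2) *\<^sub>R Q' w) \<le> (e/3) * (norm v)\<^sup>2" .
    have "norm (P' R) \<le> K3 * norm R" by (rule K3)
    also have "\<dots> \<le> K3 * (e1 * (norm v)\<^sup>2)" using elim(1) K3(1) unfolding R_def w_def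
      by (intro mult_left_mono) auto
    also have "\<dots> \<le> K3 * (e/(3*K3) * (norm v)\<^sup>2)"
      using K3(1) by (intro mult_left_mono mult_right_mono) (auto simp: e1_def)
    also have "\<dots> = (e/3) * (norm v)\<^sup>2" using K3(1) by simp
    finally have b: "norm (P' R) \<le> (e/3) * (norm v)\<^sup>2" .
    have "B' w w - B' (P v) (P v) = B' (w - P v) w + B' (P v) (w - P v)"
      by (simp add: bilinear_lsub[OF B'(1)] bilinear_rsub[OF B'(1)])
    then have "norm (B' w w - B' (P v) (P v)) \<le> norm (B' (w - P v) w) + norm (B' (P v) (w - P v))"
      by (simp add: norm_triangle_ineq)
    also have "\<dots> \<le> K4 * norm (w - P v) * norm w + K4 * norm (P v) * norm (w - P v)"
      using K4(2) by (meson add_mono)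
    also have "\<dots> = K4 * norm (w - P v) * (norm w + norm (P v))" by (simp add: algebra_simps)
    also have "\<dots> \<le> K4 * ((K2+1) * (norm v)\<^sup>2) * ((2*K1+1) * norm v)"
      using K4(1) K2(1) w1 w2 K1(2)[of v] by (intro mult_mono mult_left_mono) (auto simp: algebra_simps)
    also have "\<dots> = (K4 * (K2+1) * (2*K1+1) * norm v) * (norm v)\<^sup>2" by (simp add: algebra_simps)
    also have "\<dots> \<le> (e/3) * (norm v)\<^sup>2"
    proof (rule mult_right_mono)
      have "norm v \<le> e / (3 * K4 * (K2+1) * (2*K1+1))" using elim(2) by (simp add: d_def)
      moreover have "3 * K4 * (K2+1) * (2*K1+1) > 0" using K4(1) K2(1) K1(1) by simp
      ultimately have "norm v * (3 * K4 * (K2+1) * (2*K1+1)) \<le> e" by (simp only: pos_le_divide_eq)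
      moreover have "norm v * (3 * K4 * (K2+1) * (2*K1+1)) = 3 * (K4 * (K2+1) * (2*K1+1) * norm v)"
        by (simp only: mult_ac)
      ultimately show "K4 * (K2+1) * (2*K1+1) * norm v \<le> e/3" by linarith
    qed simp
    finally have c: "norm (B' w w - B' (P v) (P v)) \<le> (e/3) * (norm v)\<^sup>2" .
    have Pw: "P' w = P' (P v) + (1/2) *\<^sub>R P' (Q v) + P' R"
      unfolding R_def using lin(2) by (simp add: linear_diff linear_cmul)
    define X where "X = H (F z + w) - H (F z) - P' w - (1/2) *\<^sub>R Q' w"
    define Y where "Y = (1/2) *\<^sub>R (B' w w - B' (P v) (P v))"
    have "norm (H (F (z + v)) - H (F z) - P' (P v) - (1/2) *\<^sub>R (P' (Q v) + Q' (P v))) = norm ((X + P' R) + Y)"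
      unfolding X_def Y_def Pw B'(2) by (simp add: w_def scaleR_diff_right scaleR_add_right diff_diff_eq add.assoc)
    moreover have "norm Y = norm (B' w w - B' (P v) (P v)) / 2" unfolding Y_def by simp
    then have "norm Y \<le> (e/3) * (norm v)\<^sup>2"
      using c norm_ge_zero[of Y] by linarith
    moreover have "norm X \<le> (e/3) * (norm v)\<^sup>2" using a unfolding X_def .
    moreover have "norm ((X + P' R) + Y) \<le> norm X + norm (P' R) + norm Y"
      using norm_triangle_ineq[of "X + P' R" Y] norm_triangle_ineq[of X "P' R"] by linarith
    ultimately show ?case using b by linarith
  qed
qed

lemma jet2_comp:
  assumes "jet2 F z P Q" "jet2 H (F z) P' Q'"
  shows "jet2 (\<lambda>x. H (F x)) z (\<lambda>v. P' (P v)) (\<lambda>v. P' (Q v) + Q' (P v))"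
proof -
  obtain B where "bilinear B" "\<And>v. Q' v = B v v" using assms(2) unfolding jet2_def quadform_def by blast
  then show ?thesis using jet2_compose assms by blast
qed

lemma jet2_comp_linear:
  assumes "jet2 H (L z) P' Q'" "linear L"
  shows "jet2 (\<lambda>x. H (L x)) z (\<lambda>v. P' (L v)) (\<lambda>v. Q' (L v))"
  using jet2_comp[OF jet2_linear[OF assms(2)] assms(1)] assms(1)
  by (simp add: jet2_def linear_0)

lemma jet2_linear_left:
  assumes "jet2 F z P Q" "linear L"
  shows "jet2 (\<lambda>x. L (F x)) z (\<lambda>v. L (P v)) (\<lambda>v. L (Q v))"
  using jet2_comp[OF assms(1) jet2_linear[OF assms(2)]] by simp

lemma jet2_scaleR_left:
  assumes "jet2 (F::'a::euclidean_space \<Rightarrow> real) z P Q"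
  shows "jet2 (\<lambda>x. F x *\<^sub>R c) z (\<lambda>v. P v *\<^sub>R c) (\<lambda>v. Q v *\<^sub>R c)"
  using jet2_linear_left[OF assms, of "\<lambda>r. r *\<^sub>R c"] by (simp add: linear_iff algebra_simps)

lemma jet2_cmult:
  assumes "jet2 (F::'a::euclidean_space \<Rightarrow> real) z P Q"
  shows "jet2 (\<lambda>x. c * F x) z (\<lambda>v. c * P v) (\<lambda>v. c * Q v)"
  using jet2_linear_left[OF assms, of "\<lambda>r. c * r"] by (simp add: linear_iff algebra_simps)

lemma jet2_norm2: "jet2 (\<lambda>v::'a::euclidean_space. (norm v)\<^sup>2) z (\<lambda>v. 2 * (z \<bullet> v)) (\<lambda>v. 2 * (norm v)\<^sup>2)"
  using quadform_linear_comp[OF quadform_norm2, of "\<lambda>r. 2 * r"]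
  by (intro jet2_exact) (auto simp: power2_norm_eq_inner linear_iff inner_commute algebra_simps)

lemma jet2_norm2_comp:
  assumes "jet2 F z P Q"
  shows "jet2 (\<lambda>x. (norm (F x))\<^sup>2) z (\<lambda>v. 2 * (F z \<bullet> P v)) (\<lambda>v. 2 * (F z \<bullet> Q v) + 2 * (norm (P v))\<^sup>2)"
  using jet2_comp[OF assms jet2_norm2] .

lemma jet2_power2_comp:
  fixes F :: "'a::euclidean_space \<Rightarrow> real"
  assumes "jet2 F z P Q"
  shows "jet2 (\<lambda>x. (F x)\<^sup>2) z (\<lambda>v. 2 * (F z * P v)) (\<lambda>v. 2 * (F z * Q v) + 2 * (P v)\<^sup>2)"
  using jet2_norm2_comp[OF assms] by simp

lemma jet2_quadratic:
  assumes P: "linear (P::'a::euclidean_space \<Rightarrow> real)" and B: "bilinear B" "\<And>v w. B v w = B w v"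
  shows "jet2 (\<lambda>x. P (x - x0) + (1/2) * B (x - x0) (x - x0)) z (\<lambda>v. P v + B (z - x0) v) (\<lambda>v. B v v)"
proof (rule jet2_exact)
  show "linear (\<lambda>v. P v + B (z - x0) v)"
    using P B(1) by (auto intro!: linear_compose_add simp: bilinear_def)
  show "quadform (\<lambda>v. B v v)" unfolding quadform_def using B by blast
  fix v
  have "z + v - x0 = (z - x0) + v" by simp
  then show "P (z + v - x0) + (1/2) * B (z + v - x0) (z + v - x0)
     = P (z - x0) + (1/2) * B (z - x0) (z - x0) + (P v + B (z - x0) v) + (1/2) *\<^sub>R B v v"
    by (simp only: linear_add[OF P] bilinear_ladd[OF B(1)] bilinear_radd[OF B(1)] B(2)[of v "z - x0"])
       (simp add: algebra_simps)
qed

text \<open>The remainder \<open>G\<close> has derivative \<open>f' (x + s) - f' x - d * s\<close>,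
  of size at most \<open>e |s|\<close> by differentiability of \<open>f'\<close> at
  \<open>x\<close>. The mean value inequality on the ball of radius \<open>|v|\<close> turns this
  into \<open>e |v|^2\<close>.\<close>

lemma jet2_real:
  fixes f f' :: "real \<Rightarrow> real"
  assumes f: "\<forall>\<^sub>F y in nhds x. (f has_real_derivative f' y) (at y)"
    and f': "(f' has_real_derivative d) (at x)"
  shows "jet2 f x (\<lambda>h. f' x * h) (\<lambda>h. d * h\<^sup>2)"
  unfolding jet2_def
proof (intro conjI allI impI)
  show "linear (\<lambda>h. f' x * h)" by (auto simp: linear_iff algebra_simps)
  show "quadform (\<lambda>h. d * h\<^sup>2)" unfolding quadform_def
    by (rule exI[of _ "\<lambda>a b. d * a * b"]) (auto intro!: bilinearI simp: algebra_simps power2_eq_square)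
  fix e :: real assume e: "e > 0"
  have "(f' has_derivative (\<lambda>h. h * d)) (at x)" using f' unfolding has_field_derivative_def mult_commute_abs[of d] .
  then obtain \<delta> where \<delta>: "\<delta> > 0" "\<And>y. norm (y - x) < \<delta> \<Longrightarrow> norm (f' y - f' x - (y - x) * d) \<le> e * norm (y - x)"
    unfolding has_derivative_at_alt using e by blast
  obtain \<delta>' where \<delta>': "\<delta>' > 0" "\<And>y. dist y x < \<delta>' \<Longrightarrow> (f has_real_derivative f' y) (at y)"
    using f unfolding eventually_nhds_metric by auto
  show "\<forall>\<^sub>F v in nhds 0. norm (f (x + v) - f x - f' x * v - (1/2) *\<^sub>R (d * v\<^sup>2)) \<le> e * (norm v)\<^sup>2"
    unfolding eventually_nhds_metric
  proof (intro exI[of _ "min \<delta> \<delta>'"] conjI allI impI)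
    show "min \<delta> \<delta>' > 0" using \<delta> \<delta>' by simp
    fix v :: real assume v: "dist v 0 < min \<delta> \<delta>'"
    define G where "G = (\<lambda>s. f (x + s) - f x - f' x * s - (1/2) * (d * s\<^sup>2))"
    have G': "(G has_derivative (\<lambda>h. h * (f' (x + s) - f' x - d * s))) (at s within A)" if "norm s < min \<delta> \<delta>'" for s A
    proof -
      have "(f has_real_derivative f' (x + s)) (at (x + s))" using that by (intro \<delta>') (simp add: dist_norm)
      then have "((\<lambda>s. f (x + s)) has_real_derivative f' (x + s)) (at s)"
        using DERIV_shift[of f "f' (x+s)" s x] by (simp add: add.commute)
      then have "(G has_real_derivative (f' (x + s) - f' x - d * s)) (at s)"
        unfolding G_def by (auto intro!: derivative_eq_intros)
      then show ?thesis unfolding has_field_derivative_def mult_commute_abs[of "f' (x + s) - f' x - d * s"]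
        by (rule has_derivative_at_withinI)
    qed
    have "norm (G v - G 0) \<le> (e * norm v) * norm (v - 0)"
    proof (rule differentiable_bound[where S = "cball 0 (norm v)" and f' = "\<lambda>s h. h * (f' (x + s) - f' x - d * s)"])
      fix s :: real assume s: "s \<in> cball 0 (norm v)"
      then have s': "norm s < min \<delta> \<delta>'" using v by simp
      show "(G has_derivative (\<lambda>h. h * (f' (x + s) - f' x - d * s))) (at s within cball 0 (norm v))"
        by (rule G'[OF s'])
      have "norm (f' (x + s) - f' x - d * s) \<le> e * norm s"
        using \<delta>(2)[of "x + s"] s' by (simp add: mult.commute)
      also have "\<dots> \<le> e * norm v" using s e by simp
      finally show "onorm (\<lambda>h. h * (f' (x + s) - f' x - d * s)) \<le> e * norm v"
        by (intro onorm_le) (simp add: abs_mult mult.commute mult_left_mono)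
    qed auto
    then show "norm (f (x + v) - f x - f' x * v - (1/2) *\<^sub>R (d * v\<^sup>2)) \<le> e * (norm v)\<^sup>2"
      by (simp add: G_def power2_eq_square)
  qed
qed

section \<open>Upper semicontinuity and viscosity inequalities\<close>

lemma usc_onD:
  assumes "usc_on S f" "x \<in> S" "f x < a"
  obtains U where "open U" "x \<in> U" "\<And>y. y \<in> U \<Longrightarrow> y \<in> S \<Longrightarrow> f y < a"
proof -
  have "openin (top_of_set S) {x \<in> S. f x < a}" using assms(1) unfolding usc_on_def by blast
  then obtain U where U: "open U" "{x \<in> S. f x < a} = S \<inter> U" unfolding openin_open by auto
  with assms(2,3) show ?thesis by (intro that[of U]) auto
qed

lemma usc_onI:
  assumes "\<And>x a. x \<in> S \<Longrightarrow> f x < a \<Longrightarrow> \<exists>U. open U \<and> x \<in> U \<and> (\<forall>y\<in>U \<inter> S. f y < a)"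
  shows "usc_on S f"
  unfolding usc_on_def
proof
  fix a
  show "openin (top_of_set S) {x \<in> S. f x < a}"
    unfolding openin_subopen[of _ "{x \<in> S. f x < a}"]
  proof
    fix x assume x: "x \<in> {x \<in> S. f x < a}"
    then obtain U where U: "open U" "x \<in> U" "\<forall>y\<in>U \<inter> S. f y < a" using assms by blast
    show "\<exists>T. openin (top_of_set S) T \<and> x \<in> T \<and> T \<subseteq> {x \<in> S. f x < a}"
      by (rule exI[of _ "S \<inter> U"]) (use U x in auto)
  qed
qed

lemma usc_on_subset:
  assumes "usc_on S f" "T \<subseteq> S" shows "usc_on T f"
proof (rule usc_onI)
  fix x a assume "x \<in> T" "f x < a"
  then obtain U where "open U" "x \<in> U" "\<And>y. y \<in> U \<Longrightarrow> y \<in> S \<Longrightarrow> f y < a"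
    using usc_onD[OF assms(1), of x a] assms(2) by blast
  then show "\<exists>U. open U \<and> x \<in> U \<and> (\<forall>y\<in>U \<inter> T. f y < a)" using assms(2) by blast
qed

lemma usc_on_cong: "usc_on S f \<Longrightarrow> (\<And>x. x \<in> S \<Longrightarrow> f x = g x) \<Longrightarrow> usc_on S g"
  unfolding usc_on_def by (metis (mono_tags, lifting) Collect_cong)

lemma usc_on_compose:
  assumes "usc_on S f" "continuous_on T m" "m ` T \<subseteq> S"
  shows "usc_on T (\<lambda>x. f (m x))"
proof (rule usc_onI)
  fix x a assume "x \<in> T" "f (m x) < a"
  then obtain U where U: "open U" "m x \<in> U" "\<And>y. y \<in> U \<Longrightarrow> y \<in> S \<Longrightarrow> f y < a"
    using usc_onD[OF assms(1), of "m x" a] assms(3) by blast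
  obtain V where "open V" "V \<inter> T = m -` U \<inter> T"
    using assms(2) U(1) unfolding continuous_on_open_invariant by metis
  then show "\<exists>U. open U \<and> x \<in> U \<and> (\<forall>y\<in>U \<inter> T. f (m y) < a)"
    using U assms(3) \<open>x \<in> T\<close> by (intro exI[of _ V]) blast
qed

lemma real_below_ereal:
  assumes "ereal x < a" obtains r where "x < r" "ereal r \<le> a"
proof (cases a)
  case (real r) then show ?thesis using assms that[of r] by simp
next
  case PInf then show ?thesis using that[of "x + 1"] by simp
qed (use assms in auto)

lemma continuous_imp_usc_on:
  assumes "continuous_on S (g :: _ \<Rightarrow> real)" shows "usc_on S (\<lambda>x. ereal (g x))"
proof (rule usc_onI)
  fix x a assume x: "x \<in> S" "ereal (g x) < a"
  then obtain r where r: "g x < r" "ereal r \<le> a" using real_below_ereal by blast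
  obtain V where "open V" "V \<inter> S = g -` {..<r} \<inter> S"
    using assms open_lessThan[of r] unfolding continuous_on_open_invariant by metis
  moreover have "ereal (g y) < a" if "g y < r" for y
    using less_le_trans[OF _ r(2), of "ereal (g y)"] that by simp
  ultimately show "\<exists>U. open U \<and> x \<in> U \<and> (\<forall>y\<in>U \<inter> S. ereal (g y) < a)"
    using x r by (intro exI[of _ V]) blast
qed

lemma usc_on_add_continuous:
  assumes "usc_on S (\<lambda>x. ereal (h x))" "continuous_on S g"
  shows "usc_on S (\<lambda>x. ereal (h x + g x))"
proof (rule usc_onI)
  fix x a assume x: "x \<in> S" "ereal (h x + g x) < a"
  then obtain r where r: "h x + g x < r" "ereal r \<le> a" using real_below_ereal by blast
  define d where "d = (r - h x - g x) / 2"
  have d: "d > 0" "h x + d + (g x + d) = r" using r by (auto simp: d_def field_simps)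
  have "ereal (h x) < ereal (h x + d)" using d(1) by simp
  then obtain U where U: "open U" "x \<in> U" "\<And>y. y \<in> U \<Longrightarrow> y \<in> S \<Longrightarrow> ereal (h y) < ereal (h x + d)"
    using usc_onD[OF assms(1) x(1)] by blast
  have "ereal (g x) < ereal (g x + d)" using d(1) by simp
  then obtain V where V: "open V" "x \<in> V" "\<And>y. y \<in> V \<Longrightarrow> y \<in> S \<Longrightarrow> ereal (g y) < ereal (g x + d)"
    using usc_onD[OF continuous_imp_usc_on[OF assms(2)] x(1)] by blast
  have "ereal (h y + g y) < a" if "y \<in> U \<inter> V" "y \<in> S" for y
  proof -
    have "h y < h x + d" "g y < g x + d" using U(3)[of y] V(3)[of y] that by auto
    then have "h y + g y < r" using d(2) by linarith
    then show ?thesis using less_le_trans[OF _ r(2), of "ereal (h y + g y)"] by simp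
  qed
  then show "\<exists>U. open U \<and> x \<in> U \<and> (\<forall>y\<in>U \<inter> S. ereal (h y + g y) < a)"
    using U V by (intro exI[of _ "U \<inter> V"]) auto
qed

lemma usc_on_max:
  assumes "usc_on S f" "usc_on S g" shows "usc_on S (\<lambda>x. max (f x) (g x))"
proof -
  have "{x \<in> S. max (f x) (g x) < a} = {x \<in> S. f x < a} \<inter> {x \<in> S. g x < a}" for a by auto
  then show ?thesis using assms unfolding usc_on_def by auto
qed

text \<open>Without a maximum, each \<open>x\<close> has a neighbourhood on which \<open>f\<close>
  stays below some value \<open>f (y x)\<close>. Finitely many of them cover \<open>K\<close>, and
  the largest of their bounds is itself a value of \<open>f\<close>, hence smaller than
  itself.\<close>

lemma usc_attains_max:
  assumes K: "compact K" "K \<noteq> {}" and f: "usc_on K f"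
  obtains x where "x \<in> K" "\<And>y. y \<in> K \<Longrightarrow> f y \<le> f x"
proof (rule ccontr)
  note found = that
  assume contr: "\<not> thesis"
  have *: "\<exists>y\<in>K. f x < f y" if "x \<in> K" for x
  proof (rule ccontr)
    assume "\<not> (\<exists>y\<in>K. f x < f y)"
    then have "f y \<le> f x" if "y \<in> K" for y using that by (meson not_le_imp_less)
    then show False using found \<open>x \<in> K\<close> contr by blast
  qed
  have "\<exists>U y. open U \<and> x \<in> U \<and> y \<in> K \<and> (\<forall>z\<in>U \<inter> K. f z < f y)" if x: "x \<in> K" for x
  proof -
    obtain y where "y \<in> K" "f x < f y" using *[OF x] by blast
    with usc_onD[OF f x, of "f y"] show ?thesis by (metis IntE)
  qed
  then obtain U y where Uy: "\<And>x. x \<in> K \<Longrightarrow> open (U x) \<and> x \<in> U x \<and> y x \<in> K \<and> (\<forall>z\<in>U x \<inter> K. f z < f (y x))"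
    by metis
  have "\<forall>x\<in>K. open (U x)" "K \<subseteq> (\<Union>x\<in>K. U x)" using Uy by auto
  then obtain C where C: "C \<subseteq> K" "finite C" "K \<subseteq> (\<Union>x\<in>C. U x)"
    using compactE_image[OF K(1), of K U] by metis
  then have "C \<noteq> {}" using K by auto
  define m where "m = Max ((\<lambda>x. f (y x)) ` C)"
  have "m \<in> (\<lambda>x. f (y x)) ` C" unfolding m_def using C \<open>C \<noteq> {}\<close> by (intro Max_in) auto
  then obtain x where x: "x \<in> C" "m = f (y x)" by auto
  then have "y x \<in> K" using Uy C by auto
  then obtain x' where x': "x' \<in> C" "y x \<in> U x'" using C by auto
  then have "f (y x) < f (y x')" using Uy C \<open>y x \<in> K\<close> by blast
  moreover have "f (y x') \<le> m" unfolding m_def using C x' by (intro Max_ge) auto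
  ultimately show False using x by simp
qed

lemma usc_compact_superlevel:
  assumes "compact K" "usc_on K f"
  shows "compact {x \<in> K. a \<le> f x}"
proof -
  have "closedin (top_of_set K) (K - {x \<in> K. f x < a})"
    using assms(2) unfolding usc_on_def by (intro closedin_diff) auto
  moreover have "K - {x \<in> K. f x < a} = {x \<in> K. a \<le> f x}" by auto
  ultimately show ?thesis using assms(1) closedin_compact by metis
qed

text \<open>The points of \<open>C\<close> with \<open>F x >= F z\<close> form a compact set on
  which \<open>\<psi>\<close> is positive, hence bounded below by some \<open>m\<close>. A single
  large \<open>N\<close> makes them lose against \<open>z\<close>, so the maximum of
  \<open>F - N \<psi>\<close> avoids \<open>C\<close>; no limit in \<open>N\<close> is taken. In the
  applications \<open>\<psi>\<close> is a squared distance to a line, or fibrewise to a graph, and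
  \<open>C\<close> is a boundary.\<close>

lemma penalization:
  fixes F \<psi> :: "'a::t2_space \<Rightarrow> real"
  assumes D: "compact D" and F: "usc_on D (\<lambda>x. ereal (F x))"
    and \<psi>: "continuous_on D \<psi>" "\<And>x. x \<in> D \<Longrightarrow> 0 \<le> \<psi> x"
    and z: "z \<in> D" "\<psi> z = 0"
    and C: "C \<subseteq> D" "compact C" "\<And>x. x \<in> C \<Longrightarrow> \<psi> x = 0 \<Longrightarrow> F x < F z"
  obtains N x where "N \<ge> 0" "x \<in> D - C" "F z \<le> F x - N * \<psi> x"
    "\<And>y. y \<in> D \<Longrightarrow> F y - N * \<psi> y \<le> F x - N * \<psi> x"
proof -
  obtain xm where xm: "xm \<in> D" "\<And>y. y \<in> D \<Longrightarrow> F y \<le> F xm"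
    using usc_attains_max[OF D _ F] z by auto
  define L where "L = {x \<in> C. ereal (F z) \<le> ereal (F x)}"
  have "compact L" unfolding L_def
    by (rule usc_compact_superlevel[OF C(2) usc_on_subset[OF F C(1)]])
  have "\<exists>m>0. \<forall>x\<in>L. m \<le> \<psi> x"
  proof (cases "L = {}")
    case True then show ?thesis by (auto intro: exI[of _ 1])
  next
    case False
    have "continuous_on L \<psi>" by (rule continuous_on_subset[OF \<psi>(1)]) (use C in \<open>auto simp: L_def\<close>)
    then obtain x where x: "x \<in> L" "\<And>y. y \<in> L \<Longrightarrow> \<psi> x \<le> \<psi> y"
      using continuous_attains_inf[OF \<open>compact L\<close> False] by blast
    have "\<psi> x > 0" using x(1) C \<psi>(2)[of x] by (force simp: L_def)
    then show ?thesis using x by blast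
  qed
  then obtain m where m: "m > 0" "\<And>x. x \<in> L \<Longrightarrow> m \<le> \<psi> x" by blast
  define N where "N = (F xm - F z) / m + 1"
  have N: "N \<ge> 1" using xm(2)[OF z(1)] m by (simp add: N_def)
  have "usc_on D (\<lambda>x. ereal (F x + - (N * \<psi> x)))"
    by (intro usc_on_add_continuous F continuous_intros \<psi>)
  from usc_attains_max[OF D _ this] z obtain x where "x \<in> D"
    "\<And>y. y \<in> D \<Longrightarrow> ereal (F y + - (N * \<psi> y)) \<le> ereal (F x + - (N * \<psi> x))" by blast
  then have x: "x \<in> D" "\<And>y. y \<in> D \<Longrightarrow> F y - N * \<psi> y \<le> F x - N * \<psi> x" by auto
  have Fz: "F z \<le> F x - N * \<psi> x" using x(2)[OF z(1)] z by simp
  have "x \<notin> C"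
  proof
    assume "x \<in> C"
    have "F z \<le> F x" using Fz N \<psi>(2)[OF x(1)] by (smt (verit) mult_nonneg_nonneg)
    then have "m \<le> \<psi> x" using m \<open>x \<in> C\<close> by (auto simp: L_def)
    then have "N * m \<le> N * \<psi> x" using N by (intro mult_left_mono) auto
    moreover have "N * m = F xm - F z + m" unfolding N_def using m by (simp add: field_simps)
    ultimately show False using Fz xm(2)[OF x(1)] m by linarith
  qed
  then show ?thesis using that[of N x] N x Fz by auto
qed

section \<open>Viscosity subsolutions\<close>

text \<open>Only increments of \<open>\<phi>\<close> matter, so \<open>\<phi> z\<close> need not be
  normalized to the value of \<open>f\<close>. Nothing touches where \<open>f\<close> is infinite,
  which matches the convention for contact jets at \<open>-\<infinity>\<close>.\<close>

definition touches :: "('a::topological_space \<Rightarrow> ereal) \<Rightarrow> 'a \<Rightarrow> ('a \<Rightarrow> real) \<Rightarrow> bool" where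
  "touches f z \<phi> \<longleftrightarrow> \<bar>f z\<bar> \<noteq> \<infinity> \<and> (\<forall>\<^sub>F y in nhds z. f y \<le> f z + ereal (\<phi> y - \<phi> z))"

text \<open>
  The jets \<open>(r, p, A)\<close> satisfying \<open>c \<le> (\<Sum>s\<leftarrow>ss. s \<bullet> A s) + p \<bullet> b - a r\<close> form a half-space \<open>H\<close>.
  Then \<open>lin_sub\<close> is \<open>H\<close>-subharmonicity, while \<open>graph_sub\<close> and \<open>fibre_sub\<close> together are \<open>H#\<P>\<close>-subharmonicity.
\<close>

definition lin_sub ::
  "('e::euclidean_space) list \<Rightarrow> 'e \<Rightarrow> real \<Rightarrow> real \<Rightarrow> 'e set \<Rightarrow> ('e \<Rightarrow> ereal) \<Rightarrow> bool" where
  "lin_sub ss b a c W f \<longleftrightarrow>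
     (\<forall>z\<in>W. \<forall>\<phi> P Q. touches f z \<phi> \<longrightarrow> jet2 \<phi> z P Q \<longrightarrow>
        c \<le> (\<Sum>s\<leftarrow>ss. Q s) + P b - a * real_of_ereal (f z))"

definition graph_sub ::
  "('e::euclidean_space) list \<Rightarrow> 'e \<Rightarrow> real \<Rightarrow> real \<Rightarrow> ('e \<times> 'g::euclidean_space) set \<Rightarrow> ('e \<times> 'g \<Rightarrow> ereal) \<Rightarrow> bool" where
  "graph_sub ss b a c W f \<longleftrightarrow>
     (\<forall>z\<in>W. \<forall>\<phi> P Q \<Gamma>. touches f z \<phi> \<longrightarrow> jet2 \<phi> z P Q \<longrightarrow> linear \<Gamma> \<longrightarrow>
        c \<le> (\<Sum>s\<leftarrow>ss. Q (s, \<Gamma> s)) + P (b, \<Gamma> b) - a * real_of_ereal (f z))"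

definition fibre_sub :: "('e::euclidean_space \<times> 'g::euclidean_space) set \<Rightarrow> ('e \<times> 'g \<Rightarrow> ereal) \<Rightarrow> bool" where
  "fibre_sub W f \<longleftrightarrow>
     (\<forall>z\<in>W. \<forall>\<phi> P Q w. touches f z \<phi> \<longrightarrow> jet2 \<phi> z P Q \<longrightarrow> 0 \<le> Q (0, w))"

lemma touches_comp_linear:
  fixes L :: "'a::euclidean_space \<Rightarrow> 'b::euclidean_space"
  assumes t: "touches f (L x) \<phi>" and L: "linear L"
  shows "touches (\<lambda>y. f (L y)) x (\<lambda>y. \<phi> (L y))"
proof -
  have "isCont L x" using L by (simp add: linear_continuous_at linear_conv_bounded_linear)
  then have "filterlim L (nhds (L x)) (nhds x)"
    unfolding isCont_def using tendsto_at_iff_tendsto_nhds by blast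
  then have "\<forall>\<^sub>F y in nhds x. f (L y) \<le> f (L x) + ereal (\<phi> (L y) - \<phi> (L x))"
    using t eventually_compose_filterlim unfolding touches_def by blast
  then show ?thesis using t by (simp add: touches_def)
qed

lemma jet2_affine:
  assumes "linear L" shows "jet2 (\<lambda>y. L y + c) z L (\<lambda>v. 0)"
  using jet2_add[OF jet2_linear[OF assms] jet2_const[of c]] by simp

lemma touches_real:
  "touches (\<lambda>x. ereal (h x)) z \<phi> \<longleftrightarrow> (\<forall>\<^sub>F y in nhds z. h y \<le> h z + (\<phi> y - \<phi> z))"
  unfolding touches_def by simp

text \<open>If \<open>h y\<close> exceeded both end values, then
  \<open>h + \<epsilon> \<theta>^2\<close>, penalized by the squared distance to the line, would
  have a maximum inside a thin cylinder around the segment. The test function there has second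
  derivative \<open>-2 \<epsilon>\<close> along the segment, the penalty being constant in that
  direction, which contradicts \<open>jet\<close>.\<close>

lemma segment_max_principle:
  fixes h :: "'a::euclidean_space \<Rightarrow> real"
  assumes S: "open S" "usc_on S (\<lambda>x. ereal (h x))"
    and jet: "\<And>z \<phi> P Q. z \<in> S \<Longrightarrow> touches (\<lambda>x. ereal (h x)) z \<phi> \<Longrightarrow> jet2 \<phi> z P Q \<Longrightarrow> 0 \<le> Q (y1 - y0)"
    and seg: "closed_segment y0 y1 \<subseteq> S" and y: "y \<in> closed_segment y0 y1"
  shows "h y \<le> max (h y0) (h y1)"
proof (cases "y0 = y1")
  case True then show ?thesis using y by simp
next
  case False
  define e where "e = y1 - y0"
  define m where "m = max (h y0) (h y1)"
  show ?thesis
  proof (rule ccontr)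
    assume "\<not> ?thesis"
    then have hm: "h y > m" unfolding m_def by (rule not_le_imp_less)
    \<comment> \<open>Half of the gap: as \<open>\<theta>^2 <= 1\<close> on the segment, adding
      \<open>\<epsilon> \<theta>^2\<close> cannot lift the end points to the value at
      \<open>y\<close>.\<close>
    define \<epsilon> where "\<epsilon> = (h y - m) / 2"
    have \<epsilon>: "\<epsilon> > 0" using hm by (simp add: \<epsilon>_def)
    have ee: "e \<bullet> e > 0" using False by (simp add: e_def)
    \<comment> \<open>\<open>\<theta>\<close> is the coordinate along the line, 0 at
      \<open>y0\<close> and 1 at \<open>y1\<close>; \<open>G\<close> is the component of
      \<open>x - y0\<close> orthogonal to \<open>e\<close>.\<close>
    define L where "L = (\<lambda>v. (v \<bullet> e) / (e \<bullet> e))"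
    have L: "linear L" unfolding L_def by (auto simp: linear_iff inner_add_left add_divide_distrib)
    have Le: "L e = 1" using ee by (simp add: L_def)
    define \<theta> where "\<theta> = (\<lambda>x. L x + - L y0)"
    define G where "G = (\<lambda>x. x - L x *\<^sub>R e + (L y0 *\<^sub>R e - y0))"
    have G_lin: "linear (\<lambda>x. x - L x *\<^sub>R e)" using L by (auto simp: linear_iff algebra_simps)
    have Gdecomp: "x = y0 + \<theta> x *\<^sub>R e + G x" for x by (simp add: \<theta>_def G_def algebra_simps)
    have seg_pt: "y0 + t *\<^sub>R e \<in> closed_segment y0 y1" if "0 \<le> t" "t \<le> 1" for t
      using that unfolding in_segment e_def by (intro exI[of _ t]) (auto simp: algebra_simps)
    have \<theta>_seg: "\<theta> (y0 + t *\<^sub>R e) = t" and G_seg: "G (y0 + t *\<^sub>R e) = 0" for t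
      using Le by (auto simp: \<theta>_def G_def linear_add[OF L] linear_cmul[OF L] algebra_simps)
    obtain r where r: "r > 0" "(\<Union>x\<in>closed_segment y0 y1. cball x r) \<subseteq> S"
      using compact_subset_open_imp_cball_epsilon_subset[OF compact_segment S(1) seg] by blast
    have cont: "continuous_on A \<theta>" "continuous_on A G" for A
      unfolding \<theta>_def G_def L_def by (intro continuous_intros; use ee in simp)+
    define D where "D = {x. 0 \<le> \<theta> x \<and> \<theta> x \<le> 1 \<and> norm (G x) \<le> r}"
    have DS: "D \<subseteq> S"
    proof
      fix x assume "x \<in> D"
      then have "x \<in> cball (y0 + \<theta> x *\<^sub>R e) r" "y0 + \<theta> x *\<^sub>R e \<in> closed_segment y0 y1"
        using Gdecomp[of x] seg_pt[of "\<theta> x"] by (auto simp: D_def dist_norm norm_minus_commute)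
          (metis add_diff_cancel_left' norm_minus_commute)
      then show "x \<in> S" using r by blast
    qed
    have "compact D"
      unfolding compact_eq_bounded_closed
    proof
      show "bounded D" unfolding bounded_iff
      proof (intro exI ballI)
        fix x assume x: "x \<in> D"
        have "norm x \<le> norm y0 + norm (\<theta> x *\<^sub>R e) + norm (G x)"
          by (subst Gdecomp[of x]) (meson norm_triangle_ineq norm_triangle_le add_right_mono order_trans)
        also have "norm (\<theta> x *\<^sub>R e) \<le> 1 * norm e" unfolding norm_scaleR
          using x by (intro mult_right_mono) (auto simp: D_def)
        also have "norm (G x) \<le> r" using x by (simp add: D_def)
        finally show "norm x \<le> norm y0 + 1 * norm e + r" by simp
      qed
      have "closed {x. 0 \<le> \<theta> x}" "closed {x. \<theta> x \<le> 1}" "closed {x. norm (G x) \<le> r}"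
        by (intro closed_Collect_le continuous_intros cont)+
      then show "closed D" unfolding D_def by (intro closed_Collect_conj) auto
    qed
    define C where "C = {x\<in>D. \<theta> x = 0 \<or> \<theta> x = 1 \<or> norm (G x) = r}"
    have "compact C"
    proof -
      have "closed {x. \<theta> x = 0}" "closed {x. \<theta> x = 1}" "closed {x. norm (G x) = r}"
        by (intro closed_Collect_eq continuous_intros cont)+
      then have "closed {x. \<theta> x = 0 \<or> \<theta> x = 1 \<or> norm (G x) = r}" by (intro closed_Collect_disj)
      moreover have "C = D \<inter> {x. \<theta> x = 0 \<or> \<theta> x = 1 \<or> norm (G x) = r}" by (auto simp: C_def)
      ultimately show ?thesis using \<open>compact D\<close> by (simp add: compact_Int_closed)
    qed
    obtain t where t: "0 \<le> t" "t \<le> 1" "y = y0 + t *\<^sub>R e"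
      using y unfolding in_segment e_def by (auto simp: algebra_simps)
    define F where "F = (\<lambda>x. h x + \<epsilon> * (\<theta> x)\<^sup>2)"
    define \<psi> where "\<psi> = (\<lambda>x. (norm (G x))\<^sup>2)"
    have yD: "y \<in> D" "\<psi> y = 0" using t r by (auto simp: D_def \<theta>_seg G_seg \<psi>_def)
    have Fy: "F y \<ge> h y" using \<epsilon> by (simp add: F_def)
    have Cz: "F x < F y" if x: "x \<in> C" "\<psi> x = 0" for x
    proof -
      have G0: "G x = 0" using x by (simp add: \<psi>_def)
      then have "\<theta> x = 0 \<or> \<theta> x = 1" using x r by (auto simp: C_def)
      moreover have "x = y0 + \<theta> x *\<^sub>R e" using Gdecomp[of x] G0 by simp
      ultimately have "h x \<le> m" by (auto simp: m_def e_def)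
      moreover have "\<epsilon> * (\<theta> x)\<^sup>2 \<le> \<epsilon>" using \<open>\<theta> x = 0 \<or> \<theta> x = 1\<close> \<epsilon> by auto
      ultimately have "F x \<le> m + \<epsilon>" by (simp add: F_def)
      also have "\<dots> < h y" using hm by (simp add: \<epsilon>_def field_simps)
      finally show ?thesis using Fy by simp
    qed
    obtain N x where N: "N \<ge> 0" "x \<in> D - C" "F y \<le> F x - N * \<psi> x"
      and mx: "\<And>x'. x' \<in> D \<Longrightarrow> F x' - N * \<psi> x' \<le> F x - N * \<psi> x"
    proof (rule penalization[OF \<open>compact D\<close>, of F \<psi> y C])
      show "usc_on D (\<lambda>x. ereal (F x))" unfolding F_def
        by (intro usc_on_add_continuous usc_on_subset[OF S(2) DS] continuous_intros cont)
      show "continuous_on D \<psi>" unfolding \<psi>_def by (intro continuous_intros cont)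
    qed (use yD Cz \<open>compact C\<close> in \<open>auto simp: C_def \<psi>_def\<close>)
    define \<phi> where "\<phi> = (\<lambda>x. (-\<epsilon>) * (\<theta> x)\<^sup>2 + N * (norm (G x))\<^sup>2)"
    have "touches (\<lambda>x. ereal (h x)) x \<phi>" unfolding touches_real
    proof -
      have "open {x. 0 < \<theta> x \<and> \<theta> x < 1 \<and> norm (G x) < r}"
        by (intro open_Collect_conj open_Collect_less continuous_intros cont)
      moreover have "x \<in> {x. 0 < \<theta> x \<and> \<theta> x < 1 \<and> norm (G x) < r}" using N(2) by (auto simp: C_def D_def)
      ultimately have "\<forall>\<^sub>F x' in nhds x. x' \<in> {x. 0 < \<theta> x \<and> \<theta> x < 1 \<and> norm (G x) < r}"
        by (rule eventually_nhds_in_open)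
      then show "\<forall>\<^sub>F x' in nhds x. h x' \<le> h x + (\<phi> x' - \<phi> x)"
      proof eventually_elim
        case (elim x')
        then have "x' \<in> D" by (auto simp: D_def)
        from mx[OF this] show ?case by (simp add: F_def \<psi>_def \<phi>_def)
      qed
    qed
    moreover have "jet2 \<phi> x (\<lambda>v. (-\<epsilon>) * (2 * (\<theta> x * L v)) + N * (2 * (G x \<bullet> (v - L v *\<^sub>R e))))
       (\<lambda>v. (-\<epsilon>) * (2 * (\<theta> x * 0) + 2 * (L v)\<^sup>2) + N * (2 * (G x \<bullet> 0) + 2 * (norm (v - L v *\<^sub>R e))\<^sup>2))"
      unfolding \<phi>_def
      by (rule jet2_add[OF jet2_cmult[OF jet2_power2_comp] jet2_cmult[OF jet2_norm2_comp]])
         (unfold \<theta>_def G_def, (rule jet2_affine[OF L] jet2_affine[OF G_lin])+)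
    moreover have "x \<in> S" using N DS by auto
    ultimately have "0 \<le> (-\<epsilon>) * (2 * (\<theta> x * 0) + 2 * (L e)\<^sup>2) + N * (2 * (G x \<bullet> 0) + 2 * (norm (e - L e *\<^sub>R e))\<^sup>2)"
      using jet unfolding e_def[symmetric] by blast
    then show False using \<epsilon> Le by simp
  qed
qed

text \<open>A segment in a fibre has direction \<open>(0, y1 - y0)\<close>, on which
  \<open>fibre_sub\<close> gives the sign that the maximum principle asks for. Quasiconvexity is
  enough to make sublevel sets in the fibres convex.\<close>

lemma fibre_sub_quasiconvex:
  fixes h :: "'e::euclidean_space \<times> 'g::euclidean_space \<Rightarrow> real"
  assumes W: "open W" "usc_on W (\<lambda>z. ereal (h z))" "fibre_sub W (\<lambda>z. ereal (h z))"
    and seg: "\<And>y. y \<in> closed_segment y0 y1 \<Longrightarrow> (x, y) \<in> W" and y: "y \<in> closed_segment y0 y1"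
  shows "h (x, y) \<le> max (h (x, y0)) (h (x, y1))"
proof (rule segment_max_principle[OF W(1,2)])
  have *: "closed_segment (x, y0) (x, y1) = Pair x ` closed_segment y0 y1"
    by (auto simp: in_segment image_iff algebra_simps simp flip: scaleR_add_left)
  show "closed_segment (x, y0) (x, y1) \<subseteq> W" "(x, y) \<in> closed_segment (x, y0) (x, y1)"
    unfolding * using seg y by auto
  fix z \<phi> P Q assume "z \<in> W" "touches (\<lambda>x. ereal (h x)) z \<phi>" "jet2 \<phi> z P Q"
  then show "0 \<le> Q ((x, y1) - (x, y0))" using W(3) unfolding fibre_sub_def by simp
qed

text \<open>Replacing \<open>\<phi>\<close> by \<open>q = P + Q/2 + \<epsilon> |v|^2\<close> makes
  the touching strict away from \<open>x\<close>. By compactness some \<open>gs j\<close> stays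
  below \<open>g0 + q\<close> on the outer shell of a small ball, so the maximum of
  \<open>gs j - q\<close> lies in the inner ball and is a genuine touching point for
  \<open>gs j\<close>. Its position is not tracked further: the bound \<open>R\<close> stays below
  \<open>c\<close> at every point of the ball.\<close>

lemma lin_sub_decreasing_limit:
  fixes gs :: "nat \<Rightarrow> 'e::euclidean_space \<Rightarrow> ereal"
  assumes D: "open D" and usc: "\<And>j. usc_on D (gs j)" and sub: "\<And>j. lin_sub ss b a c D (gs j)"
    and fin: "\<And>j x. x \<in> D \<Longrightarrow> \<bar>gs j x\<bar> \<noteq> \<infinity>"
    and dec: "\<And>i j x. x \<in> D \<Longrightarrow> i \<le> j \<Longrightarrow> gs j x \<le> gs i x"
    and lim: "\<And>x. x \<in> D \<Longrightarrow> g x = (INF j. gs j x)" and a: "a \<ge> 0"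
  shows "lin_sub ss b a c D g"
  unfolding lin_sub_def
proof (intro ballI allI impI)
  fix x \<phi> P Q assume x: "x \<in> D" and t: "touches g x \<phi>" and j: "jet2 \<phi> x P Q"
  obtain g0 where g0: "g x = ereal g0" using t unfolding touches_def by auto
  have P: "linear P" and Q: "quadform Q" using j unfolding jet2_def by auto
  obtain B where B: "bilinear B" "\<And>v w. B v w = B w v" "\<And>v. Q v = B v v" using quadform_sym[OF Q] by blast
  define \<sigma> where "\<sigma> = (\<Sum>s\<leftarrow>ss. (norm s)\<^sup>2)"
  have \<sigma>: "\<sigma> \<ge> 0" unfolding \<sigma>_def by (rule sum_list_nonneg) auto
  show "c \<le> (\<Sum>s\<leftarrow>ss. Q s) + P b - a * real_of_ereal (g x)"
  proof (rule ccontr)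
    assume "\<not> ?thesis"
    then have gap: "(\<Sum>s\<leftarrow>ss. Q s) + P b - a * g0 < c" by (simp add: g0)
    define \<gamma> where "\<gamma> = c - ((\<Sum>s\<leftarrow>ss. Q s) + P b - a * g0)"
    \<comment> \<open>The perturbation raises the sum of the \<open>Q s\<close> by
      \<open>2 \<epsilon> \<sigma>\<close>, which must stay below the gap \<open>\<gamma>\<close>;
      the \<open>+ 1\<close> covers \<open>\<sigma> = 0\<close>.\<close>
    define \<epsilon> where "\<epsilon> = \<gamma> / (4 * (\<sigma> + 1))"
    have \<gamma>: "\<gamma> > 0" using gap by (simp add: \<gamma>_def)
    have \<epsilon>: "\<epsilon> > 0" using \<gamma> \<sigma> by (simp add: \<epsilon>_def)
    have \<epsilon>\<sigma>: "2 * \<epsilon> * \<sigma> < \<gamma>"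
    proof -
      have "2 * \<epsilon> * \<sigma> \<le> 2 * \<epsilon> * (\<sigma> + 1)" using \<epsilon> by simp
      also have "\<dots> = \<gamma> / 2" using \<sigma> by (simp add: \<epsilon>_def field_simps)
      finally show ?thesis using \<gamma> by linarith
    qed
    define q where "q = (\<lambda>v. P v + (1/2) * Q v + \<epsilon> * (norm v)\<^sup>2)"
    have contP: "continuous_on UNIV P" by (rule linear_continuous_on) (simp add: P linear_conv_bounded_linear[symmetric])
    have contQ: "continuous_on A Q" for A
    proof -
      have "bounded_bilinear B" using B(1) bilinear_conv_bounded_bilinear by blast
      then have "continuous_on A (\<lambda>v. B v v)" by (intro bounded_bilinear.continuous_on[of B] continuous_intros)
      then show ?thesis by (simp add: B(3))
    qed
    have contB: "continuous_on UNIV (\<lambda>v. B v b)"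
      using B(1) by (intro linear_continuous_on) (simp add: bilinear_def linear_conv_bounded_linear[symmetric])
    have contq: "continuous_on A q" for A
      unfolding q_def by (intro continuous_intros contQ continuous_on_subset[OF contP]) auto
    \<comment> \<open>An upper bound for the right-hand side of the inequality when \<open>q\<close>
      touches at \<open>x + v\<close>. The value of \<open>gs j\<close> there enters through its
      lower bound \<open>g0 + q v\<close>, which is where \<open>a >= 0\<close> is used.\<close>
    define R where "R = (\<lambda>v. (\<Sum>s\<leftarrow>ss. Q s) + 2 * \<epsilon> * \<sigma> + (P b + B v b + 2 * \<epsilon> * (v \<bullet> b)) - a * (g0 + q v))"
    have contR: "continuous_on UNIV R" unfolding R_def by (intro continuous_intros contB contq)
    have R0: "R 0 < c"
      using \<epsilon>\<sigma> unfolding R_def q_def by (simp add: linear_0[OF P] quadform_zero[OF Q] bilinear_lzero[OF B(1)] \<gamma>_def)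
    have "open {v. R v < c}" by (intro open_Collect_less contR continuous_intros)
    then have "\<forall>\<^sub>F v in nhds 0. R v < c" using R0 eventually_nhds_in_open[of "{v. R v < c}" 0] by simp
    then obtain \<delta>1 where \<delta>1: "\<delta>1 > 0" "\<And>v. norm v < \<delta>1 \<Longrightarrow> R v < c"
      unfolding eventually_nhds_metric by (auto simp: dist_norm)
    obtain \<delta>2 where \<delta>2: "\<delta>2 > 0"
      "\<And>y. dist y x < \<delta>2 \<Longrightarrow> \<phi> y - \<phi> x \<le> P (y - x) + (1/2) * Q (y - x) + (\<epsilon>/2) * (norm (y - x))\<^sup>2"
      using jet2_upper_estimate[OF j half_gt_zero[OF \<epsilon>]] by blast
    obtain \<delta>3 where \<delta>3: "\<delta>3 > 0" "\<And>y. dist y x < \<delta>3 \<Longrightarrow> g y \<le> g x + ereal (\<phi> y - \<phi> x)"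
      using t unfolding touches_def eventually_nhds_metric by auto
    obtain \<delta>4 where \<delta>4: "\<delta>4 > 0" "ball x \<delta>4 \<subseteq> D" using D x open_contains_ball by blast
    define \<rho> where "\<rho> = min (min \<delta>1 \<delta>2) (min \<delta>3 \<delta>4) / 2"
    have \<rho>: "\<rho> > 0" "\<rho> < \<delta>1" "\<rho> < \<delta>2" "\<rho> < \<delta>3" "\<rho> < \<delta>4"
      using \<delta>1 \<delta>2 \<delta>3 \<delta>4 by (auto simp: \<rho>_def)
    have KD: "cball x \<rho> \<subseteq> D" using \<rho> \<delta>4 by auto
    have gq: "g y \<le> ereal (g0 + q (y - x) - (\<epsilon>/2) * (norm (y - x))\<^sup>2)" if y: "y \<in> cball x \<rho>" for y
    proof -
      have n: "norm (y - x) \<le> \<rho>" using y by (simp add: dist_norm norm_minus_commute)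
      then have 1: "g y \<le> g x + ereal (\<phi> y - \<phi> x)" using \<rho> \<delta>3(2)[of y] by (simp add: dist_norm)
      have "\<phi> y - \<phi> x \<le> P (y - x) + (1/2) * Q (y - x) + (\<epsilon>/2) * (norm (y - x))\<^sup>2"
        using n \<rho> by (intro \<delta>2(2)) (simp add: dist_norm)
      then have "\<phi> y - \<phi> x \<le> q (y - x) - (\<epsilon>/2) * (norm (y - x))\<^sup>2"
        unfolding q_def by argo
      then show ?thesis using 1 g0 by (simp add: order_trans)
    qed
    define r where "r = (\<lambda>j y. real_of_ereal (gs j y))"
    have r: "gs j y = ereal (r j y)" if "y \<in> D" for j y using fin[OF that] by (simp add: r_def ereal_real)
    have rusc: "usc_on (cball x \<rho>) (\<lambda>y. ereal (r j y + - q (y - x)))" for j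
    proof (intro usc_on_add_continuous)
      show "usc_on (cball x \<rho>) (\<lambda>y. ereal (r j y))"
        by (rule usc_on_cong[OF usc_on_subset[OF usc[of j] KD]]) (use r KD in auto)
      show "continuous_on (cball x \<rho>) (\<lambda>y. - q (y - x))"
        by (intro continuous_intros continuous_on_compose2[OF contq[of UNIV]]) auto
    qed
    \<comment> \<open>Nested compact sets: a common point would satisfy \<open>g >= g0 + q\<close>
      on the outer shell, against the strict touching, so some \<open>M j\<close> is empty.\<close>
    define M where "M = (\<lambda>j. {y \<in> cball x \<rho> - ball x (\<rho>/2). ereal g0 \<le> ereal (r j y + - q (y - x))})"
    have "\<exists>j. M j = {}"
    proof (rule ccontr)
      assume ne: "\<not> ?thesis"
      have "\<Inter> (range M) \<noteq> {}"
      proof (rule compact_nest)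
        show "compact (M j)" for j unfolding M_def
          by (rule usc_compact_superlevel[OF _ usc_on_subset[OF rusc]]) (auto intro: compact_diff)
        show "M j \<noteq> {}" for j using ne by auto
        show "M n \<subseteq> M m" if mn: "m \<le> n" for m n
        proof
          fix y assume y: "y \<in> M n"
          then have "y \<in> D" using KD by (auto simp: M_def)
          then have "r n y \<le> r m y" using dec[OF _ mn, of y] by (simp add: r)
          then show "y \<in> M m" using y by (auto simp: M_def)
        qed
      qed
      then obtain y where y: "\<And>j. y \<in> M j" by auto
      have yK: "y \<in> cball x \<rho>" "norm (y - x) \<ge> \<rho>/2" using y[of 0] by (auto simp: M_def dist_norm norm_minus_commute)
      then have yD: "y \<in> D" using KD by auto
      have "ereal (g0 + q (y - x)) \<le> gs j y" for j using y[of j] by (auto simp: M_def r[OF yD])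
      then have "ereal (g0 + q (y - x)) \<le> g y" unfolding lim[OF yD] by (intro INF_greatest)
      also note gq[OF yK(1)]
      finally have "(\<epsilon>/2) * (norm (y - x))\<^sup>2 \<le> 0" by simp
      then show False using \<epsilon> yK \<rho> by (simp add: mult_le_0_iff)
    qed
    then obtain j where j: "M j = {}" by blast
    obtain y where y: "y \<in> cball x \<rho>" "\<And>y'. y' \<in> cball x \<rho> \<Longrightarrow> ereal (r j y' + - q (y' - x)) \<le> ereal (r j y + - q (y - x))"
      by (rule usc_attains_max[OF compact_cball _ rusc[of j]]) (use \<rho> in auto)
    have "g x \<le> gs j x" unfolding lim[OF x] by (intro INF_lower) auto
    then have "g0 \<le> r j x" using g0 r[OF x] by simp
    moreover have "q 0 = 0" by (simp add: q_def linear_0[OF P] quadform_zero[OF Q])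
    ultimately have val: "g0 \<le> r j y - q (y - x)" using y(2)[of x] \<rho> by simp
    have yb: "y \<in> ball x (\<rho>/2)"
    proof (rule ccontr)
      assume "y \<notin> ball x (\<rho>/2)"
      then have "y \<in> M j" using y(1) val by (simp add: M_def)
      then show False using j by simp
    qed
    define \<psi> where "\<psi> = (\<lambda>y. (P (y - x) + (1/2) * B (y - x) (y - x)) + \<epsilon> * (norm (y + - x))\<^sup>2)"
    have \<psi>q: "\<psi> y = q (y - x)" for y by (simp add: \<psi>_def q_def B(3))
    have yD: "y \<in> D" using y KD by auto
    have "touches (gs j) y \<psi>" unfolding touches_def
    proof
      show "\<bar>gs j y\<bar> \<noteq> \<infinity>" by (rule fin[OF yD])
      have "\<forall>\<^sub>F y' in nhds y. y' \<in> ball x \<rho>"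
        using yb \<rho> by (intro eventually_nhds_in_open) auto
      then show "\<forall>\<^sub>F y' in nhds y. gs j y' \<le> gs j y + ereal (\<psi> y' - \<psi> y)"
      proof eventually_elim
        case (elim y')
        then have "y' \<in> cball x \<rho>" by auto
        then show ?case using y(2)[of y'] KD by (auto simp: r yD \<psi>q)
      qed
    qed
    moreover have "jet2 \<psi> y (\<lambda>v. (P v + B (y - x) v) + \<epsilon> * (2 * ((y + - x) \<bullet> v)))
        (\<lambda>v. B v v + \<epsilon> * (2 * ((y + - x) \<bullet> 0) + 2 * (norm v)\<^sup>2))"
      unfolding \<psi>_def
      by (rule jet2_add[OF jet2_quadratic[OF P B(1,2)] jet2_cmult[OF jet2_norm2_comp[OF jet2_affine]]])
         (rule linear_id[unfolded id_def])
    ultimately have "c \<le> (\<Sum>s\<leftarrow>ss. B s s + \<epsilon> * (2 * ((y + - x) \<bullet> 0) + 2 * (norm s)\<^sup>2))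
       + ((P b + B (y - x) b) + \<epsilon> * (2 * ((y + - x) \<bullet> b))) - a * real_of_ereal (gs j y)"
      using sub[of j] yD unfolding lin_sub_def by blast
    also have "(\<Sum>s\<leftarrow>ss. B s s + \<epsilon> * (2 * ((y + - x) \<bullet> 0) + 2 * (norm s)\<^sup>2)) = (\<Sum>s\<leftarrow>ss. Q s) + 2 * \<epsilon> * \<sigma>"
      unfolding \<sigma>_def by (simp add: sum_list_addf B(3) sum_list_const_mult algebra_simps)
    finally have 1: "c \<le> (\<Sum>s\<leftarrow>ss. Q s) + 2 * \<epsilon> * \<sigma> + ((P b + B (y - x) b) + \<epsilon> * (2 * ((y + - x) \<bullet> b)))
       - a * real_of_ereal (gs j y)" .
    have "a * (g0 + q (y - x)) \<le> a * real_of_ereal (gs j y)"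
      using val a by (intro mult_left_mono) (auto simp: r[OF yD])
    with 1 have "c \<le> R (y - x)" by (simp add: R_def)
    moreover have "norm (y - x) < \<delta>1" using yb \<rho> by (simp add: dist_norm norm_minus_commute)
    ultimately show False using \<delta>1(2) by fastforce
  qed
qed

section \<open>Trigonometric polynomials and the heat flow\<close>

text \<open>The phase \<open>\<theta>\<close> makes sines available too. Each cosine is an
  eigenfunction of every averaging step below, which makes the flow explicit.\<close>

inductive trig_poly :: "('e::euclidean_space \<Rightarrow> 'g::euclidean_space) \<Rightarrow> bool" where
  cos: "trig_poly (\<lambda>x. cos (k \<bullet> x + \<theta>) *\<^sub>R c)"
| add: "trig_poly u \<Longrightarrow> trig_poly v \<Longrightarrow> trig_poly (\<lambda>x. u x + v x)"

lemma trig_poly_const: "trig_poly (\<lambda>x. c)"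
  using trig_poly.cos[of 0 0 c] by simp

lemma trig_poly_sum: "finite A \<Longrightarrow> (\<And>i. i \<in> A \<Longrightarrow> trig_poly (u i)) \<Longrightarrow> trig_poly (\<lambda>x. \<Sum>i\<in>A. u i x)"
  by (induction A rule: finite_induct) (auto intro: trig_poly_const trig_poly.add)

lemma trig_poly_scaleR:
  assumes "trig_poly (u :: _ \<Rightarrow> real)" shows "trig_poly (\<lambda>x. u x *\<^sub>R e)"
  using assms
proof induction
  case (cos k \<theta> c)
  then show ?case using trig_poly.cos[of k \<theta> "c *\<^sub>R e"] by simp
qed (auto simp: scaleR_add_left intro: trig_poly.add)

lemma trig_poly_mult:
  assumes "trig_poly (u :: _ \<Rightarrow> real)" "trig_poly v" shows "trig_poly (\<lambda>x. u x * v x)"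
  using assms
proof (induction arbitrary: v)
  case (cos k \<theta> c)
  from cos show ?case
  proof induction
    case (cos k' \<theta>' c')
    have "cos (k \<bullet> x + \<theta>) *\<^sub>R c * (cos (k' \<bullet> x + \<theta>') *\<^sub>R c')
      = cos ((k - k') \<bullet> x + (\<theta> - \<theta>')) *\<^sub>R (c * c' / 2) + cos ((k + k') \<bullet> x + (\<theta> + \<theta>')) *\<^sub>R (c * c' / 2)" for x
    proof -
      have "(k - k') \<bullet> x + (\<theta> - \<theta>') = (k \<bullet> x + \<theta>) - (k' \<bullet> x + \<theta>')"
        "(k + k') \<bullet> x + (\<theta> + \<theta>') = (k \<bullet> x + \<theta>) + (k' \<bullet> x + \<theta>')"
        by (auto simp: inner_diff_left inner_add_left)
      moreover have "cos \<alpha> *\<^sub>R c * (cos \<beta> *\<^sub>R c') = cos (\<alpha> - \<beta>) *\<^sub>R (c * c' / 2) + cos (\<alpha> + \<beta>) *\<^sub>R (c * c' / 2)" for \<alpha> \<beta> :: real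
        by (simp add: cos_diff cos_add field_simps)
      ultimately show ?thesis by (simp only:)
    qed
    then show ?case by (simp only:) (intro trig_poly.intros)
  next
    case (add u v)
    then show ?case using trig_poly.add[OF add.IH] by (simp add: distrib_left)
  qed
next
  case (add u1 u2)
  then show ?case using trig_poly.add[of "\<lambda>x. u1 x * v x" "\<lambda>x. u2 x * v x"] by (simp add: distrib_right)
qed

text \<open>Substituted into a polynomial it produces a trigonometric polynomial, so the algebraic
  Weierstrass theorem yields trigonometric approximation wherever the sine is invertible.\<close>

definition sin_vec :: "'e::euclidean_space \<Rightarrow> 'e" where
  "sin_vec x = (\<Sum>b\<in>Basis. sin (x \<bullet> b) *\<^sub>R b)"

lemma sin_vec_inner: "b \<in> Basis \<Longrightarrow> sin_vec x \<bullet> b = sin (x \<bullet> b)"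
  unfolding sin_vec_def by simp

lemma trig_poly_real_polynomial_sin_vec:
  assumes "real_polynomial_function p" shows "trig_poly (\<lambda>x::'e::euclidean_space. p (sin_vec x))"
  using assms
proof induction
  case (linear f)
  have "f (sin_vec x) = (\<Sum>b\<in>Basis. cos (b \<bullet> x + (-pi/2)) *\<^sub>R f b)" for x :: 'e
    unfolding sin_vec_def using linear
    by (simp add: linear_sum[OF bounded_linear.linear] linear_cmul[OF bounded_linear.linear] cos_sin_eq
        inner_commute minus_diff_eq cos_diff)
  then show ?case by (simp only:) (intro trig_poly_sum trig_poly.cos finite_Basis)
qed (auto intro: trig_poly_const trig_poly.add trig_poly_mult)

lemma trig_poly_polynomial_sin_vec:
  fixes p :: "'e::euclidean_space \<Rightarrow> 'g::euclidean_space"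
  assumes "polynomial_function p" shows "trig_poly (\<lambda>x. p (sin_vec x))"
proof -
  have "trig_poly (\<lambda>x. (p (sin_vec x) \<bullet> e) *\<^sub>R e)" for e
    using assms unfolding polynomial_function_def
    by (intro trig_poly_scaleR trig_poly_real_polynomial_sin_vec) (use bounded_linear_inner_left in \<open>force simp: o_def\<close>)
  then have "trig_poly (\<lambda>x. \<Sum>e\<in>Basis. (p (sin_vec x) \<bullet> e) *\<^sub>R e)"
    by (intro trig_poly_sum) auto
  then show ?thesis by (simp add: euclidean_representation)
qed

text \<open>
  The heat semigroup at time \<open>t\<close> is the limit of \<open>n\<close> averaging steps of size \<open>t/n\<close>.
  This keeps the flow inside every closed convex set that contains the initial values.
\<close>

primrec walk :: "'e::real_vector list \<Rightarrow> real \<Rightarrow> ('e \<Rightarrow> 'g::real_vector) \<Rightarrow> 'e \<Rightarrow> 'g" where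
  "walk [] h u = u"
| "walk (s # ss) h u = (\<lambda>x. (1/2) *\<^sub>R walk ss h u (x + sqrt (2*h) *\<^sub>R s) + (1/2) *\<^sub>R walk ss h u (x - sqrt (2*h) *\<^sub>R s))"

lemma walk_add: "walk ss h (\<lambda>x. u x + v x) = (\<lambda>x. walk ss h u x + walk ss h v x)"
  by (induction ss) (auto simp: algebra_simps)

lemma walk_scaleR: "walk ss h (\<lambda>x. r *\<^sub>R u x) = (\<lambda>x. r *\<^sub>R walk ss h u x)"
  by (induction ss) (auto simp: algebra_simps)

lemma walk_cos:
  "walk ss h (\<lambda>x. cos (k \<bullet> x + \<theta>) *\<^sub>R c) = (\<lambda>x. (\<Prod>s\<leftarrow>ss. cos (sqrt (2*h) * (k \<bullet> s))) *\<^sub>R (cos (k \<bullet> x + \<theta>) *\<^sub>R c))"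
proof (induction ss)
  case (Cons s ss)
  have "cos (k \<bullet> (x + sqrt (2*h) *\<^sub>R s) + \<theta>) + cos (k \<bullet> (x - sqrt (2*h) *\<^sub>R s) + \<theta>)
      = 2 * cos (sqrt (2*h) * (k \<bullet> s)) * cos (k \<bullet> x + \<theta>)" for x
  proof -
    have "k \<bullet> (x + sqrt (2*h) *\<^sub>R s) + \<theta> = (k \<bullet> x + \<theta>) + sqrt (2*h) * (k \<bullet> s)"
      "k \<bullet> (x - sqrt (2*h) *\<^sub>R s) + \<theta> = (k \<bullet> x + \<theta>) - sqrt (2*h) * (k \<bullet> s)"
      by (auto simp: inner_add_right inner_diff_right)
    moreover have "cos (\<alpha> + \<beta>) + cos (\<alpha> - \<beta>) = 2 * cos \<beta> * cos \<alpha>" for \<alpha> \<beta> :: real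
      unfolding cos_diff cos_add by simp
    ultimately show ?thesis by metis
  qed
  note * = this
  have **: "(1/2) *\<^sub>R (p *\<^sub>R (X *\<^sub>R c)) + (1/2) *\<^sub>R (p *\<^sub>R (Y *\<^sub>R c)) = (p * (X + Y) / 2) *\<^sub>R c" for p X Y :: real
    by (simp add: algebra_simps add_divide_distrib)
  show ?case unfolding walk.simps Cons.IH ** *
    by (rule ext) simp
qed simp

lemma walk_convex:
  assumes "convex C" "\<And>x. u x \<in> C" shows "walk ss h u x \<in> C"
  by (induction ss arbitrary: x) (auto simp: assms(2) intro!: convexD[OF assms(1)])

lemma walk_iter_convex:
  assumes "convex C" "\<And>x. u x \<in> C" shows "(walk ss h ^^ n) u x \<in> C"
  by (induction n arbitrary: x) (auto simp: assms(2) intro!: walk_convex[OF assms(1)])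

text \<open>The factor by which \<open>n\<close> averaging steps of size \<open>t/n\<close> damp a
  mode. The step length \<open>sqrt (2*h)\<close> is chosen so that the cosine expands as
  \<open>1 - t \<kappa>^2 / n + ...\<close>, whose \<open>n\<close>-th power tends to the heat
  factor.\<close>

lemma cos_power_limit:
  assumes "t \<ge> 0"
  shows "(\<lambda>n. cos (sqrt (2 * (t / real n)) * \<kappa>) ^ n) \<longlonglongrightarrow> exp (- t * \<kappa>\<^sup>2)"
proof -
  define a where "a = sqrt (2*t) * \<kappa>"
  have "(\<lambda>n. cos (a / sqrt (real n)) ^ n) \<longlonglongrightarrow> exp (- (a * a / 2))"
  proof (cases "a = 0")
    case False
    show ?thesis using False by real_asymp
  qed simp
  moreover have "sqrt (2 * (t / real n)) * \<kappa> = a / sqrt (real n)" for n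
    by (simp add: a_def real_sqrt_mult real_sqrt_divide)
  moreover have "a * a / 2 = t * \<kappa>\<^sup>2"
    using assms unfolding power2_eq_square[symmetric] by (simp add: a_def power_mult_distrib)
  ultimately show ?thesis by simp
qed

lemma prod_list_cos_limit:
  assumes "t \<ge> 0"
  shows "(\<lambda>n. (\<Prod>s\<leftarrow>ss. cos (sqrt (2 * (t / real n)) * (k \<bullet> s))) ^ n) \<longlonglongrightarrow> exp (- t * (\<Sum>s\<leftarrow>ss. (k \<bullet> s)\<^sup>2))"
proof (induction ss)
  case (Cons s ss)
  have "exp (- t * (\<Sum>s\<leftarrow>s # ss. (k \<bullet> s)\<^sup>2)) = exp (- t * (k \<bullet> s)\<^sup>2) * exp (- t * (\<Sum>s\<leftarrow>ss. (k \<bullet> s)\<^sup>2))"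
    by (simp add: algebra_simps flip: exp_add)
  then show ?case using tendsto_mult[OF cos_power_limit[OF assms, of "k \<bullet> s"] Cons.IH]
    by (simp add: power_mult_distrib)
qed simp

text \<open>What the comparison needs from the flow in one predicate: spatial jets, the heat
  equation, joint continuity and the limit of averaging steps. The time derivative is two-sided at
  every real \<open>t\<close>, which cosine modes allow; the averaging limit is confined to
  \<open>t >= 0\<close>.\<close>

definition heat_flow ::
  "'e::euclidean_space list \<Rightarrow> ('e \<Rightarrow> 'g::euclidean_space) \<Rightarrow> (real \<Rightarrow> 'e \<Rightarrow> 'g)
    \<Rightarrow> (real \<Rightarrow> 'e \<Rightarrow> 'e \<Rightarrow> 'g) \<Rightarrow> (real \<Rightarrow> 'e \<Rightarrow> 'e \<Rightarrow> 'g) \<Rightarrow> bool" where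
  "heat_flow ss Y U P Q \<longleftrightarrow> U 0 = Y \<and> (\<forall>t x. jet2 (U t) x (P t x) (Q t x)) \<and>
     (\<forall>t x. ((\<lambda>t. U t x) has_vector_derivative (\<Sum>s\<leftarrow>ss. Q t x s)) (at t)) \<and>
     continuous_on UNIV (\<lambda>z. U (fst z) (snd z)) \<and>
     (\<forall>t\<ge>0. \<forall>x. (\<lambda>n. (walk ss (t / real n) ^^ n) Y x) \<longlonglongrightarrow> U t x)"

lemma heat_flow_cos: "\<exists>U P Q. heat_flow ss (\<lambda>x. cos (k \<bullet> x + \<theta>) *\<^sub>R c) U P Q"
proof -
  define \<mu> where "\<mu> = (\<Sum>s\<leftarrow>ss. (k \<bullet> s)\<^sup>2)"
  define E where "E = (\<lambda>t. exp (- t * \<mu>))"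
  define U where "U = (\<lambda>t x. (E t * cos (k \<bullet> x + \<theta>)) *\<^sub>R c)"
  define P where "P = (\<lambda>t x v. (E t * (- sin (k \<bullet> x + \<theta>) * (k \<bullet> v))) *\<^sub>R c)"
  define Q where "Q = (\<lambda>t x v. (E t * (- sin (k \<bullet> x + \<theta>) * 0 + (- cos (k \<bullet> x + \<theta>)) * (k \<bullet> v)\<^sup>2)) *\<^sub>R c)"
  have 1: "U 0 = (\<lambda>x. cos (k \<bullet> x + \<theta>) *\<^sub>R c)" by (auto simp: U_def E_def)
  have 2: "jet2 (U t) x (P t x) (Q t x)" for t x
  proof -
    have A: "jet2 (\<lambda>x. k \<bullet> x + \<theta>) x (\<lambda>v. k \<bullet> v) (\<lambda>v. 0)"
      by (rule jet2_affine) (auto simp: linear_iff inner_add_right)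
    have B: "jet2 cos (k \<bullet> x + \<theta>) (\<lambda>v. - sin (k \<bullet> x + \<theta>) * v) (\<lambda>v. - cos (k \<bullet> x + \<theta>) * v\<^sup>2)"
      by (rule jet2_real) (auto intro!: derivative_eq_intros)
    show ?thesis unfolding U_def P_def Q_def
      by (rule jet2_scaleR_left[OF jet2_cmult[OF jet2_comp[OF A B]]])
  qed
  have sumQ: "(\<Sum>s\<leftarrow>ss. Q t x s) = (- \<mu> * E t * cos (k \<bullet> x + \<theta>)) *\<^sub>R c" for t x
    unfolding \<mu>_def by (induction ss) (auto simp: Q_def algebra_simps)
  have 3: "((\<lambda>t. U t x) has_vector_derivative (\<Sum>s\<leftarrow>ss. Q t x s)) (at t)" for t x
    unfolding sumQ unfolding U_def E_def
    by (auto intro!: derivative_eq_intros simp flip: has_real_derivative_iff_has_vector_derivative)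
  have 4: "continuous_on UNIV (\<lambda>z. U (fst z) (snd z))"
    unfolding U_def E_def by (intro continuous_intros)
  have 5: "(\<lambda>n. (walk ss (t / real n) ^^ n) (\<lambda>x. cos (k \<bullet> x + \<theta>) *\<^sub>R c) x) \<longlonglongrightarrow> U t x" if "t \<ge> 0" for t x
  proof -
    have "(walk ss h ^^ n) (\<lambda>x. cos (k \<bullet> x + \<theta>) *\<^sub>R c)
      = (\<lambda>x. (\<Prod>s\<leftarrow>ss. cos (sqrt (2*h) * (k \<bullet> s))) ^ n *\<^sub>R (cos (k \<bullet> x + \<theta>) *\<^sub>R c))" for n h
    proof (induction n)
      case (Suc n)
      show ?case unfolding funpow.simps o_apply Suc.IH walk_scaleR walk_cos by (simp add: mult_ac)
    qed simp
    then show ?thesis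
      using tendsto_scaleR[OF prod_list_cos_limit[OF that, of k ss] tendsto_const[of "cos (k \<bullet> x + \<theta>) *\<^sub>R c"]]
      by (simp add: U_def E_def \<mu>_def)
  qed
  show ?thesis using 1 2 3 4 5 unfolding heat_flow_def by blast
qed

lemma heat_flow_add:
  assumes u: "heat_flow ss u U P Q" and v: "heat_flow ss v V P' Q'"
  shows "heat_flow ss (\<lambda>x. u x + v x) (\<lambda>t x. U t x + V t x) (\<lambda>t x h. P t x h + P' t x h) (\<lambda>t x h. Q t x h + Q' t x h)"
proof -
  have w: "(walk ss h ^^ n) (\<lambda>x. u x + v x) = (\<lambda>x. (walk ss h ^^ n) u x + (walk ss h ^^ n) v x)" for h n
    by (induction n) (auto simp: walk_add)
  show ?thesis
    unfolding heat_flow_def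
  proof (intro conjI allI impI)
    show "(\<lambda>x. U 0 x + V 0 x) = (\<lambda>x. u x + v x)" using u v by (auto simp: heat_flow_def)
    show "jet2 (\<lambda>x. U t x + V t x) x (\<lambda>h. P t x h + P' t x h) (\<lambda>h. Q t x h + Q' t x h)" for t x
      using u v by (auto simp: heat_flow_def intro: jet2_add)
    show "((\<lambda>t. U t x + V t x) has_vector_derivative (\<Sum>s\<leftarrow>ss. Q t x s + Q' t x s)) (at t)" for t x
      using u v by (auto simp: heat_flow_def sum_list_addf intro!: has_vector_derivative_add)
    show "continuous_on UNIV (\<lambda>z. U (fst z) (snd z) + V (fst z) (snd z))"
      using u v by (auto simp: heat_flow_def intro: continuous_on_add)
    show "(\<lambda>n. (walk ss (t / real n) ^^ n) (\<lambda>x. u x + v x) x) \<longlonglongrightarrow> U t x + V t x" if "t \<ge> 0" for t x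
      using u v that by (auto simp: w heat_flow_def intro!: tendsto_add)
  qed
qed

lemma trig_poly_heat_flow:
  assumes "trig_poly Y" obtains U P Q where "heat_flow ss Y U P Q"
proof -
  have "\<exists>U P Q. heat_flow ss Y U P Q" using assms
  proof induction
    case (cos k \<theta> c) show ?case by (rule heat_flow_cos)
  next
    case (add u v) then show ?case using heat_flow_add by blast
  qed
  then show ?thesis using that by blast
qed

lemma heat_flow_convex:
  assumes "heat_flow ss Y U P Q" "closed C" "convex C" "\<And>x. Y x \<in> C" "t \<ge> 0"
  shows "U t x \<in> C"
proof (rule closed_sequentially[OF assms(2)])
  show "(\<lambda>n. (walk ss (t / real n) ^^ n) Y x) \<longlonglongrightarrow> U t x" using assms by (simp add: heat_flow_def)
  show "(walk ss (t / real n) ^^ n) Y x \<in> C" for n by (rule walk_iter_convex) (use assms in auto)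
qed

section \<open>The inequality at a touching point of the marginal function\<close>

lemma trig_poly_shift:
  assumes "trig_poly u" shows "trig_poly (\<lambda>x. u (x - x0))"
  using assms
proof induction
  case (cos k \<theta> c)
  then show ?case using trig_poly.cos[of k "\<theta> - k \<bullet> x0" c] by (simp add: inner_diff_right algebra_simps)
qed (auto intro: trig_poly.add)

text \<open>From the coordinates \<open>sin (x - x0)\<close> the ball is recovered by
  \<open>arcsin\<close>, as \<open>\<rho> <= 1 <= pi/2\<close>. The target is extended to the whole
  cube by the closest point map, so the approximant is near some value of \<open>y\<close> at every
  \<open>x\<close>, not just on the ball. This global control is needed because the averaging steps
  reach outside the ball.\<close>

lemma approximate_by_trig_poly:
  fixes y :: "'e::euclidean_space \<Rightarrow> 'g::euclidean_space"
  assumes y: "continuous_on (cball x0 \<rho>) y" and \<rho>: "0 \<le> \<rho>" "\<rho> \<le> 1" and e: "e > 0"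
  obtains Y where "trig_poly Y" "\<And>x. x \<in> cball x0 \<rho> \<Longrightarrow> norm (Y x - y x) < e"
    "\<And>x. \<exists>x'\<in>cball x0 \<rho>. norm (Y x - y x') < e"
proof -
  define S where "S = cbox (- One) (One :: 'e)"
  define A where "A = (\<lambda>s::'e. x0 + (\<Sum>b\<in>Basis. arcsin (s \<bullet> b) *\<^sub>R b))"
  define Z where "Z = (\<lambda>s. y (closest_point (cball x0 \<rho>) (A s)))"
  have S: "s \<in> S \<longleftrightarrow> (\<forall>b\<in>Basis. -1 \<le> s \<bullet> b \<and> s \<bullet> b \<le> 1)" for s
    by (simp add: S_def mem_box)
  have A: "continuous_on S A" unfolding A_def
    by (intro continuous_intros) (auto simp: S)
  have ne: "cball x0 \<rho> \<noteq> {}" using \<rho> by simp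
  have cl: "closest_point (cball x0 \<rho>) w \<in> cball x0 \<rho>" for w
    by (rule closest_point_in_set[OF closed_cball ne])
  have "continuous_on S Z" unfolding Z_def
    by (rule continuous_on_compose2[OF y continuous_on_compose2[OF continuous_on_closest_point[OF convex_cball closed_cball ne] A]])
       (use cl in auto)
  then obtain p where p: "polynomial_function p" "\<And>s. s \<in> S \<Longrightarrow> norm (Z s - p s) < e"
    using Stone_Weierstrass_polynomial_function[of S Z e] e by (auto simp: S_def)
  define Y where "Y = (\<lambda>x. p (sin_vec (x - x0)))"
  have sinS: "sin_vec x \<in> S" for x :: 'e by (auto simp: S sin_vec_inner)
  have YZ: "norm (Y x - Z (sin_vec (x - x0))) < e" for x
    unfolding Y_def using p(2)[OF sinS] by (simp add: norm_minus_commute)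
  show ?thesis
  proof (rule that[of Y])
    show "trig_poly Y" unfolding Y_def by (rule trig_poly_shift[OF trig_poly_polynomial_sin_vec[OF p(1)]])
    show "\<exists>x'\<in>cball x0 \<rho>. norm (Y x - y x') < e" for x
      using YZ[of x] cl unfolding Z_def by blast
    fix x assume x: "x \<in> cball x0 \<rho>"
    have "arcsin (sin_vec (x - x0) \<bullet> b) = (x - x0) \<bullet> b" if "b \<in> Basis" for b
    proof -
      have "\<bar>(x - x0) \<bullet> b\<bar> \<le> norm (x - x0)" using that by (rule Basis_le_norm)
      also have "\<dots> \<le> 1" using x \<rho> by (simp add: dist_norm norm_minus_commute)
      also have "1 \<le> pi / 2" using pi_ge_two by simp
      finally show ?thesis unfolding sin_vec_inner[OF that] by (intro arcsin_sin) auto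
    qed
    then have "A (sin_vec (x - x0)) = x0 + (\<Sum>b\<in>Basis. ((x - x0) \<bullet> b) *\<^sub>R b)"
      unfolding A_def by simp
    then have "A (sin_vec (x - x0)) = x" by (simp add: euclidean_representation)
    then have "Z (sin_vec (x - x0)) = y x" unfolding Z_def using x by (simp add: closest_point_self)
    then show "norm (Y x - y x) < e" using YZ[of x] by simp
  qed
qed

text \<open>For fixed \<open>y\<close> the strict inequality is open in \<open>x\<close>, so
  finitely many constant choices serve all of \<open>K\<close>. A partition of unity glues them, and
  the average stays admissible because strict sublevel sets in the fibres are convex.\<close>

lemma quasiconvex_selection:
  fixes h :: "'e::euclidean_space \<times> 'g::euclidean_space \<Rightarrow> real"
  assumes K: "compact K" and Y: "convex Y" "K \<times> Y \<subseteq> W"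
    and usc: "usc_on W (\<lambda>z. ereal (h z))"
    and qc: "\<And>x \<beta>. x \<in> K \<Longrightarrow> convex {y \<in> Y. h (x, y) < \<beta>}"
    and q: "continuous_on K q"
    and near: "\<And>x. x \<in> K \<Longrightarrow> \<exists>y\<in>Y. h (x, y) < q x"
  obtains A y where "finite A" "A \<subseteq> Y" "continuous_on K y"
    "\<And>x. x \<in> K \<Longrightarrow> y x \<in> convex hull A" "\<And>x. x \<in> K \<Longrightarrow> h (x, y x) < q x"
proof -
  have "\<exists>y r. y \<in> Y \<and> r > 0 \<and> (\<forall>x'\<in>ball x r \<inter> K. h (x', y) < q x')" if x: "x \<in> K" for x
  proof -
    obtain y where y: "y \<in> Y" "h (x, y) < q x" using near[OF x] by blast
    have "usc_on K (\<lambda>x. ereal (h (x, y) + - q x))"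
      by (intro usc_on_add_continuous usc_on_compose[OF usc] continuous_intros q) (use Y y in auto)
    moreover have "ereal (h (x, y) + - q x) < ereal 0" using y by simp
    ultimately obtain U where U: "open U" "x \<in> U" "\<And>x'. x' \<in> U \<Longrightarrow> x' \<in> K \<Longrightarrow> ereal (h (x', y) + - q x') < ereal 0"
      using usc_onD[of K _ x "ereal 0"] x by blast
    obtain r where "r > 0" "ball x r \<subseteq> U" using U open_contains_ball by blast
    then show ?thesis using U y by (intro exI[of _ y] exI[of _ r]) fastforce
  qed
  then obtain y r where yr: "\<And>x. x \<in> K \<Longrightarrow> y x \<in> Y \<and> r x > 0 \<and> (\<forall>x'\<in>ball x (r x) \<inter> K. h (x', y x) < q x')"
    by metis
  have "K \<subseteq> (\<Union>x\<in>K. ball x (r x))" using yr by (meson UN_I centre_in_ball subsetI)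
  then obtain I where I: "I \<subseteq> K" "finite I" "K \<subseteq> (\<Union>x\<in>I. ball x (r x))"
    using compactE_image[OF K, of K "\<lambda>x. ball x (r x)"] by (metis open_ball)
  define w where "w = (\<lambda>a x. max 0 (r a - dist a x))"
  define T where "T = (\<lambda>x. \<Sum>a\<in>I. w a x)"
  define f where "f = (\<lambda>x. \<Sum>a\<in>I. (w a x / T x) *\<^sub>R y a)"
  have w0: "w a x \<ge> 0" for a x by (simp add: w_def)
  have Tpos: "T x > 0" if x: "x \<in> K" for x
  proof -
    obtain a where a: "a \<in> I" "x \<in> ball a (r a)" using I x by blast
    then have "w a x > 0" by (simp add: w_def)
    moreover have "w a x \<le> T x" unfolding T_def by (rule member_le_sum) (use a I w0 in auto)
    ultimately show ?thesis by simp
  qed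
  have wT1: "(\<Sum>a\<in>I. w a x / T x) = 1" if "x \<in> K" for x
    using Tpos[OF that] unfolding sum_divide_distrib[symmetric] T_def by simp
  show ?thesis
  proof (rule that[of "y ` I" f])
    show "finite (y ` I)" "y ` I \<subseteq> Y" using I yr by auto
    have "continuous_on K (w a)" for a unfolding w_def by (intro continuous_intros)
    moreover from this have "continuous_on K T" unfolding T_def by (intro continuous_intros)
    ultimately show "continuous_on K f" unfolding f_def
      by (intro continuous_intros) (use Tpos in force)+
    fix x assume x: "x \<in> K"
    show "f x \<in> convex hull (y ` I)" unfolding f_def
      by (rule convex_sum[OF _ convex_convex_hull]) (use I wT1[OF x] Tpos[OF x] w0 in \<open>auto intro: hull_inc\<close>)
    \<comment> \<open>The active indices. Convexity is applied to these alone: a constant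
      \<open>y a\<close> with vanishing weight may violate the inequality at
      \<open>x\<close>.\<close>
    define J where "J = {a \<in> I. dist a x < r a}"
    have zero: "w a x / T x = 0" if "a \<in> I - J" for a using that by (auto simp: J_def w_def)
    have fJ: "f x = (\<Sum>a\<in>J. (w a x / T x) *\<^sub>R y a)" unfolding f_def
      by (rule sum.mono_neutral_right) (use I zero in \<open>auto simp: J_def\<close>)
    have "(\<Sum>a\<in>J. w a x / T x) = (\<Sum>a\<in>I. w a x / T x)"
      by (rule sum.mono_neutral_left) (use I zero in \<open>auto simp: J_def\<close>)
    then have J1: "(\<Sum>a\<in>J. w a x / T x) = 1" using wT1[OF x] by simp
    have "f x \<in> {y \<in> Y. h (x, y) < q x}" unfolding fJ
    proof (rule convex_sum[OF _ qc[OF x] J1])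
      show "finite J" using I by (simp add: J_def)
      fix a assume a: "a \<in> J"
      then show "0 \<le> w a x / T x" using Tpos[OF x] w0 by simp
      have "a \<in> K" "x \<in> ball a (r a) \<inter> K" using a I x by (auto simp: J_def)
      then show "y a \<in> {y \<in> Y. h (x, y) < q x}" using yr by blast
    qed
    then show "h (x, f x) < q x" by simp
  qed
qed

text \<open>The strict inequality survives the passage from a continuous selection to a
  trigonometric polynomial: the points over the ball and in \<open>C\<close> that violate it form a
  compact set missing the graph, hence at vertical distance at least \<open>d\<close> from it.
  \<open>C\<close> and \<open>r\<close> record a convex region with room to spare in
  \<open>Y\<close>, in which the flow will stay.\<close>

lemma trig_selection:
  fixes h :: "'e::euclidean_space \<times> 'g::euclidean_space \<Rightarrow> real"
  assumes \<rho>: "0 \<le> \<rho>" "\<rho> \<le> 1" and Y: "open Y" "convex Y" "cball x0 \<rho> \<times> Y \<subseteq> W"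
    and usc: "usc_on W (\<lambda>z. ereal (h z))"
    and qc: "\<And>x \<beta>. x \<in> cball x0 \<rho> \<Longrightarrow> convex {y \<in> Y. h (x, y) < \<beta>}"
    and q: "continuous_on (cball x0 \<rho>) q"
    and near: "\<And>x. x \<in> cball x0 \<rho> \<Longrightarrow> \<exists>y\<in>Y. h (x, y) < q x"
  obtains Z C r where "trig_poly Z" "compact C" "convex C" "r > 0" "\<And>y. y \<in> C \<Longrightarrow> cball y r \<subseteq> Y"
    "\<And>x. Z x \<in> C" "\<And>x. x \<in> cball x0 \<rho> \<Longrightarrow> h (x, Z x) < q x"
proof -
  let ?K = "cball x0 \<rho>"
  obtain A y where A: "finite A" "A \<subseteq> Y" and y: "continuous_on ?K y"
    "\<And>x. x \<in> ?K \<Longrightarrow> y x \<in> convex hull A" "\<And>x. x \<in> ?K \<Longrightarrow> h (x, y x) < q x"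
    using quasiconvex_selection[OF compact_cball Y(2,3) usc qc q near] by blast
  define C0 where "C0 = convex hull A"
  have C0: "compact C0" "convex C0" "C0 \<subseteq> Y"
    unfolding C0_def using A Y by (auto intro: finite_imp_compact_convex_hull hull_minimal convex_convex_hull)
      (metis hull_minimal subsetD)
  obtain e where e: "e > 0" "(\<Union>x\<in>C0. cball x e) \<subseteq> Y"
    using compact_subset_open_imp_cball_epsilon_subset[OF C0(1) Y(1) C0(3)] by blast
  \<comment> \<open>The radius \<open>e\<close> is shared evenly: one half for the approximation
    error, so that \<open>Z\<close> takes values in \<open>C\<close>, and one half for the balls
    around points of \<open>C\<close> that must fit in \<open>Y\<close>.\<close>
  define C where "C = {u + v |u v. u \<in> C0 \<and> v \<in> cball 0 (e/2)}"
  have C: "compact C" "convex C"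
  proof -
    show "compact C" unfolding C_def by (rule compact_sums[OF C0(1) compact_cball])
    have "C = (\<Union>x\<in>C0. \<Union>y\<in>cball 0 (e/2). {x + y})" unfolding C_def by blast
    then show "convex C" using convex_sums[OF C0(2) convex_cball] by simp
  qed
  have CY: "cball z (e/2) \<subseteq> Y" if zC: "z \<in> C" for z
  proof
    fix w assume w: "w \<in> cball z (e/2)"
    obtain u v where uv: "z = u + v" "u \<in> C0" "v \<in> cball 0 (e/2)" using zC unfolding C_def by blast
    have "dist u w \<le> dist u z + dist z w" by (rule dist_triangle)
    also have "\<dots> \<le> e/2 + e/2" using uv w by (intro add_mono) (auto simp: dist_norm)
    finally have "w \<in> cball u e" by simp
    then show "w \<in> Y" using e(2) uv(2) by blast
  qed
  define L where "L = {z \<in> ?K \<times> C. ereal 0 \<le> ereal (h z + - q (fst z))}"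
  have KC: "?K \<times> C \<subseteq> W" using CY e Y(3) by force
  have "compact L" unfolding L_def
    by (intro usc_compact_superlevel compact_Times compact_cball C usc_on_add_continuous
        usc_on_subset[OF usc KC] continuous_intros continuous_on_compose2[OF q]) auto
  have "\<exists>d>0. \<forall>z\<in>L. d \<le> norm (snd z - y (fst z))"
  proof (cases "L = {}")
    case True then show ?thesis by (auto intro: exI[of _ 1])
  next
    case False
    have "continuous_on L (\<lambda>z. norm (snd z - y (fst z)))"
      by (intro continuous_intros continuous_on_compose2[OF y(1)]) (auto simp: L_def)
    then obtain z where z: "z \<in> L" "\<And>w. w \<in> L \<Longrightarrow> norm (snd z - y (fst z)) \<le> norm (snd w - y (fst w))"
      using continuous_attains_inf[OF \<open>compact L\<close> False] by blast
    have "snd z \<noteq> y (fst z)"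
    proof
      assume "snd z = y (fst z)"
      then have "z = (fst z, y (fst z))" by (metis prod.collapse)
      moreover have "fst z \<in> ?K" "q (fst z) \<le> h z" using z(1) by (auto simp: L_def)
      ultimately show False using y(3) by (metis not_le)
    qed
    then show ?thesis using z by (intro exI[of _ "norm (snd z - y (fst z))"]) auto
  qed
  then obtain d where d: "d > 0" "\<And>z. z \<in> L \<Longrightarrow> d \<le> norm (snd z - y (fst z))" by blast
  obtain Z where Z: "trig_poly Z" "\<And>x. x \<in> ?K \<Longrightarrow> norm (Z x - y x) < min (e/2) d"
    "\<And>x. \<exists>x'\<in>?K. norm (Z x - y x') < min (e/2) d"
    using approximate_by_trig_poly[OF y(1) \<rho>, of "min (e/2) d"] e d by auto
  have ZC: "Z x \<in> C" for x
  proof -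
    obtain x' where "x' \<in> ?K" "norm (Z x - y x') < min (e/2) d" using Z(3) by blast
    then show ?thesis unfolding C_def using y(2)[of x']
      by (intro CollectI exI[of _ "y x'"] exI[of _ "Z x - y x'"]) (auto simp: C0_def)
  qed
  show ?thesis
  proof (rule that[of Z C "e/2"])
    fix x assume x: "x \<in> ?K"
    show "h (x, Z x) < q x"
    proof (rule ccontr)
      assume "\<not> ?thesis"
      then have "(x, Z x) \<in> L" using x ZC by (auto simp: L_def)
      from d(2)[OF this] Z(2)[OF x] show False by simp
    qed
  qed (use Z C CY ZC e in auto)
qed

text \<open>Earlier times alone are compared, because the maximum in the comparison argument may
  occur at the final time.\<close>

lemma derivative_nonneg_at_left_max:
  fixes f :: "real \<Rightarrow> real"
  assumes "(f has_real_derivative D) (at t)" "0 < t" "\<And>s. 0 \<le> s \<Longrightarrow> s \<le> t \<Longrightarrow> f s \<le> f t"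
  shows "D \<ge> 0"
proof (rule ccontr)
  assume "\<not> ?thesis"
  then obtain d where d: "d > 0" "\<And>h. 0 < h \<Longrightarrow> h < d \<Longrightarrow> f t < f (t - h)"
    using DERIV_neg_dec_left[OF assms(1)] by auto
  have "f t < f (t - min (d/2) t)" using d assms(2) by (intro d) auto
  moreover have "f (t - min (d/2) t) \<le> f t" using d(1) assms(2) by (intro assms(3)) auto
  ultimately show False by simp
qed

text \<open>
  The term \<open>\<mu> (|x - x0|\<^sup>2 + L t)\<^sup>2\<close> of the supersolution dominates on the lateral boundary without any
  control of the data there, and is only \<open>O(t\<^sup>2)\<close> at the centre.
\<close>

lemma graph_comparison:
  fixes h :: "'e::euclidean_space \<times> 'g::euclidean_space \<Rightarrow> real" and b :: 'e
  defines "\<sigma> ss \<equiv> (\<Sum>s\<leftarrow>ss. (norm s)\<^sup>2)"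
  assumes W: "usc_on W (\<lambda>z. ereal (h z))" "graph_sub ss b a c W (\<lambda>z. ereal (h z))" and a: "a \<ge> 0"
    and \<rho>: "\<rho> > 0" and Y: "cball x0 \<rho> \<times> Y \<subseteq> W"
    and M: "\<And>x y. x \<in> cball x0 \<rho> \<Longrightarrow> y \<in> Y \<Longrightarrow> h (x, y) \<le> M"
    and P: "linear P" and B: "bilinear B" "\<And>v w. B v w = B w v"
    and q: "\<And>x. q x = q0 + (P (x - x0) + (1/2) * B (x - x0) (x - x0))"
    and strict: "\<And>x. x \<in> cball x0 \<rho> \<Longrightarrow> (\<Sum>s\<leftarrow>ss. B s s) + (P b + B (x - x0) b) - a * q x - c \<le> - 2 * \<kappa>"
    and \<kappa>: "\<kappa> > 0" and \<tau>: "\<tau> > 0" "a * \<tau> \<le> 1/2" and \<mu>: "\<mu> \<ge> 0"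
    and lateral: "\<And>x. dist x0 x = \<rho> \<Longrightarrow> M \<le> q x - \<kappa> * \<tau> + \<mu> * \<rho> ^ 4"
    and \<eta>: "\<eta> \<ge> 0" and L: "L = 6 * \<sigma> ss + 2 * \<rho> * norm b"
    and U: "heat_flow ss Z U PU QU" and C: "compact C" "convex C" "r > 0" "\<And>y. y \<in> C \<Longrightarrow> cball y r \<subseteq> Y"
    and Z: "\<And>x. Z x \<in> C" "\<And>x. x \<in> cball x0 \<rho> \<Longrightarrow> h (x, Z x) < q x + \<eta>"
  shows "h (x0, U \<tau> x0) \<le> q0 + \<eta> - \<kappa> * \<tau> + \<mu> * (L * \<tau>)\<^sup>2"
proof (rule ccontr)
  assume contr: "\<not> ?thesis"
  have \<sigma>: "\<sigma> ss \<ge> 0" unfolding \<sigma>_def by (rule sum_list_nonneg) auto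
  then have L0: "L \<ge> 0" using \<rho> by (simp add: L)
  define R where "R = (\<lambda>t x. (norm (x + - x0))\<^sup>2 + L * t)"
  define v where "v = (\<lambda>t x. (q0 + \<eta> - \<kappa> * t + (P (x - x0) + (1/2) * B (x - x0) (x - x0))) + \<mu> * (R t x)\<^sup>2)"
  have vq: "v t x = q x + \<eta> - \<kappa> * t + \<mu> * (R t x)\<^sup>2" for t x by (simp add: v_def q)
  have UC: "U t x \<in> C" if "t \<ge> 0" for t x
    by (rule heat_flow_convex[OF U compact_imp_closed[OF C(1)] C(2) Z(1) that])
  have Ucont: "continuous_on UNIV (\<lambda>z. U (fst z) (snd z))" using U by (simp add: heat_flow_def)
  have contP: "continuous_on UNIV P" using P linear_continuous_on linear_conv_bounded_linear by blast
  have contB: "continuous_on UNIV (\<lambda>v. B v v)"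
    using B(1) bilinear_conv_bounded_bilinear bounded_bilinear.continuous_on[of B, OF _ continuous_on_id continuous_on_id] by blast
  \<comment> \<open>The range of \<open>y\<close> in the comparison: it contains the
    \<open>r\<close>-neighbourhood of the moving graph at all times \<open>t >= 0\<close>, yet is
    compact and inside \<open>Y\<close>.\<close>
  define C2 where "C2 = {u + w |u w. u \<in> C \<and> w \<in> cball 0 r}"
  have C2: "compact C2" unfolding C2_def by (intro compact_sums C compact_cball)
  have C2Y: "C2 \<subseteq> Y" using C(4) unfolding C2_def by (fastforce simp: dist_norm)
  have C2I: "y \<in> C2" if "u \<in> C" "norm (y - u) \<le> r" for u y
    unfolding C2_def using that by (intro CollectI exI[of _ u] exI[of _ "y - u"]) auto
  define D where "D = {0..\<tau>} \<times> cball x0 \<rho> \<times> C2"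
  have D: "compact D" unfolding D_def by (intro compact_Times compact_cball C2 compact_Icc)
  define F where "F = (\<lambda>z. h (snd z) + - v (fst z) (fst (snd z)))"
  define \<psi> where "\<psi> = (\<lambda>z. (norm (snd (snd z) - U (fst z) (fst (snd z))))\<^sup>2)"
  have contU: "continuous_on A (\<lambda>z::real \<times> 'e \<times> 'g. U (fst z) (fst (snd z)))" for A
  proof -
    have "continuous_on A (\<lambda>z::real \<times> 'e \<times> 'g. (fst z, fst (snd z)))" by (intro continuous_intros)
    then show ?thesis using continuous_on_compose2[OF Ucont, of A "\<lambda>z. (fst z, fst (snd z))"] by simp
  qed
  have usc: "usc_on D (\<lambda>z. ereal (F z))" unfolding F_def
  proof (intro usc_on_add_continuous)
    show "usc_on D (\<lambda>z. ereal (h (snd z)))"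
      by (rule usc_on_compose[OF W(1)]) (use C2Y Y in \<open>auto simp: D_def intro: continuous_intros\<close>)
    show "continuous_on D (\<lambda>z. - v (fst z) (fst (snd z)))"
      unfolding v_def R_def
      by (intro continuous_intros continuous_on_compose2[OF contP] continuous_on_compose2[OF contB]) auto
  qed
  define \<zeta> where "\<zeta> = (\<tau>, x0, U \<tau> x0)"
  have \<zeta>D: "\<zeta> \<in> D" using \<tau> \<rho> C2I[OF UC[of \<tau> x0], of "U \<tau> x0"] C(3) by (auto simp: \<zeta>_def D_def)
  have F\<zeta>: "F \<zeta> > 0"
    using contr by (simp add: F_def \<zeta>_def v_def R_def linear_0[OF P] bilinear_lzero[OF B(1)])
  \<comment> \<open>The parabolic boundary together with the points far from the graph; the final
    time \<open>\<tau>\<close> is kept out of it. On the graph only the initial and lateral parts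
    occur, and there \<open>h <= v\<close>.\<close>
  define E where "E = {z \<in> D. fst z = 0 \<or> dist x0 (fst (snd z)) = \<rho> \<or> norm (snd (snd z) - U (fst z) (fst (snd z))) \<ge> r}"
  have E: "compact E"
  proof -
    have "closed {z::real \<times> 'e \<times> 'g. fst z = 0 \<or> dist x0 (fst (snd z)) = \<rho> \<or> norm (snd (snd z) - U (fst z) (fst (snd z))) \<ge> r}"
      by (intro closed_Collect_disj closed_Collect_eq closed_Collect_le continuous_intros contU)
    moreover have "E = D \<inter> {z. fst z = 0 \<or> dist x0 (fst (snd z)) = \<rho> \<or> norm (snd (snd z) - U (fst z) (fst (snd z))) \<ge> r}"
      by (auto simp: E_def)
    ultimately show ?thesis using D by (simp add: compact_Int_closed)
  qed
  have FE: "F z < F \<zeta>" if z: "z \<in> E" "\<psi> z = 0" for z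
  proof -
    obtain t x y where zz: "z = (t, x, y)" by (cases z) auto
    have t: "0 \<le> t" "t \<le> \<tau>" and x: "x \<in> cball x0 \<rho>" and y: "y \<in> C2" using z by (auto simp: E_def D_def zz)
    have yU: "y = U t x" using z by (simp add: \<psi>_def zz)
    then consider "t = 0" | "dist x0 x = \<rho>" using z C(3) by (auto simp: E_def zz)
    then have "h (x, y) \<le> v t x"
    proof cases
      case 1
      then have "y = Z x" using yU U by (simp add: heat_flow_def)
      then have "h (x, y) < q x + \<eta>" using Z x by simp
      also have "\<dots> \<le> v t x" unfolding vq using \<mu> 1 by simp
      finally show ?thesis by simp
    next
      case 2
      have "\<rho>\<^sup>2 \<le> R t x" using 2 L0 t by (simp add: R_def dist_norm norm_minus_commute)
      then have "(\<rho>\<^sup>2)\<^sup>2 \<le> (R t x)\<^sup>2" by (intro power_mono) auto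
      then have "\<mu> * \<rho> ^ 4 \<le> \<mu> * (R t x)\<^sup>2" using \<mu> by (intro mult_left_mono) (auto simp flip: power_mult)
      moreover have "\<kappa> * t \<le> \<kappa> * \<tau>" using t \<kappa> by simp
      moreover have "h (x, y) \<le> M" using M x y C2Y by blast
      ultimately show ?thesis unfolding vq using lateral[OF 2] \<eta> by linarith
    qed
    then show ?thesis using F\<zeta> by (simp add: F_def zz)
  qed
  obtain N z where N: "N \<ge> 0" and z: "z \<in> D - E" "F \<zeta> \<le> F z - N * \<psi> z"
    and mx: "\<And>z'. z' \<in> D \<Longrightarrow> F z' - N * \<psi> z' \<le> F z - N * \<psi> z"
  proof (rule penalization[OF D usc _ _ \<zeta>D _ _ E FE])
    show "continuous_on D \<psi>" unfolding \<psi>_def by (intro continuous_intros contU)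
  qed (auto simp: \<psi>_def \<zeta>_def E_def)
  obtain t x y where zz: "z = (t, x, y)" by (cases z) auto
  have t: "0 < t" "t \<le> \<tau>" and x: "dist x0 x < \<rho>" and y: "y \<in> C2" "norm (y - U t x) < r"
    using z by (auto simp: E_def D_def zz)
  define \<delta> where "\<delta> = snd (x, y) + (- 1) *\<^sub>R U t (fst (x, y))"
  have \<delta>: "\<delta> = y - U t x" by (simp add: \<delta>_def)
  have jU: "jet2 (U t) x (PU t x) (QU t x)" using U by (simp add: heat_flow_def)
  then have linU: "linear (PU t x)" by (simp add: jet2_def)
  define Pv where "Pv = (\<lambda>w. (P w + B (x - x0) w) + \<mu> * (2 * (R t x * (2 * ((x + - x0) \<bullet> w)))))"
  define Qv where "Qv = (\<lambda>w. B w w + \<mu> * (2 * (R t x * (2 * ((x + - x0) \<bullet> 0) + 2 * (norm w)\<^sup>2)) + 2 * (2 * ((x + - x0) \<bullet> w))\<^sup>2))"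
  have jv: "jet2 (v t) x Pv Qv"
  proof -
    have 1: "jet2 (\<lambda>x. (norm (x + - x0))\<^sup>2) x (\<lambda>w. 2 * ((x + - x0) \<bullet> w)) (\<lambda>w. 2 * ((x + - x0) \<bullet> 0) + 2 * (norm w)\<^sup>2)"
      by (rule jet2_norm2_comp[OF jet2_affine]) (rule linear_id[unfolded id_def])
    have 2: "jet2 (R t) x (\<lambda>w. 2 * ((x + - x0) \<bullet> w)) (\<lambda>w. 2 * ((x + - x0) \<bullet> 0) + 2 * (norm w)\<^sup>2)"
      using jet2_add[OF 1 jet2_const[of "L * t"]] unfolding R_def by simp
    have 3: "jet2 (\<lambda>x. q0 + \<eta> - \<kappa> * t + (P (x - x0) + (1/2) * B (x - x0) (x - x0))) x (\<lambda>w. P w + B (x - x0) w) (\<lambda>w. B w w)"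
      using jet2_add[OF jet2_const[of "q0 + \<eta> - \<kappa> * t"] jet2_quadratic[OF P B, of x0 x]] by simp
    show ?thesis unfolding v_def Pv_def Qv_def
      by (rule jet2_add[OF 3 jet2_cmult[OF jet2_power2_comp[OF 2]]])
  qed
  define \<phi> where "\<phi> = (\<lambda>z. v t (fst z) + N * (norm (snd z + (- 1) *\<^sub>R U t (fst z)))\<^sup>2)"
  have "touches (\<lambda>z. ereal (h z)) (x, y) \<phi>" unfolding touches_real
  proof -
    let ?O = "{z. dist x0 (fst z) < \<rho> \<and> norm (snd z - U t x) < r}"
    have "open ?O" by (intro open_Collect_conj open_Collect_less continuous_intros)
    moreover have "(x, y) \<in> ?O" using x y by simp
    ultimately have "\<forall>\<^sub>F z' in nhds (x, y). z' \<in> ?O" by (rule eventually_nhds_in_open)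
    then show "\<forall>\<^sub>F z' in nhds (x, y). h z' \<le> h (x, y) + (\<phi> z' - \<phi> (x, y))"
    proof eventually_elim
      case (elim z')
      have "snd z' \<in> C2" using elim t by (intro C2I[OF UC[of t x]]) auto
      then have "(t, fst z', snd z') \<in> D" using elim t by (auto simp: D_def mem_Times_iff)
      from mx[OF this] show ?case by (simp add: F_def \<psi>_def \<phi>_def zz)
    qed
  qed
  moreover have "jet2 \<phi> (x, y)
      (\<lambda>w. Pv (fst w) + N * (2 * (\<delta> \<bullet> (snd w + (- 1) *\<^sub>R PU t x (fst w)))))
      (\<lambda>w. Qv (fst w) + N * (2 * (\<delta> \<bullet> (0 + (- 1) *\<^sub>R QU t x (fst w))) + 2 * (norm (snd w + (- 1) *\<^sub>R PU t x (fst w)))\<^sup>2))"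
    unfolding \<phi>_def \<delta>_def
  proof (rule jet2_add[OF jet2_comp_linear[OF _ linear_fst] jet2_cmult[OF jet2_norm2_comp[OF jet2_add[OF jet2_linear[OF linear_snd]]]]])
    show "jet2 (v t) (fst (x, y)) Pv Qv" using jv by simp
    have "jet2 (\<lambda>z. U t (fst z)) (x, y) (\<lambda>w. PU t x (fst w)) (\<lambda>w. QU t x (fst w))"
      by (rule jet2_comp_linear[OF _ linear_fst]) (use jU in simp)
    then show "jet2 (\<lambda>z. (- 1) *\<^sub>R U t (fst z)) (x, y) (\<lambda>w. (- 1) *\<^sub>R PU t x (fst w)) (\<lambda>w. (- 1) *\<^sub>R QU t x (fst w))"
      by (rule jet2_linear_left) (auto simp: linear_iff)
  qed
  moreover have "(x, y) \<in> W" using Y C2Y x y by auto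
  \<comment> \<open>The test uses \<open>\<Gamma> = PU t x\<close>, the derivative of the graph over
    \<open>x\<close>. The map \<open>w \<mapsto> snd w - PU t x (fst w)\<close> vanishes on
    \<open>(s, \<Gamma> s)\<close> and \<open>(b, \<Gamma> b)\<close>, so of the penalty only the
    curvature term with \<open>QU\<close> remains.\<close>
  ultimately have "c \<le> (\<Sum>s\<leftarrow>ss. Qv (fst (s, PU t x s)) + N * (2 * (\<delta> \<bullet> (0 + (- 1) *\<^sub>R QU t x (fst (s, PU t x s)))) + 2 * (norm (snd (s, PU t x s) + (- 1) *\<^sub>R PU t x (fst (s, PU t x s))))\<^sup>2))
     + (Pv (fst (b, PU t x b)) + N * (2 * (\<delta> \<bullet> (snd (b, PU t x b) + (- 1) *\<^sub>R PU t x (fst (b, PU t x b)))))) - a * real_of_ereal (ereal (h (x, y)))"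
    using W(2) linU unfolding graph_sub_def by blast
  then have "c \<le> (\<Sum>s\<leftarrow>ss. Qv s - 2 * N * (\<delta> \<bullet> QU t x s)) + Pv b - a * h (x, y)"
    by (simp add: mult.assoc mult.left_commute)
  also have "(\<Sum>s\<leftarrow>ss. Qv s - 2 * N * (\<delta> \<bullet> QU t x s)) = (\<Sum>s\<leftarrow>ss. Qv s) - 2 * N * (\<delta> \<bullet> (\<Sum>s\<leftarrow>ss. QU t x s))"
    by (induction ss) (auto simp: inner_add_right algebra_simps)
  finally have space: "c \<le> (\<Sum>s\<leftarrow>ss. Qv s) - 2 * N * (\<delta> \<bullet> (\<Sum>s\<leftarrow>ss. QU t x s)) + Pv b - a * h (x, y)" .
  \<comment> \<open>By the heat equation the time derivative of the penalty contains the same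
    \<open>\<delta> \<bullet> (\<Sum>s. QU t x s)\<close>, so adding \<open>space\<close> and
    \<open>time\<close> eliminates \<open>N\<close>.\<close>
  have time: "- (- \<kappa> + \<mu> * (2 * R t x * L)) + 2 * N * (\<delta> \<bullet> (\<Sum>s\<leftarrow>ss. QU t x s)) \<ge> 0"
  proof (rule derivative_nonneg_at_left_max[OF _ t(1)])
    have "((\<lambda>t. U t x) has_derivative (\<lambda>h. h *\<^sub>R (\<Sum>s\<leftarrow>ss. QU t x s))) (at t)"
      using U unfolding heat_flow_def has_vector_derivative_def by blast
    then have "((\<lambda>t. (norm (y - U t x))\<^sup>2) has_derivative (\<lambda>h. h * (- 2 * (\<delta> \<bullet> (\<Sum>s\<leftarrow>ss. QU t x s))))) (at t)"
      unfolding power2_norm_eq_inner \<delta>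
      by (auto intro!: derivative_eq_intros simp: inner_commute algebra_simps)
    then have "((\<lambda>t. (norm (y - U t x))\<^sup>2) has_real_derivative (- 2 * (\<delta> \<bullet> (\<Sum>s\<leftarrow>ss. QU t x s)))) (at t)"
      unfolding has_field_derivative_def mult_commute_abs .
    moreover have "((\<lambda>t. v t x) has_real_derivative (- \<kappa> + \<mu> * (2 * R t x * L))) (at t)"
      unfolding v_def R_def by (auto intro!: derivative_eq_intros)
    ultimately have "((\<lambda>t. - v t x - N * (norm (y - U t x))\<^sup>2) has_real_derivative
       (- (- \<kappa> + \<mu> * (2 * R t x * L)) - N * (- 2 * (\<delta> \<bullet> (\<Sum>s\<leftarrow>ss. QU t x s))))) (at t)"
      by (intro DERIV_diff DERIV_minus DERIV_cmult)
    then show "((\<lambda>t. - v t x - N * (norm (y - U t x))\<^sup>2) has_real_derivative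
       (- (- \<kappa> + \<mu> * (2 * R t x * L)) + 2 * N * (\<delta> \<bullet> (\<Sum>s\<leftarrow>ss. QU t x s)))) (at t)"
      by (simp add: mult.assoc mult.left_commute)
    fix s assume s: "0 \<le> s" "s \<le> t"
    then have "(s, x, y) \<in> D" using t x y by (auto simp: D_def)
    from mx[OF this] show "- v s x - N * (norm (y - U s x))\<^sup>2 \<le> - v t x - N * (norm (y - U t x))\<^sup>2"
      by (simp add: F_def \<psi>_def zz)
  qed
  have R0: "(norm (x - x0))\<^sup>2 \<le> R t x" "R t x \<ge> 0" using L0 t by (auto simp: R_def)
  \<comment> \<open>The square of \<open>R\<close> contributes \<open>4 \<mu> R |s|^2\<close>
    through the Hessian of \<open>R\<close> and
    \<open>8 \<mu> ((x - x0) \<bullet> s)^2 <= 8 \<mu> R |s|^2\<close> through its gradient. The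
    total of 12, and the 4 in \<open>Pb\<close>, are matched by \<open>2 \<mu> R L\<close> from the
    time derivative; this fixes \<open>L\<close>.\<close>
  have Qv: "Qv s \<le> B s s + 12 * \<mu> * R t x * (norm s)\<^sup>2" for s
  proof -
    have "((x - x0) \<bullet> s)\<^sup>2 \<le> (norm (x - x0) * norm s)\<^sup>2"
      using Cauchy_Schwarz_ineq2[of "x - x0" s] by (metis abs_ge_zero power2_abs power_mono)
    also have "\<dots> \<le> R t x * (norm s)\<^sup>2" unfolding power_mult_distrib by (intro mult_right_mono R0) auto
    finally have "\<mu> * ((x - x0) \<bullet> s)\<^sup>2 \<le> \<mu> * (R t x * (norm s)\<^sup>2)" using \<mu> by (rule mult_left_mono)
    moreover define i where "i = (x + - x0) \<bullet> s"
    ultimately have "\<mu> * i\<^sup>2 \<le> \<mu> * (R t x * (norm s)\<^sup>2)" by simp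
    then show ?thesis unfolding Qv_def i_def[symmetric] by (simp add: power_mult_distrib algebra_simps)
  qed
  have "(\<Sum>s\<leftarrow>ss. Qv s) \<le> (\<Sum>s\<leftarrow>ss. B s s + 12 * \<mu> * R t x * (norm s)\<^sup>2)" by (rule sum_list_mono) (rule Qv)
  also have "\<dots> = (\<Sum>s\<leftarrow>ss. B s s) + 12 * \<mu> * R t x * \<sigma> ss"
    unfolding \<sigma>_def by (simp add: sum_list_addf sum_list_const_mult)
  finally have Qs: "(\<Sum>s\<leftarrow>ss. Qv s) \<le> (\<Sum>s\<leftarrow>ss. B s s) + 12 * \<mu> * R t x * \<sigma> ss" .
  have Pb: "Pv b \<le> P b + B (x - x0) b + 4 * \<mu> * R t x * (\<rho> * norm b)"
  proof -
    have "(x - x0) \<bullet> b \<le> norm (x - x0) * norm b" by (rule norm_cauchy_schwarz)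
    also have "\<dots> \<le> \<rho> * norm b" using x by (intro mult_right_mono) (auto simp: dist_norm norm_minus_commute)
    finally have "(4 * \<mu> * R t x) * ((x - x0) \<bullet> b) \<le> (4 * \<mu> * R t x) * (\<rho> * norm b)" using \<mu> R0 by (intro mult_left_mono) auto
    then show ?thesis unfolding Pv_def by (simp add: algebra_simps)
  qed
  have "h (x, y) \<ge> v t x"
  proof -
    have "N * \<psi> z \<ge> 0" using N by (simp add: \<psi>_def)
    then have "F z > 0" using z(2) F\<zeta> by linarith
    then show ?thesis by (simp add: F_def zz)
  qed
  moreover have "v t x \<ge> q x - \<kappa> * \<tau>"
  proof -
    have "\<kappa> * t \<le> \<kappa> * \<tau>" using t \<kappa> by simp
    moreover have "\<mu> * (R t x)\<^sup>2 \<ge> 0" using \<mu> by simp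
    ultimately show ?thesis unfolding vq using \<eta> by linarith
  qed
  ultimately have "a * q x - a * (\<kappa> * \<tau>) \<le> a * h (x, y)"
    unfolding right_diff_distrib[symmetric] using a by (intro mult_left_mono) auto
  moreover have "a * (\<kappa> * \<tau>) \<le> \<kappa> / 2" using mult_left_mono[OF \<tau>(2), of \<kappa>] \<kappa> by (simp add: mult_ac)
  moreover have "\<mu> * (2 * R t x * L) = 12 * \<mu> * R t x * \<sigma> ss + 4 * \<mu> * R t x * (\<rho> * norm b)"
    by (simp add: L algebra_simps)
  moreover have "(\<Sum>s\<leftarrow>ss. B s s) + (P b + B (x - x0) b) - a * q x - c \<le> - 2 * \<kappa>" using x by (intro strict) auto
  \<comment> \<open>Budget of the strict gap \<open>2 \<kappa>\<close>: the decrease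
    \<open>\<kappa> * t\<close> in \<open>v\<close> takes \<open>\<kappa>\<close>, the term
    \<open>a * h\<close> takes at most \<open>\<kappa>/2\<close>, and \<open>\<kappa>/2\<close> is
    left for the contradiction.\<close>
  ultimately show False using space time Qs Pb \<kappa> by linarith
qed

text \<open>\<open>near\<close> puts the infimum over \<open>Y\<close> below \<open>q\<close> on the
  ball, and \<open>low\<close> says that \<open>q0\<close> is not undercut over \<open>x0\<close>.
  If the inequality failed, it would fail strictly on a small ball, and the comparison would drive
  the transported graph below \<open>q0\<close> at \<open>x0\<close>.\<close>

theorem marginal_touching_inequality:
  fixes h :: "'e::euclidean_space \<times> 'g::euclidean_space \<Rightarrow> real" and b :: 'e
  assumes W: "open W" "usc_on W (\<lambda>z. ereal (h z))" "graph_sub ss b a c W (\<lambda>z. ereal (h z))"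
      "fibre_sub W (\<lambda>z. ereal (h z))" and a: "a \<ge> 0"
    and \<rho>: "\<rho> > 0" and Y: "open Y" "convex Y" "cball x0 \<rho> \<times> Y \<subseteq> W"
    and M: "\<And>x y. x \<in> cball x0 \<rho> \<Longrightarrow> y \<in> Y \<Longrightarrow> h (x, y) \<le> M"
    and P: "linear P" and B: "bilinear B" "\<And>v w. B v w = B w v"
    and q: "\<And>x. q x = q0 + (P (x - x0) + (1/2) * B (x - x0) (x - x0))"
    and near: "\<And>x \<eta>. x \<in> cball x0 \<rho> \<Longrightarrow> \<eta> > 0 \<Longrightarrow> \<exists>y\<in>Y. h (x, y) < q x + \<eta>"
    and low: "\<And>y. y \<in> Y \<Longrightarrow> q0 \<le> h (x0, y)"
  shows "c \<le> (\<Sum>s\<leftarrow>ss. B s s) + P b - a * q0"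
proof (rule ccontr)
  assume contr: "\<not> ?thesis"
  have contP: "continuous_on UNIV P" using P linear_continuous_on linear_conv_bounded_linear by blast
  have bB: "bounded_bilinear B" using B(1) bilinear_conv_bounded_bilinear by blast
  have contq: "continuous_on A q" for A
    unfolding q by (intro continuous_intros continuous_on_compose2[OF contP] bounded_bilinear.continuous_on[OF bB]) auto
  define \<Lambda> where "\<Lambda> = (\<lambda>x. (\<Sum>s\<leftarrow>ss. B s s) + (P b + B (x - x0) b) - a * q x - c)"
  have \<Lambda>0: "\<Lambda> x0 < 0" using contr by (simp add: \<Lambda>_def q linear_0[OF P] bilinear_lzero[OF B(1)])
  \<comment> \<open>A quarter of the deficit, so that \<open>\<Lambda> <= - 2 \<kappa>\<close>
    persists near \<open>x0\<close> by continuity.\<close>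
  define \<kappa> where "\<kappa> = - \<Lambda> x0 / 4"
  have \<kappa>: "\<kappa> > 0" "\<Lambda> x0 < - 2 * \<kappa>" using \<Lambda>0 by (auto simp: \<kappa>_def)
  have "continuous_on UNIV \<Lambda>" unfolding \<Lambda>_def
    by (intro continuous_intros contq bounded_bilinear.continuous_on[OF bB])
  then have "open {x. \<Lambda> x < - 2 * \<kappa>}" by (intro open_Collect_less continuous_intros)
  then obtain r1 where r1: "r1 > 0" "ball x0 r1 \<subseteq> {x. \<Lambda> x < - 2 * \<kappa>}"
    using \<kappa> open_contains_ball by blast
  \<comment> \<open>The bound 1 keeps the ball where the sine coordinates are invertible.\<close>
  define \<rho>' where "\<rho>' = min (min \<rho> 1) (r1/2)"
  have \<rho>': "\<rho>' > 0" "\<rho>' \<le> 1" "\<rho>' \<le> \<rho>" "\<rho>' < r1" using \<rho> r1 by (auto simp: \<rho>'_def)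
  have K: "cball x0 \<rho>' \<subseteq> cball x0 \<rho>" using \<rho>' by auto
  have strict: "\<Lambda> x \<le> - 2 * \<kappa>" if "x \<in> cball x0 \<rho>'" for x
  proof -
    have "x \<in> ball x0 r1" using that \<rho>' by auto
    then show ?thesis using r1(2) by (meson less_imp_le mem_Collect_eq subsetD)
  qed
  obtain m where m: "\<And>x. x \<in> cball x0 \<rho>' \<Longrightarrow> - m \<le> q x"
  proof -
    obtain w where "\<forall>x\<in>cball x0 \<rho>'. q w \<le> q x"
      using continuous_attains_inf[OF compact_cball _ contq[of "cball x0 \<rho>'"]] \<rho>' by auto
    then show ?thesis using that[of "- q w"] by simp
  qed
  \<comment> \<open>Large enough that on the sphere of radius \<open>\<rho>'\<close> the barrier
    alone covers the difference between \<open>M\<close> and the lower bound \<open>- m\<close> of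
    \<open>q\<close>, with \<open>\<kappa>\<close> in reserve for the term
    \<open>\<kappa> * \<tau>\<close>.\<close>
  define \<mu> where "\<mu> = max 0 (M + m + \<kappa>) / \<rho>' ^ 4"
  have \<mu>: "\<mu> \<ge> 0" "M + m + \<kappa> \<le> \<mu> * \<rho>' ^ 4" using \<rho>' by (auto simp: \<mu>_def)
  define L where "L = 6 * (\<Sum>s\<leftarrow>ss. (norm s)\<^sup>2) + 2 * \<rho>' * norm b"
  \<comment> \<open>Chosen after \<open>\<mu>\<close> and \<open>L\<close>: the barrier error
    \<open>\<mu> (L \<tau>)^2\<close> is quadratic in \<open>\<tau>\<close> and the gain
    \<open>\<kappa> \<tau>\<close> linear. With \<open>\<eta> = \<kappa> \<tau> / 4\<close> the
    final value is at most \<open>q0 - \<kappa> \<tau> / 2\<close>.\<close>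
  define \<tau> where "\<tau> = min 1 (min (1 / (2 * (a + 1))) (\<kappa> / (4 * (\<mu> * L\<^sup>2 + 1))))"
  have den: "\<mu> * L\<^sup>2 + 1 > 0" using \<mu> by (simp add: add_nonneg_pos)
  have \<tau>: "\<tau> > 0" "\<tau> \<le> 1" using a \<kappa> den by (auto simp: \<tau>_def)
  have a\<tau>: "a * \<tau> \<le> 1/2"
  proof -
    have "a * \<tau> \<le> a * (1 / (2 * (a + 1)))" using a by (intro mult_left_mono) (auto simp: \<tau>_def)
    also have "\<dots> \<le> 1/2" using a by (simp add: field_simps)
    finally show ?thesis .
  qed
  have \<mu>\<tau>: "\<mu> * (L * \<tau>)\<^sup>2 \<le> \<kappa> * \<tau> / 4"
  proof -
    have "\<tau> \<le> \<kappa> / (4 * (\<mu> * L\<^sup>2 + 1))" by (simp add: \<tau>_def)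
    then have "\<tau> * (4 * (\<mu> * L\<^sup>2 + 1)) \<le> \<kappa>" using den by (simp add: pos_le_divide_eq)
    then have "\<mu> * L\<^sup>2 * \<tau> \<le> \<kappa> / 4" using \<tau> by (simp add: algebra_simps)
    then have "(\<mu> * L\<^sup>2 * \<tau>) * \<tau> \<le> \<kappa> / 4 * \<tau>" using \<tau> by (intro mult_right_mono) auto
    then show ?thesis by (simp add: power_mult_distrib power2_eq_square mult_ac)
  qed
  define \<eta> where "\<eta> = \<kappa> * \<tau> / 4"
  have \<eta>: "\<eta> > 0" using \<kappa> \<tau> by (simp add: \<eta>_def)
  have KY: "cball x0 \<rho>' \<times> Y \<subseteq> W" using K Y(3) by blast
  have qc: "convex {y \<in> Y. h (x, y) < \<beta>}" if x: "x \<in> cball x0 \<rho>'" for x \<beta>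
    unfolding convex_contains_segment
  proof (intro ballI)
    fix y0 y1 assume y: "y0 \<in> {y \<in> Y. h (x, y) < \<beta>}" "y1 \<in> {y \<in> Y. h (x, y) < \<beta>}"
    then have seg: "closed_segment y0 y1 \<subseteq> Y" using Y(2) by (auto simp: convex_contains_segment)
    have "h (x, y') \<le> max (h (x, y0)) (h (x, y1))" if "y' \<in> closed_segment y0 y1" for y'
      by (rule fibre_sub_quasiconvex[OF W(1,2,4) _ that]) (use seg KY x in auto)
    then show "closed_segment y0 y1 \<subseteq> {y \<in> Y. h (x, y) < \<beta>}" using seg y by force
  qed
  obtain Z C r where ZC: "trig_poly Z" "compact C" "convex C" "r > 0" "\<And>y. y \<in> C \<Longrightarrow> cball y r \<subseteq> Y"
    "\<And>x. Z x \<in> C" "\<And>x. x \<in> cball x0 \<rho>' \<Longrightarrow> h (x, Z x) < q x + \<eta>"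
  proof (rule trig_selection[of \<rho>' Y x0 W h "\<lambda>x. q x + \<eta>"])
    show "continuous_on (cball x0 \<rho>') (\<lambda>x. q x + \<eta>)" by (intro continuous_intros contq)
    show "\<exists>y\<in>Y. h (x, y) < q x + \<eta>" if "x \<in> cball x0 \<rho>'" for x using near[of x \<eta>] K that \<eta> by auto
  qed (use \<rho>' Y KY W qc in auto)
  obtain U PU QU where U: "heat_flow ss Z U PU QU" using trig_poly_heat_flow[OF ZC(1)] by blast
  have "h (x0, U \<tau> x0) \<le> q0 + \<eta> - \<kappa> * \<tau> + \<mu> * (L * \<tau>)\<^sup>2"
  proof (rule graph_comparison[OF W(2,3) a \<rho>'(1) KY _ P B q _ \<kappa>(1) \<tau>(1) a\<tau> \<mu>(1) _ _ L_def U ZC(2-7)])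
    show "h (x, y) \<le> M" if "x \<in> cball x0 \<rho>'" "y \<in> Y" for x y using M K that by blast
    show "(\<Sum>s\<leftarrow>ss. B s s) + (P b + B (x - x0) b) - a * q x - c \<le> - 2 * \<kappa>" if "x \<in> cball x0 \<rho>'" for x
      using strict[OF that] by (simp add: \<Lambda>_def)
    show "M \<le> q x - \<kappa> * \<tau> + \<mu> * \<rho>' ^ 4" if "dist x0 x = \<rho>'" for x
    proof -
      have "\<kappa> * \<tau> \<le> \<kappa>" using \<kappa> \<tau> by simp
      then show ?thesis using m[of x] that \<mu>(2) by simp
    qed
  qed (use \<eta> in auto)
  also have "\<dots> < q0" using \<mu>\<tau> \<eta> unfolding \<eta>_def by linarith
  finally have "h (x0, U \<tau> x0) < q0" .
  moreover have "U \<tau> x0 \<in> C"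
    by (rule heat_flow_convex[OF U compact_imp_closed[OF ZC(2)] ZC(3,6)]) (use \<tau> in auto)
  then have "U \<tau> x0 \<in> Y" using ZC(4,5) by force
  ultimately show False using low by fastforce
qed

section \<open>Marginal functions of subsolutions\<close>

definition marg :: "('e \<times> 'g) set \<Rightarrow> ('e \<times> 'g \<Rightarrow> ereal) \<Rightarrow> 'e \<Rightarrow> ereal" where
  "marg W f x = (INF y\<in>{y. (x, y) \<in> W}. f (x, y))"

lemma usc_on_marg:
  fixes f :: "'e::topological_space \<times> 'g::topological_space \<Rightarrow> ereal"
  assumes W: "open W" and f: "usc_on W f" shows "usc_on (fst ` W) (marg W f)"
proof (rule usc_onI)
  fix x a assume "x \<in> fst ` W" "marg W f x < a"
  then obtain y where y: "(x, y) \<in> W" "f (x, y) < a" unfolding marg_def INF_less_iff by auto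
  then obtain U where U: "open U" "(x, y) \<in> U" "\<And>z. z \<in> U \<Longrightarrow> z \<in> W \<Longrightarrow> f z < a" using usc_onD[OF f] by blast
  then have "open (U \<inter> W)" "(x, y) \<in> U \<inter> W" using W y by auto
  then obtain A B where AB: "open A" "open B" "x \<in> A" "y \<in> B" "A \<times> B \<subseteq> U \<inter> W"
    by (metis open_prod_elim mem_Sigma_iff)
  have "marg W f x' < a" if "x' \<in> A" for x'
  proof -
    have "(x', y) \<in> U \<inter> W" using AB that by blast
    then show ?thesis unfolding marg_def INF_less_iff using U(3) by blast
  qed
  then show "\<exists>U. open U \<and> x \<in> U \<and> (\<forall>y\<in>U \<inter> fst ` W. marg W f y < a)" using AB by blast
qed

section \<open>Truncation by the exhaustion\<close>

lemma touches_cong: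
  assumes "open W" "z \<in> W" "\<And>w. w \<in> W \<Longrightarrow> f w = g w" shows "touches f z \<phi> \<longleftrightarrow> touches g z \<phi>"
proof -
  have "\<forall>\<^sub>F y in nhds z. f y = g y"
    using eventually_nhds_in_open[OF assms(1,2)] by eventually_elim (rule assms(3))
  then have "(\<forall>\<^sub>F y in nhds z. f y \<le> f z + ereal (\<phi> y - \<phi> z)) \<longleftrightarrow> (\<forall>\<^sub>F y in nhds z. g y \<le> f z + ereal (\<phi> y - \<phi> z))"
    by (intro eventually_cong) (auto elim: eventually_mono)
  then show ?thesis unfolding touches_def using assms(3)[OF assms(2)] by simp
qed

lemma graph_sub_cong:
  assumes "open W" "\<And>w. w \<in> W \<Longrightarrow> f w = g w" "graph_sub ss b a c W f" shows "graph_sub ss b a c W g"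
  using assms(3) unfolding graph_sub_def
  by (auto simp: touches_cong[OF assms(1) _ assms(2), symmetric] assms(2)[symmetric])

lemma fibre_sub_cong:
  assumes "open W" "\<And>w. w \<in> W \<Longrightarrow> f w = g w" "fibre_sub W f" shows "fibre_sub W g"
  using assms(3) unfolding fibre_sub_def
  by (auto simp: touches_cong[OF assms(1) _ assms(2), symmetric])

lemma touches_max_cases:
  assumes "touches (\<lambda>z. max (f z) (ereal (u z - j))) z \<phi>"
  obtains "touches f z \<phi>" "max (f z) (ereal (u z - j)) = f z"
  | "touches (\<lambda>z. ereal (u z)) z \<phi>" "max (f z) (ereal (u z - j)) = ereal (u z - j)"
proof (cases "ereal (u z - j) \<le> f z")
  case True
  then have m: "max (f z) (ereal (u z - j)) = f z" by simp
  have "touches f z \<phi>" unfolding touches_def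
  proof
    show "\<bar>f z\<bar> \<noteq> \<infinity>" using assms m unfolding touches_def by simp
    show "\<forall>\<^sub>F y in nhds z. f y \<le> f z + ereal (\<phi> y - \<phi> z)"
      using assms unfolding touches_def m by (auto elim: eventually_mono)
  qed
  then show ?thesis using that(1) m by blast
next
  case False
  then have m: "max (f z) (ereal (u z - j)) = ereal (u z - j)" by simp
  have "touches (\<lambda>z. ereal (u z)) z \<phi>" unfolding touches_real
    using assms unfolding touches_def m by (auto elim: eventually_mono)
  then show ?thesis using that(2) m by blast
qed

text \<open>Where the second function is active the inequality is inherited from \<open>u\<close>:
  lowering the value by \<open>j\<close> helps because \<open>a >= 0\<close>, which is the
  Negativity Property of a half-space.\<close>

lemma graph_sub_max:
  fixes f :: "'e::euclidean_space \<times> 'g::euclidean_space \<Rightarrow> ereal"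
  assumes f: "graph_sub ss b a c W f" and u: "graph_sub ss b a c W (\<lambda>z. ereal (u z))" and "a \<ge> 0" "j \<ge> 0"
  shows "graph_sub ss b a c W (\<lambda>z. max (f z) (ereal (u z - j)))"
  unfolding graph_sub_def
proof (intro ballI allI impI)
  fix z \<phi> P Q and \<Gamma> :: "'e \<Rightarrow> 'g"
  assume z: "z \<in> W" and t: "touches (\<lambda>z. max (f z) (ereal (u z - j))) z \<phi>" and J: "jet2 \<phi> z P Q" and "linear \<Gamma>"
  from t show "c \<le> (\<Sum>s\<leftarrow>ss. Q (s, \<Gamma> s)) + P (b, \<Gamma> b) - a * real_of_ereal (max (f z) (ereal (u z - j)))"
  proof (cases rule: touches_max_cases)
    case 1 then show ?thesis using f z J \<open>linear \<Gamma>\<close> unfolding graph_sub_def by simp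
  next
    case 2
    then have "c \<le> (\<Sum>s\<leftarrow>ss. Q (s, \<Gamma> s)) + P (b, \<Gamma> b) - a * real_of_ereal (ereal (u z))"
      using u z J \<open>linear \<Gamma>\<close> unfolding graph_sub_def by blast
    moreover have "a * (u z - j) \<le> a * u z" using assms(3,4) by (intro mult_left_mono) auto
    ultimately show ?thesis using 2 by simp
  qed
qed

lemma fibre_sub_max:
  assumes "fibre_sub W f" "fibre_sub W (\<lambda>z. ereal (u z))"
  shows "fibre_sub W (\<lambda>z. max (f z) (ereal (u z - j)))"
  unfolding fibre_sub_def
proof (intro ballI allI impI)
  fix z \<phi> P Q and w :: 'b
  assume "z \<in> W" "touches (\<lambda>z. max (f z) (ereal (u z - j))) z \<phi>" "jet2 \<phi> z P Q"
  then show "0 \<le> Q (0, w)" using assms unfolding fibre_sub_def by (metis touches_max_cases)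
qed

text \<open>\<open>f\<close> may be \<open>-\<infinity>\<close>, and its near-minimizers may escape
  to the boundary of the fibre. Both are cured by \<open>fj j = max f (u - j)\<close>, which is
  finite and small only where \<open>u\<close> is small; \<open>loc\<close> encloses such a sublevel
  set, locally in \<open>x\<close>, in a convex \<open>Y\<close> on which \<open>f\<close> and
  \<open>u\<close> are bounded above. Infima over \<open>j\<close> and over the fibre commute, so
  the marginals of \<open>fj j\<close> decrease to that of \<open>f\<close>.\<close>

theorem lin_sub_marg:
  fixes f :: "'e::euclidean_space \<times> 'g::euclidean_space \<Rightarrow> ereal" and u :: "'e \<times> 'g \<Rightarrow> real"
  assumes W: "open W" and f: "usc_on W f" "\<And>z. z \<in> W \<Longrightarrow> f z \<noteq> \<infinity>" "graph_sub ss b a c W f" "fibre_sub W f"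
    and u: "usc_on W (\<lambda>z. ereal (u z))" "graph_sub ss b a c W (\<lambda>z. ereal (u z))" "fibre_sub W (\<lambda>z. ereal (u z))"
    and a: "a \<ge> 0"
    and bdd: "\<And>x. x \<in> fst ` W \<Longrightarrow> \<exists>m. \<forall>y. (x, y) \<in> W \<longrightarrow> m \<le> u (x, y)"
    and loc: "\<And>x0 K. x0 \<in> fst ` W \<Longrightarrow> \<exists>\<rho>>0. \<exists>Y M. open Y \<and> convex Y \<and> cball x0 \<rho> \<times> Y \<subseteq> W
       \<and> (\<forall>x\<in>cball x0 \<rho>. \<forall>y. (x, y) \<in> W \<and> u (x, y) \<le> K \<longrightarrow> y \<in> Y)
       \<and> (\<forall>x\<in>cball x0 \<rho>. \<forall>y\<in>Y. f (x, y) \<le> ereal M \<and> u (x, y) \<le> M)"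
  shows "lin_sub ss b a c (fst ` W) (marg W f)"
proof -
  define fj where "fj = (\<lambda>j z. max (f z) (ereal (u z - real j)))"
  define gs where "gs = (\<lambda>j. marg W (fj j))"
  have D: "open (fst ` W)" using W by (rule open_image_fst)
  have fin: "\<bar>fj j z\<bar> \<noteq> \<infinity>" if "z \<in> W" for j z
    using f(2)[OF that] unfolding fj_def max_def by auto
  have fj_usc: "usc_on W (fj j)" for j unfolding fj_def
    using usc_on_add_continuous[OF u(1), of "\<lambda>_. - real j"] by (intro usc_on_max f) auto
  have gfin: "\<bar>gs j x\<bar> \<noteq> \<infinity>" if x: "x \<in> fst ` W" for j x
  proof -
    obtain m where m: "\<And>y. (x, y) \<in> W \<Longrightarrow> m \<le> u (x, y)" using bdd[OF x] by blast
    have "ereal (m - real j) \<le> gs j x" unfolding gs_def marg_def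
    proof (rule INF_greatest)
      fix y assume "y \<in> {y. (x, y) \<in> W}"
      then have "ereal (m - real j) \<le> ereal (u (x, y) - real j)" using m by simp
      also have "\<dots> \<le> fj j (x, y)" by (simp add: fj_def)
      finally show "ereal (m - real j) \<le> fj j (x, y)" .
    qed
    moreover obtain y where y: "(x, y) \<in> W" using x by auto
    then have "gs j x \<le> fj j (x, y)" unfolding gs_def marg_def by (intro INF_lower) auto
    ultimately show ?thesis using fin[OF y, of j] by auto
  qed
  show ?thesis
  proof (rule lin_sub_decreasing_limit[OF D _ _ gfin _ _ a])
    fix j
    show "usc_on (fst ` W) (gs j)" unfolding gs_def by (rule usc_on_marg[OF W fj_usc])
    show "gs j x \<le> gs i x" if "i \<le> j" for i x
    proof -
      have "fj j z \<le> fj i z" for z unfolding fj_def using that by (intro max.mono) auto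
      then show ?thesis unfolding gs_def marg_def by (intro INF_mono) blast
    qed
    show "lin_sub ss b a c (fst ` W) (gs j)" unfolding lin_sub_def
    proof (intro ballI allI impI)
      fix x0 \<phi> P Q assume x0: "x0 \<in> fst ` W" and t: "touches (gs j) x0 \<phi>" and J: "jet2 \<phi> x0 P Q"
      obtain q0 where q0: "gs j x0 = ereal q0" using gfin[OF x0, of j] by auto
      have P: "linear P" and Q: "quadform Q" using J unfolding jet2_def by auto
      obtain B where B: "bilinear B" "\<And>v w. B v w = B w v" "\<And>v. Q v = B v v" using quadform_sym[OF Q] by blast
      define \<sigma> where "\<sigma> = (\<Sum>s\<leftarrow>ss. (norm s)\<^sup>2)"
      have \<sigma>: "\<sigma> \<ge> 0" unfolding \<sigma>_def by (rule sum_list_nonneg) auto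
      \<comment> \<open>\<open>\<phi>\<close> has only a Taylor expansion; adding
        \<open>\<epsilon> |x - x0|^2\<close> yields an honest quadratic \<open>q\<close> above the
        marginal on a ball, at the price \<open>2 \<epsilon> \<sigma>\<close>.\<close>
      have main: "c \<le> (\<Sum>s\<leftarrow>ss. Q s) + 2 * \<epsilon> * \<sigma> + P b - a * q0" if \<epsilon>: "\<epsilon> > 0" for \<epsilon>
      proof -
        define B' where "B' = (\<lambda>v w. B v w + 2 * \<epsilon> * (v \<bullet> w))"
        have B': "bilinear B'" "\<And>v w. B' v w = B' w v"
          unfolding B'_def using B(1) B(2)
          by (auto intro!: bilinearI simp: bilinear_ladd bilinear_radd bilinear_lmul bilinear_rmul
              inner_add_left inner_add_right algebra_simps inner_commute)
        define q where "q = (\<lambda>x. q0 + (P (x - x0) + (1/2) * B' (x - x0) (x - x0)))"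
        obtain d1 where d1: "d1 > 0"
          "\<And>x. dist x x0 < d1 \<Longrightarrow> \<phi> x - \<phi> x0 \<le> P (x - x0) + (1/2) * Q (x - x0) + \<epsilon> * (norm (x - x0))\<^sup>2"
          using jet2_upper_estimate[OF J \<epsilon>] by blast
        obtain d2 where d2: "d2 > 0" "\<And>y. dist y x0 < d2 \<Longrightarrow> gs j y \<le> gs j x0 + ereal (\<phi> y - \<phi> x0)"
          using t unfolding touches_def eventually_nhds_metric by auto
        define d where "d = min d1 d2 / 2"
        have d: "d > 0" "d < d1" "d < d2" using d1 d2 by (auto simp: d_def)
        have gq: "gs j x \<le> ereal (q x)" if x: "x \<in> cball x0 d" for x
        proof -
          have n: "norm (x - x0) \<le> d" using x by (simp add: dist_norm norm_minus_commute)
          then have 1: "gs j x \<le> ereal (q0 + (\<phi> x - \<phi> x0))" using d d2(2)[of x] by (simp add: dist_norm q0)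
          have "\<phi> x - \<phi> x0 \<le> P (x - x0) + (1/2) * Q (x - x0) + \<epsilon> * (norm (x - x0))\<^sup>2"
            using n d by (intro d1(2)) (simp add: dist_norm)
          then have "\<phi> x - \<phi> x0 \<le> P (x - x0) + (1/2) * B' (x - x0) (x - x0)"
            unfolding B'_def B(3) power2_norm_eq_inner by argo
          then have "ereal (q0 + (\<phi> x - \<phi> x0)) \<le> ereal (q x)" by (simp add: q_def)
          with 1 show ?thesis by (rule order_trans)
        qed
        have contP: "continuous_on UNIV P" using P linear_continuous_on linear_conv_bounded_linear by blast
        have bB: "bounded_bilinear B'" using B'(1) bilinear_conv_bounded_bilinear by blast
        have contq: "continuous_on (cball x0 d) q"
          unfolding q_def by (intro continuous_intros continuous_on_compose2[OF contP] bounded_bilinear.continuous_on[OF bB]) auto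
        obtain m where m: "\<forall>x\<in>cball x0 d. q x \<le> q m"
          using continuous_attains_sup[OF compact_cball _ contq] d by auto
        \<comment> \<open>The level is forced by the choice of near-minimizers:
          \<open>fj j (x, y) < q x + min \<eta> 1\<close> implies
          \<open>u (x, y) - j < q m + 1\<close>, where \<open>q m\<close> is the maximum of
          \<open>q\<close> on the ball. The cap at 1 makes the level independent of
          \<open>\<eta>\<close>.\<close>
        obtain \<rho> Y M where \<rho>: "\<rho> > 0" and Y: "open Y" "convex Y" "cball x0 \<rho> \<times> Y \<subseteq> W"
          and YK: "\<And>x y. x \<in> cball x0 \<rho> \<Longrightarrow> (x, y) \<in> W \<Longrightarrow> u (x, y) \<le> q m + 1 + real j \<Longrightarrow> y \<in> Y"
          and M: "\<And>x y. x \<in> cball x0 \<rho> \<Longrightarrow> y \<in> Y \<Longrightarrow> f (x, y) \<le> ereal M \<and> u (x, y) \<le> M"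
          using loc[OF x0, of "q m + 1 + real j"] by blast
        define r where "r = min \<rho> d"
        have r: "r > 0" "cball x0 r \<subseteq> cball x0 \<rho>" "cball x0 r \<subseteq> cball x0 d" using \<rho> d by (auto simp: r_def)
        define h where "h = (\<lambda>z. real_of_ereal (fj j z))"
        have h: "fj j z = ereal (h z)" if "z \<in> W" for z using fin[OF that] by (simp add: h_def ereal_real)
        have "c \<le> (\<Sum>s\<leftarrow>ss. B' s s) + P b - a * q0"
        proof (rule marginal_touching_inequality[OF W _ _ _ a r(1) Y(1,2) _ _ P B' fun_cong[OF q_def]])
          show "usc_on W (\<lambda>z. ereal (h z))" by (rule usc_on_cong[OF fj_usc h])
          show "graph_sub ss b a c W (\<lambda>z. ereal (h z))"
            by (rule graph_sub_cong[OF W h]) (auto simp: fj_def intro!: graph_sub_max f u a)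
          show "fibre_sub W (\<lambda>z. ereal (h z))"
            by (rule fibre_sub_cong[OF W h]) (auto simp: fj_def intro!: fibre_sub_max f u)
          show rY: "cball x0 r \<times> Y \<subseteq> W" using r Y by blast
          show "h (x, y) \<le> M" if "x \<in> cball x0 r" "y \<in> Y" for x y
          proof -
            have *: "f (x, y) \<le> ereal M" "u (x, y) \<le> M" using M that r by blast+
            then have "fj j (x, y) \<le> ereal M" by (simp add: fj_def)
            then show ?thesis using h rY that by (metis ereal_less_eq(3) mem_Sigma_iff subsetD)
          qed
          show "\<exists>y\<in>Y. h (x, y) < q x + \<eta>" if x: "x \<in> cball x0 r" and \<eta>: "\<eta> > 0" for x \<eta>
          proof -
            have "gs j x \<le> ereal (q x)" using gq x r by blast
            also have "\<dots> < ereal (q x + min \<eta> 1)" using \<eta> by simp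
            finally obtain y where y: "(x, y) \<in> W" "fj j (x, y) < ereal (q x + min \<eta> 1)"
              unfolding gs_def marg_def INF_less_iff by auto
            have "ereal (u (x, y) - real j) < ereal (q x + min \<eta> 1)"
              by (rule le_less_trans[OF _ y(2)]) (simp add: fj_def)
            moreover have "q x \<le> q m" using m x r by blast
            ultimately have "u (x, y) \<le> q m + 1 + real j" by simp
            then have "y \<in> Y" using YK y x r by blast
            moreover have "h (x, y) < q x + \<eta>" using y(2) h[OF y(1)] by simp
            ultimately show ?thesis by blast
          qed
          show "q0 \<le> h (x0, y)" if y: "y \<in> Y" for y
          proof -
            have yW: "(x0, y) \<in> W" using rY y r by auto
            then have "gs j x0 \<le> fj j (x0, y)" unfolding gs_def marg_def by (intro INF_lower) auto
            then show ?thesis using h[OF yW] q0 by simp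
          qed
        qed
        also have "(\<Sum>s\<leftarrow>ss. B' s s) = (\<Sum>s\<leftarrow>ss. Q s) + 2 * \<epsilon> * \<sigma>"
          unfolding B'_def \<sigma>_def B(3) by (simp add: sum_list_addf sum_list_const_mult power2_norm_eq_inner)
        finally show ?thesis .
      qed
      have "c \<le> ((\<Sum>s\<leftarrow>ss. Q s) + P b - a * q0) + e" if e: "e > 0" for e
      proof -
        have "2 * (e / (2 * (\<sigma> + 1))) * \<sigma> \<le> e" using \<sigma> e by (simp add: field_simps)
        moreover have "e / (2 * (\<sigma> + 1)) > 0" using e \<sigma> by simp
        ultimately show ?thesis using main[of "e / (2 * (\<sigma> + 1))"] by linarith
      qed
      then show "c \<le> (\<Sum>s\<leftarrow>ss. Q s) + P b - a * real_of_ereal (gs j x0)"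
        unfolding q0 by (simp add: field_le_epsilon)
    qed
  next
    fix x assume "x \<in> fst ` W"
    have "(INF j. fj j z) = f z" for z
    proof (rule antisym)
      show "f z \<le> (INF j. fj j z)" unfolding fj_def by (intro INF_greatest) auto
      show "(INF j. fj j z) \<le> f z"
      proof (rule ereal_le_real)
        fix r assume r: "f z \<le> ereal r"
        obtain j :: nat where "u z - r \<le> real j" using real_arch_simple by blast
        then have "fj j z \<le> ereal r" unfolding fj_def using r by simp
        then show "(INF j. fj j z) \<le> ereal r" by (rule INF_lower2[rotated]) simp
      qed
    qed
    then show "marg W f x = (INF j. gs j x)"
      unfolding gs_def marg_def by (subst INF_commute) simp
  qed auto
qed

text \<open>The set \<open>T\<close> of points visible from \<open>y0\<close> along segments is
  open, segments being compact. It is closed because along a convergent sequence of visible points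
  quasiconvexity bounds \<open>v\<close> on all the segments, and the closed sublevel set holds the
  limiting segment inside \<open>S\<close>. By connectedness \<open>T = S\<close>, so
  \<open>S\<close> itself is convex, and quasiconvexity passes this to the sublevel sets.\<close>

lemma connected_fibre_convex:
  fixes v :: "'g::euclidean_space \<Rightarrow> real"
  assumes S: "open S" "connected S" and v: "continuous_on S v"
    and cl: "\<And>K. closed {y \<in> S. v y \<le> K}"
    and qc: "\<And>y0 y1 y. closed_segment y0 y1 \<subseteq> S \<Longrightarrow> y \<in> closed_segment y0 y1 \<Longrightarrow> v y \<le> max (v y0) (v y1)"
  shows "convex {y \<in> S. v y < K}"
proof -
  have seg: "closed_segment y0 y1 \<subseteq> S" if y0: "y0 \<in> S" and y1: "y1 \<in> S" for y0 y1
  proof -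
    define T where "T = {y \<in> S. closed_segment y0 y \<subseteq> S}"
    have "openin (top_of_set S) T"
      unfolding openin_subopen[of _ T]
    proof
      fix y assume y: "y \<in> T"
      then obtain e where e: "e > 0" "(\<Union>x\<in>closed_segment y0 y. ball x e) \<subseteq> S"
        using compact_subset_open_imp_ball_epsilon_subset[OF compact_segment S(1), of y0 y] unfolding T_def by blast
      have "ball y e \<inter> S \<subseteq> T"
      proof
        fix y' assume y': "y' \<in> ball y e \<inter> S"
        have "closed_segment y0 y' \<subseteq> S"
        proof
          fix w assume "w \<in> closed_segment y0 y'"
          then obtain t where t: "0 \<le> t" "t \<le> 1" "w = (1 - t) *\<^sub>R y0 + t *\<^sub>R y'" unfolding in_segment by blast
          define w' where "w' = (1 - t) *\<^sub>R y0 + t *\<^sub>R y"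
          have "w' \<in> closed_segment y0 y" unfolding in_segment w'_def using t by blast
          moreover have "dist w' w < e"
          proof -
            have "dist w' w = t * dist y y'" using t unfolding w'_def dist_norm by (simp flip: scaleR_diff_right)
            also have "\<dots> \<le> dist y y'" using t by (simp add: mult_left_le_one_le)
            finally show ?thesis using y' by simp
          qed
          ultimately have "w \<in> (\<Union>x\<in>closed_segment y0 y. ball x e)" by auto
          then show "w \<in> S" using e(2) by blast
        qed
        then show "y' \<in> T" using y' by (simp add: T_def)
      qed
      moreover have "openin (top_of_set S) (ball y e \<inter> S)" by (metis open_ball openin_open_Int inf_commute)
      ultimately show "\<exists>U. openin (top_of_set S) U \<and> y \<in> U \<and> U \<subseteq> T" using y e by (auto simp: T_def)
    qed
    moreover have "closedin (top_of_set S) T"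
      unfolding closedin_limpt
    proof (intro conjI allI impI)
      show "T \<subseteq> S" by (auto simp: T_def)
      fix l assume l: "l islimpt T \<and> l \<in> S"
      then obtain y where yl: "(\<forall>n. y n \<in> T) \<and> l \<in> S \<and> y \<longlonglongrightarrow> l"
        unfolding islimpt_sequential by auto
      have "(\<lambda>n. v (y n)) \<longlonglongrightarrow> v l"
        using continuous_on_tendsto_compose[OF v, of y l] yl by (auto simp: T_def)
      then have "\<forall>\<^sub>F n in sequentially. v (y n) < v l + 1" by (rule order_tendstoD) simp
      then obtain N where N: "\<And>n. n \<ge> N \<Longrightarrow> v (y n) < v l + 1" unfolding eventually_sequentially by blast
      define M where "M = max (v y0) (v l + 1)"
      have "closed_segment y0 l \<subseteq> S"
      proof
        fix w assume "w \<in> closed_segment y0 l"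
        then obtain t where t: "0 \<le> t" "t \<le> 1" "w = (1 - t) *\<^sub>R y0 + t *\<^sub>R l" unfolding in_segment by blast
        have "w \<in> {y \<in> S. v y \<le> M}"
        proof (rule closed_sequentially[OF cl])
          show "(\<lambda>n. (1 - t) *\<^sub>R y0 + t *\<^sub>R y (n + N)) \<longlonglongrightarrow> w"
            unfolding t(3) using yl by (intro tendsto_intros) (auto intro: LIMSEQ_ignore_initial_segment)
          fix n
          have *: "(1 - t) *\<^sub>R y0 + t *\<^sub>R y (n + N) \<in> closed_segment y0 (y (n + N))" unfolding in_segment using t by blast
          have "closed_segment y0 (y (n + N)) \<subseteq> S" using yl by (auto simp: T_def)
          moreover from qc[OF this *] have "v ((1 - t) *\<^sub>R y0 + t *\<^sub>R y (n + N)) \<le> M"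
            using N[of "n + N"] by (auto simp: M_def)
          ultimately show "(1 - t) *\<^sub>R y0 + t *\<^sub>R y (n + N) \<in> {y \<in> S. v y \<le> M}" using * by blast
        qed
        then show "w \<in> S" by simp
      qed
      then show "l \<in> T" using yl by (simp add: T_def)
    qed
    moreover have "y0 \<in> T" using y0 by (simp add: T_def)
    ultimately have "T = S" using S(2) unfolding connected_clopen by blast
    then show ?thesis using y1 by (auto simp: T_def)
  qed
  show ?thesis unfolding convex_contains_segment
  proof (intro ballI)
    fix y0 y1 assume y: "y0 \<in> {y \<in> S. v y < K}" "y1 \<in> {y \<in> S. v y < K}"
    then have s: "closed_segment y0 y1 \<subseteq> S" using seg by blast
    show "closed_segment y0 y1 \<subseteq> {y \<in> S. v y < K}" using s y qc[OF s] by fastforce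
  qed
qed

section \<open>Tubes around fibre sublevel sets and the projected exhaustion\<close>

lemma open_sublevel:
  assumes "open S" "usc_on S f" shows "open {x \<in> S. f x < a}"
  using assms unfolding usc_on_def by (metis openin_open_trans)

text \<open>The fibre set is taken one level above \<open>K\<close> to leave room for moving
  \<open>x\<close>. It is relatively compact in \<open>W\<close>, so the bounds on \<open>f\<close>
  and \<open>u\<close> extend to a product neighbourhood. The points of level at most
  \<open>K\<close> outside \<open>V x0 K\<close> form a compact set whose projection misses
  \<open>x0\<close>, so none lies over a small ball.\<close>

lemma compact_sublevel_tube:
  fixes u :: "'e::euclidean_space \<times> 'g::euclidean_space \<Rightarrow> real"
  assumes W: "open W" and u: "continuous_on W u" and comp: "\<And>K. compact {z \<in> W. u z \<le> K}"
    and f: "usc_on W f" "\<And>z. z \<in> W \<Longrightarrow> f z \<noteq> \<infinity>"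
  defines "V \<equiv> \<lambda>x0 K. {y. (x0, y) \<in> W \<and> u (x0, y) < K + 1}"
  shows "open (V x0 K)"
    and "\<exists>\<rho>>0. \<exists>M. cball x0 \<rho> \<times> V x0 K \<subseteq> W
       \<and> (\<forall>x\<in>cball x0 \<rho>. \<forall>y. (x, y) \<in> W \<and> u (x, y) \<le> K \<longrightarrow> y \<in> V x0 K)
       \<and> (\<forall>x\<in>cball x0 \<rho>. \<forall>y\<in>V x0 K. f (x, y) \<le> ereal M \<and> u (x, y) \<le> M)"
proof -
  have oV: "open {z \<in> W. u z < K}" for K
    using open_sublevel[OF W continuous_imp_usc_on[OF u], of "ereal K"] by simp
  have "V x0 K = Pair x0 -` {z \<in> W. u z < K + 1}" by (auto simp: V_def)
  moreover have "open (Pair x0 -` {z \<in> W. u z < K + 1})"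
    by (rule open_vimage[OF oV]) (intro continuous_intros)
  ultimately show oVx: "open (V x0 K)" by simp
  define C where "C = {z \<in> W. u z \<le> K + 1} \<inter> {x0} \<times> UNIV"
  have C: "compact C" unfolding C_def by (intro compact_Int_closed comp closed_Times) auto
  have CW: "C \<subseteq> W" by (auto simp: C_def)
  have VC: "(x0, y) \<in> C" if "y \<in> V x0 K" for y using that by (auto simp: V_def C_def)
  obtain M where M: "\<And>z. z \<in> C \<Longrightarrow> f z < ereal M" "M > K + 1"
  proof (cases "C = {}")
    case True then show ?thesis using that[of "K + 2"] by simp
  next
    case False
    obtain z where z: "z \<in> C" "\<And>w. w \<in> C \<Longrightarrow> f w \<le> f z"
      using usc_attains_max[OF C False usc_on_subset[OF f(1) CW]] by blast
    then have "f z \<noteq> \<infinity>" using f(2) CW by blast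
    then obtain M where "f z < ereal M" by (metis ereal_infty_less(1) less_PInf_Ex_of_nat)
    then have "f w < ereal (max M (K + 2))" if "w \<in> C" for w
      using z(2)[OF that] by (metis ereal_less_eq(3) le_less_trans less_le_trans max.cobounded1)
    then show ?thesis using that[of "max M (K + 2)"] by simp
  qed
  define T where "T = {z \<in> W. f z < ereal M} \<inter> {z \<in> W. u z < M}"
  have "open T" unfolding T_def by (intro open_Int oV open_sublevel W f)
  moreover have "C \<subseteq> T" using M CW by (auto simp: T_def C_def)
  ultimately obtain e where e: "e > 0" "(\<Union>z\<in>C. cball z e) \<subseteq> T"
    using compact_subset_open_imp_cball_epsilon_subset[OF C] by blast
  have eT: "(x, y) \<in> T" if "x \<in> cball x0 e" "y \<in> V x0 K" for x y
  proof -
    have "(x, y) \<in> cball (x0, y) e" using that by (simp add: dist_Pair_Pair)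
    then show ?thesis using e(2) VC[OF that(2)] by blast
  qed
  define S where "S = {z \<in> W. u z \<le> K} - UNIV \<times> V x0 K"
  have "compact S" unfolding S_def by (intro compact_diff comp open_Times oVx open_UNIV)
  then have "closed (fst ` S)" by (intro compact_imp_closed compact_continuous_image continuous_intros)
  moreover have "x0 \<notin> fst ` S" by (auto simp: S_def V_def)
  ultimately obtain d where d: "d > 0" "ball x0 d \<subseteq> - fst ` S"
    by (metis ComplI open_Compl openE)
  define \<rho> where "\<rho> = min e (d/2)"
  have \<rho>: "\<rho> > 0" "\<rho> \<le> e" "\<rho> < d" using e d by (auto simp: \<rho>_def)
  have T: "(x, y) \<in> T" if "x \<in> cball x0 \<rho>" "y \<in> V x0 K" for x y
    by (rule eT[OF _ that(2)]) (use that(1) \<rho> in auto)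
  have "y \<in> V x0 K" if "x \<in> cball x0 \<rho>" "(x, y) \<in> W" "u (x, y) \<le> K" for x y
  proof (rule ccontr)
    assume "y \<notin> V x0 K"
    then have "(x, y) \<in> S" using that by (auto simp: S_def)
    then have "x \<in> fst ` S" by force
    moreover have "x \<in> ball x0 d" using that \<rho> by auto
    ultimately show False using d by blast
  qed
  moreover have "cball x0 \<rho> \<times> V x0 K \<subseteq> W" using T by (auto simp: T_def)
  moreover have "f (x, y) \<le> ereal M \<and> u (x, y) \<le> M" if "x \<in> cball x0 \<rho>" "y \<in> V x0 K" for x y
    using T[OF that] by (auto simp: T_def)
  ultimately show "\<exists>\<rho>>0. \<exists>M. cball x0 \<rho> \<times> V x0 K \<subseteq> W
       \<and> (\<forall>x\<in>cball x0 \<rho>. \<forall>y. (x, y) \<in> W \<and> u (x, y) \<le> K \<longrightarrow> y \<in> V x0 K)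
       \<and> (\<forall>x\<in>cball x0 \<rho>. \<forall>y\<in>V x0 K. f (x, y) \<le> ereal M \<and> u (x, y) \<le> M)"
    using \<rho>(1) by blast
qed

lemma marg_attained:
  fixes u :: "'e::euclidean_space \<times> 'g::euclidean_space \<Rightarrow> real"
  assumes u: "continuous_on W u" and comp: "\<And>K. compact {z \<in> W. u z \<le> K}" and x: "x \<in> fst ` W"
  obtains y where "(x, y) \<in> W" "marg W (\<lambda>z. ereal (u z)) x = ereal (u (x, y))" "\<And>y'. (x, y') \<in> W \<Longrightarrow> u (x, y) \<le> u (x, y')"
proof -
  obtain y0 where y0: "(x, y0) \<in> W" using x by auto
  define C where "C = {z \<in> W. u z \<le> u (x, y0)} \<inter> {x} \<times> UNIV"
  have C: "compact C" unfolding C_def by (intro compact_Int_closed comp closed_Times) auto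
  have "continuous_on C u" by (rule continuous_on_subset[OF u]) (auto simp: C_def)
  moreover have "(x, y0) \<in> C" using y0 by (simp add: C_def)
  ultimately obtain z where z: "z \<in> C" "\<And>w. w \<in> C \<Longrightarrow> u z \<le> u w"
    using continuous_attains_inf[OF C] by (metis empty_iff)
  obtain y where y: "z = (x, y)" "(x, y) \<in> W" "u (x, y) \<le> u (x, y0)" using z(1) by (auto simp: C_def)
  have min: "u (x, y) \<le> u (x, y')" if "(x, y') \<in> W" for y'
  proof (cases "u (x, y') \<le> u (x, y0)")
    case True then show ?thesis using z(2)[of "(x, y')"] that y by (simp add: C_def)
  qed (use y in auto)
  have "marg W (\<lambda>z. ereal (u z)) x = ereal (u (x, y))" unfolding marg_def
    by (rule antisym) (use y min in \<open>auto intro: INF_lower2 INF_greatest\<close>)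
  then show ?thesis using that y min by blast
qed

text \<open>Since minima in the fibres are attained, sublevel sets of \<open>g\<close> are
  projections of compact sets. This gives exhaustion and lower semicontinuity at once; upper
  semicontinuity is that of any marginal of an upper semicontinuous function on an open set.\<close>

lemma projected_exhaustion:
  fixes u :: "'e::euclidean_space \<times> 'g::euclidean_space \<Rightarrow> real"
  assumes W: "open W" and u: "continuous_on W u" and comp: "\<And>K. compact {z \<in> W. u z \<le> K}"
  defines "g \<equiv> \<lambda>x. real_of_ereal (marg W (\<lambda>z. ereal (u z)) x)"
  shows "continuous_on (fst ` W) g" "exhaustive (fst ` W) g" "\<And>x. x \<in> fst ` W \<Longrightarrow> marg W (\<lambda>z. ereal (u z)) x = ereal (g x)"
proof -
  show g: "marg W (\<lambda>z. ereal (u z)) x = ereal (g x)" if "x \<in> fst ` W" for x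
    using marg_attained[OF u comp that] unfolding g_def by (metis real_of_ereal.simps(1))
  have le: "{x \<in> fst ` W. g x \<le> K} = fst ` {z \<in> W. u z \<le> K}" for K
  proof (intro equalityI subsetI)
    fix x assume x: "x \<in> {x \<in> fst ` W. g x \<le> K}"
    then obtain y where "(x, y) \<in> W" "marg W (\<lambda>z. ereal (u z)) x = ereal (u (x, y))"
      using marg_attained[OF u comp, of x] by blast
    then have "(x, y) \<in> {z \<in> W. u z \<le> K}" using x by (simp add: g_def)
    then show "x \<in> fst ` {z \<in> W. u z \<le> K}" by force
  next
    fix x assume "x \<in> fst ` {z \<in> W. u z \<le> K}"
    then obtain y where y: "(x, y) \<in> W" "u (x, y) \<le> K" by auto
    then have x: "x \<in> fst ` W" by force
    have "marg W (\<lambda>z. ereal (u z)) x \<le> ereal (u (x, y))" unfolding marg_def by (rule INF_lower) (use y in simp)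
    then show "x \<in> {x \<in> fst ` W. g x \<le> K}" using x y g[OF x] by simp
  qed
  have comple: "compact {x \<in> fst ` W. g x \<le> K}" for K
    unfolding le by (intro compact_continuous_image comp continuous_intros)
  have usc: "usc_on (fst ` W) (\<lambda>x. ereal (g x))"
    by (rule usc_on_cong[OF usc_on_marg[OF W continuous_imp_usc_on[OF u]] g])
  have D: "open (fst ` W)" using W by (rule open_image_fst)
  show "continuous_on (fst ` W) g"
    unfolding continuous_on_eq_continuous_at[OF D]
  proof
    fix x assume x: "x \<in> fst ` W"
    show "isCont g x" unfolding isCont_def
    proof (rule order_tendstoI)
      fix a assume a: "a < g x"
      have "open (fst ` W - {x \<in> fst ` W. g x \<le> a})" using D comple[THEN compact_imp_closed] by (rule open_Diff)
      then have "\<forall>\<^sub>F y in nhds x. y \<in> fst ` W - {x \<in> fst ` W. g x \<le> a}"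
        by (rule eventually_nhds_in_open) (use x a in auto)
      then have "\<forall>\<^sub>F y in nhds x. a < g y" by eventually_elim auto
      then show "\<forall>\<^sub>F y in at x. a < g y" using eventually_nhds_conv_at by blast
    next
      fix a assume a: "g x < a"
      have "open {x \<in> fst ` W. ereal (g x) < ereal a}" by (rule open_sublevel[OF D usc])
      then have "\<forall>\<^sub>F y in nhds x. y \<in> {x \<in> fst ` W. ereal (g x) < ereal a}"
        by (rule eventually_nhds_in_open) (use x a in auto)
      then have "\<forall>\<^sub>F y in nhds x. g y < a" by eventually_elim auto
      then show "\<forall>\<^sub>F y in at x. g y < a" using eventually_nhds_conv_at by blast
    qed
  qed
  show "exhaustive (fst ` W) g" unfolding exhaustive_def
  proof
    fix a
    have "closure {x \<in> fst ` W. g x < a} \<subseteq> {x \<in> fst ` W. g x \<le> a}"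
      by (rule closure_minimal) (auto intro: compact_imp_closed[OF comple])
    then show "compact (closure {x \<in> fst ` W. g x < a}) \<and> closure {x \<in> fst ` W. g x < a} \<subseteq> fst ` W"
      using compact_closure bounded_subset[OF compact_imp_bounded[OF comple]] by (metis (no_types, lifting) closure_subset order_trans mem_Collect_eq subsetI subset_iff)
  qed
qed

lemma exhaustive_compact_sublevel:
  fixes u :: "'a::euclidean_space \<Rightarrow> real"
  assumes "exhaustive W u" "continuous_on W u"
  shows "compact {z \<in> W. u z \<le> K}"
proof -
  define C where "C = closure {z \<in> W. u z < K + 1}"
  have C: "compact C" "C \<subseteq> W" using assms(1) unfolding exhaustive_def C_def by auto
  have "closedin (top_of_set C) (C \<inter> u -` {..K})"
    by (intro continuous_closedin_preimage continuous_on_subset[OF assms(2) C(2)]) auto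
  then have "compact (C \<inter> u -` {..K})" using C(1) closedin_compact by blast
  moreover have "C \<inter> u -` {..K} = {z \<in> W. u z \<le> K}"
    using C(2) closure_subset[of "{z \<in> W. u z < K + 1}"] by (auto simp: C_def)
  ultimately show ?thesis by simp
qed

section \<open>Half-spaces of real jets\<close>

text \<open>Lagrange reduction: for a basis vector \<open>e\<close> with \<open>B e e > 0\<close>,
  completing the square splits off a rank-one form and leaves a semipositive form with
  \<open>e\<close> in its kernel. The set \<open>T\<close> holds the basis vectors not yet known to
  lie in the kernel.\<close>

lemma psd_sum_of_squares:
  fixes B :: "'a::euclidean_space \<Rightarrow> 'a \<Rightarrow> real"
  assumes "bilinear B" "\<And>v w. B v w = B w v" "\<And>v. 0 \<le> B v v"
  obtains ss where "\<And>v w. B v w = (\<Sum>s\<leftarrow>ss. (s \<bullet> v) * (s \<bullet> w))"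
proof -
  have "\<exists>ss. \<forall>v w. B v w = (\<Sum>s\<leftarrow>ss. (s \<bullet> v) * (s \<bullet> w))"
    if "finite T" "T \<subseteq> Basis" "bilinear B" "\<And>v w. B v w = B w v" "\<And>v. 0 \<le> B v v"
      "\<And>e w. e \<in> Basis - T \<Longrightarrow> B e w = 0" for T and B :: "'a \<Rightarrow> 'a \<Rightarrow> real"
    using that
  proof (induction T arbitrary: B rule: finite_induct)
    case empty
    have "B v w = 0" for v w
    proof -
      have "B v w = B (\<Sum>e\<in>Basis. (v \<bullet> e) *\<^sub>R e) w" by (simp add: euclidean_representation)
      also have "\<dots> = (\<Sum>e\<in>Basis. B ((v \<bullet> e) *\<^sub>R e) w)"
        using empty(2) by (intro linear_sum) (auto simp: bilinear_def)
      also have "\<dots> = 0" using empty(5) by (intro sum.neutral) (auto simp: bilinear_lmul[OF empty(2)])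
      finally show ?thesis .
    qed
    then show ?case by (intro exI[of _ "[]"]) simp
  next
    case (insert e T)
    note bil = insert.prems(2) and sym = insert.prems(3) and psd = insert.prems(4) and ker = insert.prems(5)
    have expand: "B (w + t *\<^sub>R e) (w + t *\<^sub>R e) = B w w + 2 * t * B e w + t\<^sup>2 * B e e" for w t
      by (simp add: bilinear_ladd[OF bil] bilinear_radd[OF bil] bilinear_lmul[OF bil] bilinear_rmul[OF bil]
          sym[of w e] power2_eq_square algebra_simps)
    show ?case
    proof (cases "B e e = 0")
      case True
      have "B e w = 0" for w
      proof (rule ccontr)
        assume n: "B e w \<noteq> 0"
        \<comment> \<open>With \<open>B e e = 0\<close> the form is affine in \<open>t\<close> along
          \<open>w + t e\<close>; this \<open>t\<close> gives it the value -1.\<close>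
        define t where "t = - (B w w + 1) / (2 * B e w)"
        have "B w w + 2 * t * B e w \<ge> 0" using psd[of "w + t *\<^sub>R e"] unfolding expand True by simp
        moreover have "2 * t * B e w = - (B w w + 1)" using n by (simp add: t_def)
        ultimately show False by linarith
      qed
      then show ?thesis using insert.IH[OF _ bil sym psd] insert.prems(1) ker by blast
    next
      case False
      then have \<alpha>: "B e e > 0" using psd[of e] by simp
      define l where "l = (\<Sum>b\<in>Basis. (B e b / sqrt (B e e)) *\<^sub>R b)"
      have l: "l \<bullet> w = B e w / sqrt (B e e)" for w
      proof -
        have "B e w = B e (\<Sum>b\<in>Basis. (w \<bullet> b) *\<^sub>R b)" by (simp add: euclidean_representation)
        also have "\<dots> = (\<Sum>b\<in>Basis. B e ((w \<bullet> b) *\<^sub>R b))"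
          using bil by (intro linear_sum) (auto simp: bilinear_def)
        also have "\<dots> = (\<Sum>b\<in>Basis. (w \<bullet> b) * B e b)" by (simp add: bilinear_rmul[OF bil])
        finally have "B e w / sqrt (B e e) = (\<Sum>b\<in>Basis. (w \<bullet> b) * B e b / sqrt (B e e))"
          by (simp add: sum_divide_distrib)
        then show ?thesis unfolding l_def inner_sum_left by (simp add: inner_commute mult.commute)
      qed
      define C where "C = (\<lambda>v w. B v w - B e v * B e w / B e e)"
      have "\<exists>ss. \<forall>v w. C v w = (\<Sum>s\<leftarrow>ss. (s \<bullet> v) * (s \<bullet> w))"
      proof (rule insert.IH)
        show "T \<subseteq> Basis" using insert.prems by simp
        show "bilinear C" unfolding C_def
          by (rule bilinearI) (simp_all add: bilinear_ladd[OF bil] bilinear_radd[OF bil] bilinear_lmul[OF bil]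
              bilinear_rmul[OF bil] add_divide_distrib algebra_simps)
        show "C v w = C w v" for v w unfolding C_def by (simp add: sym[of v w] mult.commute)
        show "0 \<le> C v v" for v
        proof -
          have "0 \<le> B v v + 2 * (- B e v / B e e) * B e v + (- B e v / B e e)\<^sup>2 * B e e"
            using psd[of "v + (- B e v / B e e) *\<^sub>R e"] unfolding expand .
          also have "\<dots> = C v v" using \<alpha> by (simp add: C_def field_simps power2_eq_square)
          finally show ?thesis .
        qed
        show "C f w = 0" if f: "f \<in> Basis - T" for f w
        proof (cases "f = e")
          case True then show ?thesis using \<alpha> by (simp add: C_def)
        next
          case False
          then show ?thesis using ker[of f] f by (simp add: C_def sym[of e f])
        qed
      qed
      then obtain ss where ss: "\<And>v w. C v w = (\<Sum>s\<leftarrow>ss. (s \<bullet> v) * (s \<bullet> w))" by blast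
      have "B v w = (\<Sum>s\<leftarrow>l # ss. (s \<bullet> v) * (s \<bullet> w))" for v w
      proof -
        have "B v w = C v w + B e v * B e w / B e e" by (simp add: C_def)
        also have "B e v * B e w / B e e = (l \<bullet> v) * (l \<bullet> w)" using \<alpha> by (simp add: l)
        finally show ?thesis by (simp add: ss)
      qed
      then show ?thesis by blast
    qed
  qed
  from this[of Basis B] show ?thesis using assms that by auto
qed

section \<open>Positive functionals on symmetric matrices and separation of jets\<close>

lemma inner_matrix_sum: "(S :: real^'n^'m) \<bullet> A = (\<Sum>i\<in>UNIV. \<Sum>j\<in>UNIV. S $ i $ j * A $ i $ j)"
  by (simp add: inner_vec_def)

lemma inner_matrix_vector: "v \<bullet> ((A :: real^'n^'m) *v w) = (\<Sum>i\<in>UNIV. \<Sum>j\<in>UNIV. v $ i * A $ i $ j * w $ j)"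
  by (simp add: inner_vec_def matrix_vector_mult_def sum_distrib_left mult.assoc)

text \<open>Turns the linear functional found by separation into second derivatives along finitely
  many directions. \<open>S\<close> may be nonsymmetric, but only its symmetric part acts on
  \<open>Sym\<close>, and that is the form decomposed here.\<close>

lemma psd_functional_sum_of_squares:
  fixes S :: "real^'n^'n"
  assumes "\<And>v. 0 \<le> v \<bullet> (S *v v)"
  obtains ss where "\<And>A. A \<in> Sym \<Longrightarrow> S \<bullet> A = (\<Sum>s\<leftarrow>ss. s \<bullet> (A *v s))"
proof -
  define B where "B = (\<lambda>v w. (v \<bullet> (S *v w) + w \<bullet> (S *v v)) / 2)"
  have B: "bilinear B" unfolding B_def
    by (rule bilinearI)
       (auto simp: matrix_vector_right_distrib inner_add_left inner_add_right algebra_simps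
         matrix_vector_mult_scaleR add_divide_distrib)
  obtain ss where ss: "\<And>v w. B v w = (\<Sum>s\<leftarrow>ss. (s \<bullet> v) * (s \<bullet> w))"
    by (rule psd_sum_of_squares[OF B]) (auto simp: B_def assms)
  have Sij: "(S $ i $ j + S $ j $ i) / 2 = (\<Sum>s\<leftarrow>ss. s $ i * s $ j)" for i j
  proof -
    have "axis i 1 \<bullet> (S *v axis j 1) = S $ i $ j" for i j
      by (simp add: inner_axis' matrix_vector_mul_component inner_axis)
    then have "B (axis i 1) (axis j 1) = (S $ i $ j + S $ j $ i) / 2" unfolding B_def by simp
    moreover have "B (axis i 1) (axis j 1) = (\<Sum>s\<leftarrow>ss. s $ i * s $ j)" unfolding ss by (simp add: inner_axis)
    ultimately show ?thesis by simp
  qed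
  have "S \<bullet> A = (\<Sum>s\<leftarrow>ss. s \<bullet> (A *v s))" if "A \<in> Sym" for A
  proof -
    have Aij: "A $ i $ j = A $ j $ i" for i j
      using that unfolding Sym_def transpose_def by (metis (mono_tags, lifting) mem_Collect_eq vec_lambda_beta)
    have "S \<bullet> A = (\<Sum>i\<in>UNIV. \<Sum>j\<in>UNIV. S $ j $ i * A $ i $ j)"
      unfolding inner_matrix_sum by (subst sum.swap) (simp add: Aij)
    then have "2 * (S \<bullet> A) = (\<Sum>i\<in>UNIV. \<Sum>j\<in>UNIV. S $ i $ j * A $ i $ j) + (\<Sum>i\<in>UNIV. \<Sum>j\<in>UNIV. S $ j $ i * A $ i $ j)"
      unfolding inner_matrix_sum by simp
    also have "\<dots> = 2 * (\<Sum>i\<in>UNIV. \<Sum>j\<in>UNIV. (S $ i $ j + S $ j $ i) / 2 * A $ i $ j)"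
      unfolding sum.distrib[symmetric] sum_distrib_left by (intro sum.cong refl) (simp add: algebra_simps)
    also have "(\<Sum>i\<in>UNIV. \<Sum>j\<in>UNIV. (S $ i $ j + S $ j $ i) / 2 * A $ i $ j)
      = (\<Sum>i\<in>UNIV. \<Sum>j\<in>UNIV. (\<Sum>s\<leftarrow>ss. s $ i * A $ i $ j * s $ j))"
      unfolding Sij sum_list_mult_const[symmetric] by (simp add: mult_ac)
    also have "\<dots> = (\<Sum>s\<leftarrow>ss. s \<bullet> (A *v s))"
      unfolding inner_matrix_vector by (induction ss) (auto simp: sum.distrib)
    finally show ?thesis by simp
  qed
  then show ?thesis using that by blast
qed

definition outer :: "real^'n \<Rightarrow> real^'n^'n" where
  "outer v = (\<chi> i j. v $ i * v $ j)"

lemma inner_outer: "S \<bullet> outer v = v \<bullet> (S *v v)"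
  unfolding inner_matrix_sum inner_matrix_vector outer_def by (simp add: mult_ac)

lemma outer_mult: "w \<bullet> (outer v *v w) = (v \<bullet> w)\<^sup>2"
  unfolding inner_matrix_vector outer_def
  by (simp add: inner_vec_def power2_eq_square sum_product mult_ac)

lemma outer_Pos: "outer v \<in> Pos"
proof -
  have "transpose (outer v) = outer v" by (simp add: outer_def transpose_def vec_eq_iff mult.commute)
  then show ?thesis by (simp add: Pos_def Sym_def outer_mult)
qed

lemma affine_nonneg_slope:
  fixes c m k :: real assumes "\<And>t. t \<ge> 0 \<Longrightarrow> c < m + t * k" shows "k \<ge> 0"
proof (rule ccontr)
  assume k: "\<not> ?thesis"
  have "c < m + ((\<bar>m - c\<bar>) / (- k)) * k" using k by (intro assms divide_nonneg_pos) auto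
  also have "\<dots> = m - \<bar>m - c\<bar>" using k by (simp add: field_simps)
  finally show False by linarith
qed

text \<open>Take a separating hyperplane with normal \<open>(\<alpha>, b, S)\<close>. As the set
  contains the rays \<open>r - t\<close> and \<open>A + t R\<close>, boundedness below of the
  functional forces \<open>\<alpha> <= 0\<close>, whence \<open>a = - \<alpha>\<close>, and
  \<open>S \<bullet> R >= 0\<close> on the cone. The abstract cone \<open>C\<close> serves the
  symmetric and the hermitian case.\<close>

lemma jet_separation:
  fixes F0 :: "(real \<times> 'p::euclidean_space \<times> 'm::euclidean_space) set"
  assumes F: "closed F0" "convex F0" "F0 \<noteq> {}"
    and neg: "\<And>r r' p A. (r, p, A) \<in> F0 \<Longrightarrow> r' \<le> r \<Longrightarrow> (r', p, A) \<in> F0"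
    and pos: "\<And>r p A R. (r, p, A) \<in> F0 \<Longrightarrow> R \<in> C \<Longrightarrow> (r, p, A + R) \<in> F0"
    and cone: "\<And>R t. R \<in> C \<Longrightarrow> t \<ge> 0 \<Longrightarrow> t *\<^sub>R R \<in> C"
    and out: "(r0, p0, A0) \<notin> F0"
  obtains a b S c where "a \<ge> 0" "\<forall>R\<in>C. S \<bullet> R \<ge> 0"
    "\<forall>r p A. (r, p, A) \<in> F0 \<longrightarrow> c \<le> S \<bullet> A + p \<bullet> b - a * r"
    "S \<bullet> A0 + p0 \<bullet> b - a * r0 < c"
proof -
  obtain w c where w: "w \<bullet> (r0, p0, A0) < c" "\<And>x. x \<in> F0 \<Longrightarrow> c < w \<bullet> x"
    using separating_hyperplane_closed_point[OF F(2,1) out] by blast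
  obtain \<alpha> b S where wabs: "w = (\<alpha>, b, S)" by (cases w) auto
  have w': "c < \<alpha> * r + b \<bullet> p + S \<bullet> A" if "(r, p, A) \<in> F0" for r p A
    using w(2)[OF that] by (simp add: wabs)
  obtain r1 p1 A1 where e: "(r1, p1, A1) \<in> F0" using F(3) by auto
  have "- \<alpha> \<ge> 0"
  proof (rule affine_nonneg_slope)
    fix t :: real assume "t \<ge> 0"
    then have "(r1 - t, p1, A1) \<in> F0" using neg[OF e] by simp
    from w'[OF this] show "c < (\<alpha> * r1 + b \<bullet> p1 + S \<bullet> A1) + t * (- \<alpha>)" by (simp add: algebra_simps)
  qed
  moreover have "S \<bullet> R \<ge> 0" if R: "R \<in> C" for R
  proof (rule affine_nonneg_slope)
    fix t :: real assume "t \<ge> 0"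
    then have "(r1, p1, A1 + t *\<^sub>R R) \<in> F0" using pos[OF e cone[OF R]] by simp
    from w'[OF this] show "c < (\<alpha> * r1 + b \<bullet> p1 + S \<bullet> A1) + t * (S \<bullet> R)" by (simp add: inner_add_right)
  qed
  moreover have "c \<le> S \<bullet> A + p \<bullet> b - (- \<alpha>) * r" if "(r, p, A) \<in> F0" for r p A
    using w'[OF that] by (simp add: inner_commute)
  moreover have "S \<bullet> A0 + p0 \<bullet> b - (- \<alpha>) * r0 < c" using w(1) by (simp add: wabs inner_commute)
  ultimately show ?thesis using that[of "- \<alpha>" S c b] by blast
qed

text \<open>Written for both scalar fields: over the complex numbers \<open>\<bullet>\<close> is the
  real part of the hermitian pairing.\<close>

definition half_space ::
  "('a::{euclidean_space,semiring_1}^'n) list \<Rightarrow> 'a^'n \<Rightarrow> real \<Rightarrow> real \<Rightarrow> (real \<times> ('a^'n) \<times> ('a^'n^'n)) set \<Rightarrow> bool" where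
  "half_space ss b a c F0 \<longleftrightarrow> (\<forall>r p A. (r, p, A) \<in> F0 \<longrightarrow> c \<le> (\<Sum>s\<leftarrow>ss. s \<bullet> (A *v s)) + p \<bullet> b - a * r)"

lemma real_jet_separation:
  fixes F0 :: "'n::finite real_jet set"
  assumes F: "closed F0" "convex F0" "\<And>r p A. (r, p, A) \<in> F0 \<Longrightarrow> A \<in> Sym"
    and neg: "\<And>r r' p A. (r, p, A) \<in> F0 \<Longrightarrow> r' \<le> r \<Longrightarrow> (r', p, A) \<in> F0"
    and pos: "\<And>r p A R. (r, p, A) \<in> F0 \<Longrightarrow> R \<in> Pos \<Longrightarrow> (r, p, A + R) \<in> F0"
    and out: "(r0, p0, A0) \<notin> F0" "A0 \<in> Sym"
  obtains ss b a c where "a \<ge> 0" "half_space ss b a c F0"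
    "(\<Sum>s\<leftarrow>ss. s \<bullet> (A0 *v s)) + p0 \<bullet> b - a * r0 < c"
proof (cases "F0 = {}")
  case True
  \<comment> \<open>Empty fibre: the unsatisfiable constraint \<open>1 <= 0\<close> holds vacuously
    on it and excludes the point.\<close>
  then show ?thesis using that[of 0 "[]" 0 1] by (simp add: half_space_def)
next
  case False
  have cone: "t *\<^sub>R R \<in> Pos" if "R \<in> Pos" "t \<ge> 0" for t and R :: "real^'n^'n"
    using that by (auto simp: Pos_def Sym_def transpose_def vec_eq_iff scaleR_matrix_vector_assoc[symmetric])
  obtain a b S c where *: "a \<ge> 0" "\<forall>R\<in>Pos. S \<bullet> R \<ge> 0"
    "\<forall>r p A. (r, p, A) \<in> F0 \<longrightarrow> c \<le> S \<bullet> A + p \<bullet> b - a * r" "S \<bullet> A0 + p0 \<bullet> b - a * r0 < c"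
    by (rule jet_separation[OF F(1,2) False neg pos cone out(1)])
  obtain ss where ss: "\<And>A. A \<in> Sym \<Longrightarrow> S \<bullet> A = (\<Sum>s\<leftarrow>ss. s \<bullet> (A *v s))"
    using psd_functional_sum_of_squares[of S] *(2) outer_Pos inner_outer by metis
  have "half_space ss b a c F0"
    unfolding half_space_def using *(3) ss[OF F(3)] by fastforce
  then show ?thesis using that *(1,4) ss[OF out(2)] by auto
qed

text \<open>A contact jet requires the exact quadratic polynomial to dominate, whereas
  \<open>\<phi>\<close> is only asymptotic to it. The \<open>\<epsilon>\<close> added to the Hessian
  absorbs the remainder, which is below \<open>(\<epsilon>/2) |v|^2\<close> nearby; callers let
  \<open>\<epsilon>\<close> tend to 0.\<close>

lemma touches_upper_contact_jet:
  fixes f :: "real^'n \<Rightarrow> ereal"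
  assumes t: "touches f x \<phi>" and j: "jet2 \<phi> x P Q" and \<epsilon>: "\<epsilon> > 0"
  obtains p A where "upper_contact_jet f x p A" "\<And>v. p \<bullet> v = P v" "\<And>v. v \<bullet> (A *v v) = Q v + \<epsilon> * (v \<bullet> v)"
proof -
  have P: "linear P" and Q: "quadform Q" using j unfolding jet2_def by auto
  obtain B where B: "bilinear B" "\<And>v w. B v w = B w v" "\<And>v. Q v = B v v" using quadform_sym[OF Q] by blast
  define p where "p = (\<chi> i. P (axis i 1))"
  define A where "A = (\<chi> i j. B (axis i 1) (axis j 1)) + \<epsilon> *\<^sub>R mat 1"
  have exp: "v = (\<Sum>i\<in>UNIV. (v $ i) *\<^sub>R axis i 1)" for v :: "real^'n"
    using basis_expansion[of v] by (simp add: scalar_mult_eq_scaleR)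
  have p: "p \<bullet> v = P v" for v
  proof -
    have "P v = P (\<Sum>i\<in>UNIV. (v $ i) *\<^sub>R axis i 1)" using exp by simp
    also have "\<dots> = (\<Sum>i\<in>UNIV. v $ i * P (axis i 1))" by (simp add: linear_sum[OF P] linear_cmul[OF P])
    finally show ?thesis by (simp add: p_def inner_vec_def mult.commute)
  qed
  have A: "v \<bullet> (A *v v) = Q v + \<epsilon> * (v \<bullet> v)" for v
  proof -
    have "B v v = B (\<Sum>i\<in>UNIV. (v $ i) *\<^sub>R axis i 1) (\<Sum>i\<in>UNIV. (v $ i) *\<^sub>R axis i 1)" using exp by simp
    also have "\<dots> = (\<Sum>(i,j)\<in>UNIV \<times> UNIV. B ((v $ i) *\<^sub>R axis i 1) ((v $ j) *\<^sub>R axis j 1))"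
      by (rule bilinear_sum[OF B(1)])
    also have "\<dots> = (\<Sum>i\<in>UNIV. \<Sum>j\<in>UNIV. v $ i * B (axis i 1) (axis j 1) * v $ j)"
      by (simp add: sum.cartesian_product bilinear_lmul[OF B(1)] bilinear_rmul[OF B(1)] mult_ac split_def)
    also have "\<dots> = v \<bullet> ((\<chi> i j. B (axis i 1) (axis j 1)) *v v)" unfolding inner_matrix_vector by simp
    finally show ?thesis unfolding A_def B(3)
      by (simp add: matrix_vector_mult_add_rdistrib inner_add_right scaleR_matrix_vector_assoc[symmetric])
  qed
  have "A $ j $ i = A $ i $ j" for i j
    unfolding A_def using B(2)[of "axis i 1" "axis j 1"] by (simp add: mat_def)
  then have "A \<in> Sym" by (simp add: Sym_def transpose_def vec_eq_iff)
  moreover have "\<forall>\<^sub>F y in nhds x. f y \<le> f x + ereal (p \<bullet> (y - x) + 1/2 * ((y - x) \<bullet> (A *v (y - x))))"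
  proof -
    obtain d1 where d1: "d1 > 0"
      "\<And>y. dist y x < d1 \<Longrightarrow> \<phi> y - \<phi> x \<le> P (y - x) + (1/2) * Q (y - x) + (\<epsilon>/2) * (norm (y - x))\<^sup>2"
      using jet2_upper_estimate[OF j half_gt_zero[OF \<epsilon>]] by blast
    have "\<forall>\<^sub>F y in nhds x. dist y x < d1" using d1(1) unfolding eventually_nhds_metric by auto
    moreover have "\<forall>\<^sub>F y in nhds x. f y \<le> f x + ereal (\<phi> y - \<phi> x)" using t unfolding touches_def by blast
    ultimately show ?thesis
    proof eventually_elim
      case (elim y)
      have "\<phi> y - \<phi> x \<le> P (y - x) + (1/2) * Q (y - x) + (\<epsilon>/2) * (norm (y - x))\<^sup>2"
        by (rule d1(2)[OF elim(1)])
      then have "\<phi> y - \<phi> x \<le> p \<bullet> (y - x) + 1/2 * ((y - x) \<bullet> (A *v (y - x)))"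
        unfolding p A power2_norm_eq_inner by argo
      then show ?case using elim(2) by (meson add_left_mono ereal_less_eq(3) order_trans)
    qed
  qed
  moreover have "f x \<noteq> -\<infinity>" using t unfolding touches_def by auto
  ultimately have "upper_contact_jet f x p A" unfolding upper_contact_jet_def by blast
  then show ?thesis using that p A by blast
qed

lemma upper_contact_jet_touches:
  fixes f :: "real^'n \<Rightarrow> ereal"
  assumes "upper_contact_jet f x p A" "f x \<noteq> \<infinity>"
  defines "\<phi> \<equiv> \<lambda>y. p \<bullet> (y - x) + (1/2) * ((y - x) \<bullet> (A *v (y - x)))"
  shows "touches f x \<phi>" "jet2 \<phi> x (\<lambda>v. p \<bullet> v) (\<lambda>v. v \<bullet> (A *v v))"
proof -
  show "touches f x \<phi>" using assms unfolding upper_contact_jet_def touches_def by auto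
  have A: "transpose A = A" using assms(1) by (simp add: upper_contact_jet_def Sym_def)
  have "bilinear (\<lambda>v w. v \<bullet> (A *v w))"
    by (rule bilinearI) (auto simp: inner_add_left inner_add_right matrix_vector_right_distrib matrix_vector_mult_scaleR)
  moreover have "v \<bullet> (A *v w) = w \<bullet> (A *v v)" for v w
    by (metis A dot_lmul_matrix inner_commute transpose_matrix_vector)
  moreover have "linear (\<lambda>v. p \<bullet> v)" by (auto simp: linear_iff inner_add_right)
  ultimately have "jet2 \<phi> x (\<lambda>v. p \<bullet> v + (x - x) \<bullet> (A *v v)) (\<lambda>v. v \<bullet> (A *v v))"
    unfolding \<phi>_def by (intro jet2_quadratic)
  then show "jet2 \<phi> x (\<lambda>v. p \<bullet> v) (\<lambda>v. v \<bullet> (A *v v))" by simp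
qed

section \<open>Block structure\<close>

lemma sum_UNIV_Plus: "(\<Sum>k\<in>UNIV. g k) = (\<Sum>i\<in>(UNIV::'n::finite set). g (Inl i)) + (\<Sum>j\<in>(UNIV::'m::finite set). g (Inr j))"
  unfolding UNIV_Plus_UNIV[symmetric] by (subst sum.Plus) auto

lemma vec_fst_pair [simp]: "vec_fst (vec_pair x y) = x"
  by (simp add: vec_fst_def vec_pair_def vec_eq_iff)

lemma vec_snd_pair [simp]: "vec_snd (vec_pair x y) = y"
  by (simp add: vec_snd_def vec_pair_def vec_eq_iff)

lemma vec_pair_fst_snd [simp]: "vec_pair (vec_fst z) (vec_snd z) = z"
  by (auto simp: vec_snd_def vec_fst_def vec_pair_def vec_eq_iff split: sum.split)

lemma inner_vec_pair: "p \<bullet> vec_pair v w = vec_fst p \<bullet> v + vec_snd p \<bullet> w" for p :: "'a::real_inner^('n::finite + 'm::finite)"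
  by (simp add: inner_vec_def sum_UNIV_Plus vec_pair_def vec_fst_def vec_snd_def)

lemma linear_vec_pair: "linear (\<lambda>z::('a::real_vector^'n) \<times> ('a^'m). vec_pair (fst z) (snd z))"
  by (auto simp: linear_iff vec_pair_def vec_eq_iff split: sum.split)

lemma linear_vec_split: "linear (\<lambda>z::'a::real_vector^('n::finite + 'm::finite). (vec_fst z, vec_snd z))"
  by (auto simp: linear_iff vec_fst_def vec_snd_def vec_eq_iff)

lemma continuous_on_vec_pair: "continuous_on S (\<lambda>z::('a::euclidean_space^'n) \<times> ('a^'m). vec_pair (fst z) (snd z))"
  by (rule linear_continuous_on) (simp add: linear_vec_pair linear_conv_bounded_linear[symmetric])

lemma continuous_on_vec_split: "continuous_on S (\<lambda>z::'a::euclidean_space^('n::finite + 'm::finite). (vec_fst z, vec_snd z))"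
  by (rule linear_continuous_on) (simp add: linear_vec_split linear_conv_bounded_linear[symmetric])

lemma mult_vec_pair:
  "(A :: 'a::semiring_1^('n::finite + 'm::finite)^('n + 'm)) *v vec_pair v w =
    vec_pair (block_11 A *v v + block_12 A *v w) (block_21 A *v v + block_22 A *v w)"
  by (auto simp: vec_eq_iff matrix_vector_mult_def sum_UNIV_Plus vec_pair_def
      block_11_def block_12_def block_21_def block_22_def split: sum.split)

text \<open>The pulled-back matrix is \<open>A\<close> restricted to the graph of
  \<open>\<Gamma>\<close>, seen through the injection \<open>s \<mapsto> (s, \<Gamma> s)\<close>;
  symmetry of \<open>A\<close> identifies the lower left block.\<close>

lemma real_graph_pullback_quadratic:
  fixes A :: "real^('n::finite + 'm::finite)^('n + 'm)" and \<Gamma> :: "real^'n^'m"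
  assumes "A \<in> Sym"
  shows "s \<bullet> ((block_11 A + block_12 A ** \<Gamma> + transpose \<Gamma> ** transpose (block_12 A)
        + transpose \<Gamma> ** block_22 A ** \<Gamma>) *v s) = vec_pair s (\<Gamma> *v s) \<bullet> (A *v vec_pair s (\<Gamma> *v s))"
proof -
  have 21: "block_21 A = transpose (block_12 A)"
    using assms unfolding Sym_def block_21_def block_12_def transpose_def
    by (auto simp: vec_eq_iff) 
  have T: "s \<bullet> (w v* \<Gamma>) = (\<Gamma> *v s) \<bullet> w" for w
    by (metis dot_lmul_matrix inner_commute)
  show ?thesis unfolding mult_vec_pair inner_vec_pair 21
    by (simp add: matrix_vector_mult_add_rdistrib inner_add_right inner_add_left matrix_vector_mul_assoc[symmetric] T
       inner_commute)
qed

text \<open>The jets live on vectors indexed by a sum type, the analysis above on product types;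
  \<open>split_set\<close> and \<open>split_fun\<close> transport one to the other.\<close>

definition split_set :: "('a^('n::finite + 'm::finite)) set \<Rightarrow> (('a^'n) \<times> ('a^'m)) set" where
  "split_set \<Omega> = {z. vec_pair (fst z) (snd z) \<in> \<Omega>}"

definition split_fun :: "('a^('n::finite + 'm::finite) \<Rightarrow> 'b) \<Rightarrow> ('a^'n) \<times> ('a^'m) \<Rightarrow> 'b" where
  "split_fun f z = f (vec_pair (fst z) (snd z))"

lemma fst_split_set: "fst ` split_set \<Omega> = vec_fst ` \<Omega>"
proof (intro equalityI subsetI)
  fix x assume "x \<in> fst ` split_set \<Omega>"
  then obtain y where "vec_pair x y \<in> \<Omega>" by (auto simp: split_set_def)
  then show "x \<in> vec_fst ` \<Omega>" by (metis image_eqI vec_fst_pair)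
next
  fix x assume "x \<in> vec_fst ` \<Omega>"
  then obtain z where z: "z \<in> \<Omega>" "x = vec_fst z" by auto
  then have "(x, vec_snd z) \<in> split_set \<Omega>" by (simp add: split_set_def)
  then show "x \<in> fst ` split_set \<Omega>" by force
qed

lemma open_split_set:
  assumes "open (\<Omega> :: ('a::euclidean_space^('n::finite + 'm::finite)) set)" shows "open (split_set \<Omega>)"
  using open_vimage[OF assms continuous_on_vec_pair] by (simp add: split_set_def vimage_def)

lemma marginal_split: "marginal \<Omega> f = marg (split_set \<Omega>) (split_fun f)"
  by (auto simp: marginal_def marg_def slice_def split_set_def split_fun_def)

lemma usc_on_split:
  fixes \<Omega> :: "('a::euclidean_space^('n::finite + 'm::finite)) set"
  shows "usc_on \<Omega> f \<Longrightarrow> usc_on (split_set \<Omega>) (split_fun f)"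
  unfolding split_fun_def by (rule usc_on_compose[OF _ continuous_on_vec_pair]) (auto simp: split_set_def)

lemma continuous_on_split:
  fixes \<Omega> :: "('a::euclidean_space^('n::finite + 'm::finite)) set" and u :: "_ \<Rightarrow> real"
  shows "continuous_on \<Omega> u \<Longrightarrow> continuous_on (split_set \<Omega>) (split_fun u)"
  unfolding split_fun_def by (rule continuous_on_compose2[OF _ continuous_on_vec_pair]) (auto simp: split_set_def)

lemma compact_sublevel_split:
  fixes \<Omega> :: "('a::euclidean_space^('n::finite + 'm::finite)) set" and u :: "_ \<Rightarrow> real"
  assumes "compact {z \<in> \<Omega>. u z \<le> K}" shows "compact {z \<in> split_set \<Omega>. split_fun u z \<le> K}"
proof -
  have "{z \<in> split_set \<Omega>. split_fun u z \<le> K} = (\<lambda>z. (vec_fst z, vec_snd z)) ` {z \<in> \<Omega>. u z \<le> K}"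
    (is "?L = ?R")
  proof (intro equalityI subsetI)
    fix z assume z: "z \<in> ?L"
    show "z \<in> ?R" by (rule image_eqI[of _ _ "vec_pair (fst z) (snd z)"]) (use z in \<open>auto simp: split_set_def split_fun_def\<close>)
  qed (auto simp: split_set_def split_fun_def)
  then show ?thesis using compact_continuous_image[OF continuous_on_vec_split assms] by simp
qed

lemma touches_split:
  fixes f :: "'a::euclidean_space^('n::finite + 'm::finite) \<Rightarrow> ereal"
  assumes "touches (split_fun f) z \<phi>" "jet2 \<phi> z P Q"
  shows "touches f (vec_pair (fst z) (snd z)) (\<lambda>w. \<phi> (vec_fst w, vec_snd w))"
    and "jet2 (\<lambda>w. \<phi> (vec_fst w, vec_snd w)) (vec_pair (fst z) (snd z))
      (\<lambda>w. P (vec_fst w, vec_snd w)) (\<lambda>w. Q (vec_fst w, vec_snd w))"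
proof -
  let ?\<sigma> = "\<lambda>w::'a^('n + 'm). (vec_fst w, vec_snd w)" and ?Z = "vec_pair (fst z) (snd z)"
  have "touches (\<lambda>w. split_fun f (?\<sigma> w)) ?Z (\<lambda>w. \<phi> (?\<sigma> w))"
    by (rule touches_comp_linear[OF _ linear_vec_split]) (simp add: assms(1))
  then show "touches f ?Z (\<lambda>w. \<phi> (?\<sigma> w))" by (simp add: split_fun_def)
  show "jet2 (\<lambda>w. \<phi> (?\<sigma> w)) ?Z (\<lambda>w. P (?\<sigma> w)) (\<lambda>w. Q (?\<sigma> w))"
    by (rule jet2_comp_linear[OF _ linear_vec_split]) (use assms(2) in simp)
qed

section \<open>The real minimum principle\<close>

lemma le_limit_eps:
  fixes x k :: real assumes "\<And>\<epsilon>. \<epsilon> > 0 \<Longrightarrow> c \<le> x + \<epsilon> * k" "k \<ge> 0" shows "c \<le> x"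
proof (rule field_le_epsilon)
  fix e :: real assume e: "e > 0"
  have "c \<le> x + (e / (k + 1)) * k" using e assms by (intro assms(1)) auto
  also have "(e / (k + 1)) * k \<le> e" using e assms(2) by (simp add: field_simps)
  finally show "c \<le> x + e" by simp
qed

lemma matrix_real_works:
  assumes "linear (\<Gamma> :: real^'n \<Rightarrow> real^'m)" shows "matrix \<Gamma> *v x = \<Gamma> x"
  using assms by (simp add: matrix_works scalar_mult_eq_scaleR[abs_def] linear_def)

text \<open>The \<open>\<epsilon>\<close>-perturbed contact jet pulled back by
  \<open>\<Gamma>\<close> lies in the fibre of \<open>F\<close>, hence in the half-space. Its form
  at \<open>s\<close> is that of \<open>A\<close> at \<open>(s, \<Gamma> s)\<close>, so the error is
  linear in \<open>\<epsilon>\<close>.\<close>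

lemma real_product_graph_sub:
  fixes F :: "((real^'n) \<times> 'n real_jet) set" and \<Omega> :: "(real^('n::finite + 'm::finite)) set"
  assumes f: "real_subharmonic (real_product F real_convexity_subequation) \<Omega> f"
    and H: "\<And>x. x \<in> vec_fst ` \<Omega> \<Longrightarrow> half_space ss b a c (jet_fibre F x)"
  shows "graph_sub ss b a c (split_set \<Omega>) (split_fun f)"
  unfolding graph_sub_def
proof (intro ballI allI impI)
  fix z \<phi> P Q and \<Gamma> :: "real^'n \<Rightarrow> real^'m"
  assume z: "z \<in> split_set \<Omega>" and t: "touches (split_fun f) z \<phi>" and J: "jet2 \<phi> z P Q" and \<Gamma>: "linear \<Gamma>"
  let ?Z = "vec_pair (fst z) (snd z)"
  have Z: "?Z \<in> \<Omega>" using z by (simp add: split_set_def)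
  then have x: "fst z \<in> vec_fst ` \<Omega>" by (metis image_eqI vec_fst_pair)
  show "c \<le> (\<Sum>s\<leftarrow>ss. Q (s, \<Gamma> s)) + P (b, \<Gamma> b) - a * real_of_ereal (split_fun f z)"
  proof (rule le_limit_eps)
    fix \<epsilon> :: real assume \<epsilon>: "\<epsilon> > 0"
    obtain p A where pA: "upper_contact_jet f ?Z p A" "\<And>v. p \<bullet> v = P (vec_fst v, vec_snd v)"
      "\<And>v. v \<bullet> (A *v v) = Q (vec_fst v, vec_snd v) + \<epsilon> * (v \<bullet> v)"
      using touches_upper_contact_jet[OF touches_split[OF t J] \<epsilon>] by blast
    have A: "A \<in> Sym" using pA(1) by (simp add: upper_contact_jet_def)
    have "(?Z, real_of_ereal (f ?Z), p, A) \<in> real_product F real_convexity_subequation"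
      using f pA(1) Z unfolding real_subharmonic_def jet_fibre_def by blast
    then have "real_graph_pullback (matrix \<Gamma>) (real_of_ereal (f ?Z), p, A) \<in> jet_fibre F (fst z)"
      unfolding real_product_def by auto
    then have "c \<le> (\<Sum>s\<leftarrow>ss. s \<bullet> ((block_11 A + block_12 A ** matrix \<Gamma> + transpose (matrix \<Gamma>) ** transpose (block_12 A)
        + transpose (matrix \<Gamma>) ** block_22 A ** matrix \<Gamma>) *v s)) + (vec_fst p + transpose (matrix \<Gamma>) *v vec_snd p) \<bullet> b
        - a * real_of_ereal (f ?Z)"
      using H[OF x] unfolding half_space_def real_graph_pullback_def by auto
    also have "(\<Sum>s\<leftarrow>ss. s \<bullet> ((block_11 A + block_12 A ** matrix \<Gamma> + transpose (matrix \<Gamma>) ** transpose (block_12 A)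
        + transpose (matrix \<Gamma>) ** block_22 A ** matrix \<Gamma>) *v s))
       = (\<Sum>s\<leftarrow>ss. Q (s, \<Gamma> s)) + \<epsilon> * (\<Sum>s\<leftarrow>ss. vec_pair s (\<Gamma> s) \<bullet> vec_pair s (\<Gamma> s))"
      unfolding real_graph_pullback_quadratic[OF A] matrix_real_works[OF \<Gamma>] pA(3)
      by (simp add: sum_list_addf sum_list_const_mult)
    also have "(vec_fst p + transpose (matrix \<Gamma>) *v vec_snd p) \<bullet> b = p \<bullet> vec_pair b (\<Gamma> b)"
      unfolding inner_vec_pair inner_add_left
      by (metis \<Gamma> dot_lmul_matrix matrix_real_works transpose_matrix_vector transpose_transpose)
    finally show "c \<le> ((\<Sum>s\<leftarrow>ss. Q (s, \<Gamma> s)) + P (b, \<Gamma> b) - a * real_of_ereal (split_fun f z))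
       + \<epsilon> * (\<Sum>s\<leftarrow>ss. vec_pair s (\<Gamma> s) \<bullet> vec_pair s (\<Gamma> s))"
      unfolding pA(2) by (simp add: split_fun_def)
  qed (auto intro!: sum_list_nonneg)
qed

lemma real_product_fibre_sub:
  fixes F :: "((real^'n) \<times> 'n real_jet) set" and \<Omega> :: "(real^('n::finite + 'm::finite)) set"
  assumes f: "real_subharmonic (real_product F real_convexity_subequation) \<Omega> f"
  shows "fibre_sub (split_set \<Omega>) (split_fun f)"
  unfolding fibre_sub_def
proof (intro ballI allI impI)
  fix z \<phi> P Q and w :: "real^'m"
  assume z: "z \<in> split_set \<Omega>" and t: "touches (split_fun f) z \<phi>" and J: "jet2 \<phi> z P Q"
  let ?Z = "vec_pair (fst z) (snd z)"
  have Z: "?Z \<in> \<Omega>" using z by (simp add: split_set_def)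
  show "0 \<le> Q (0, w)"
  proof (rule le_limit_eps)
    fix \<epsilon> :: real assume \<epsilon>: "\<epsilon> > 0"
    obtain p A where pA: "upper_contact_jet f ?Z p A" "\<And>v. p \<bullet> v = P (vec_fst v, vec_snd v)"
      "\<And>v. v \<bullet> (A *v v) = Q (vec_fst v, vec_snd v) + \<epsilon> * (v \<bullet> v)"
      using touches_upper_contact_jet[OF touches_split[OF t J] \<epsilon>] by blast
    have "(?Z, real_of_ereal (f ?Z), p, A) \<in> real_product F real_convexity_subequation"
      using f pA(1) Z unfolding real_subharmonic_def jet_fibre_def by blast
    then have "block_22 A \<in> Pos"
      unfolding real_product_def real_fibre_pullback_def real_convexity_subequation_def jet_fibre_def by auto
    then have "0 \<le> w \<bullet> (block_22 A *v w)" by (simp add: Pos_def)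
    also have "\<dots> = vec_pair 0 w \<bullet> (A *v vec_pair 0 w)"
      unfolding mult_vec_pair inner_vec_pair by (simp add: inner_commute)
    finally show "0 \<le> Q (0, w) + \<epsilon> * (vec_pair 0 w \<bullet> (vec_pair 0 w :: real^('n + 'm)))" unfolding pA(3) by simp
  qed simp
qed

lemma closed_Sym: "closed (Sym :: (real^'n^'n) set)"
proof -
  have "Sym = {A :: real^'n^'n. \<forall>i j. A $ j $ i = A $ i $ j}"
    by (auto simp: Sym_def transpose_def vec_eq_iff)
  show ?thesis unfolding \<open>Sym = _\<close> by (intro closed_Collect_all closed_Collect_eq continuous_intros)
qed

lemma real_jet_fibre_closed:
  assumes "closedin (top_of_set (real_jets X)) F" "x \<in> X"
  shows "closed (jet_fibre F x)" "\<And>r p A. (r, p, A) \<in> jet_fibre F x \<Longrightarrow> A \<in> Sym"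
proof -
  obtain C where C: "closed C" "F = C \<inter> real_jets X" using assms(1) unfolding closedin_closed by auto
  have "jet_fibre F x = Pair x -` C \<inter> (UNIV \<times> UNIV \<times> Sym)"
    using C assms(2) by (auto simp: jet_fibre_def real_jets_def)
  moreover have "closed (Pair x -` C)" by (intro closed_vimage C continuous_intros)
  ultimately show "closed (jet_fibre F x)" by (simp add: closed_Int closed_Times closed_Sym)
  show "A \<in> Sym" if "(r, p, A) \<in> jet_fibre F x" for r p A
    using that C by (auto simp: jet_fibre_def real_jets_def)
qed

text \<open>A jet outside the closed convex fibre is cut off by a half-space containing the fibre,
  so membership is tested one half-space at a time. \<open>sub\<close> starts from the fibre at one
  \<open>x\<close> and concludes on all of \<open>D\<close>; constant coefficients bridge this in
  the application.\<close>

lemma real_subharmonicI: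
  fixes F :: "((real^'n) \<times> 'n real_jet) set"
  assumes F: "real_primitive_subequation X F" "negativity X F" "convex_fibres X F" and D: "D \<subseteq> X"
    and g: "usc_on D g" "\<And>x. x \<in> D \<Longrightarrow> g x \<noteq> \<infinity>"
    and sub: "\<And>ss b a c x. a \<ge> 0 \<Longrightarrow> x \<in> D \<Longrightarrow> half_space ss b a c (jet_fibre F x) \<Longrightarrow> lin_sub ss b a c D g"
  shows "real_subharmonic F D g"
  unfolding real_subharmonic_def
proof (intro conjI ballI allI impI)
  fix x p A assume x: "x \<in> D" and j: "upper_contact_jet g x p A"
  have xX: "x \<in> X" using x D by blast
  note cl = real_jet_fibre_closed[OF _ xX]
  have Fc: "closedin (top_of_set (real_jets X)) F" using F(1) by (simp add: real_primitive_subequation_def)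
  show "(real_of_ereal (g x), p, A) \<in> jet_fibre F x"
  proof (rule ccontr)
    assume out: "(real_of_ereal (g x), p, A) \<notin> jet_fibre F x"
    obtain ss b a c where H: "a \<ge> 0" "half_space ss b a c (jet_fibre F x)"
      "(\<Sum>s\<leftarrow>ss. s \<bullet> (A *v s)) + p \<bullet> b - a * real_of_ereal (g x) < c"
    proof (rule real_jet_separation[OF cl(1)[OF Fc] _ cl(2)[OF Fc] _ _ out])
      show "convex (jet_fibre F x)" using F(3) xX by (simp add: convex_fibres_def)
      show "(r', p, A) \<in> jet_fibre F x" if "(r, p, A) \<in> jet_fibre F x" "r' \<le> r" for r r' p A
        using F(2) xX that unfolding negativity_def by blast
      show "(r, p, A + R) \<in> jet_fibre F x" if "(r, p, A) \<in> jet_fibre F x" "R \<in> Pos" for r p A R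
        using F(1) xX that unfolding real_primitive_subequation_def by blast
      show "A \<in> Sym" using j by (simp add: upper_contact_jet_def)
    qed
    have "lin_sub ss b a c D g" by (rule sub[OF H(1) x H(2)])
    then have "c \<le> (\<Sum>s\<leftarrow>ss. s \<bullet> (A *v s)) + p \<bullet> b - a * real_of_ereal (g x)"
      using upper_contact_jet_touches[OF j g(2)[OF x]] x unfolding lin_sub_def by blast
    then show False using H(3) by simp
  qed
qed (use g in auto)

lemma marg_finite_above:
  assumes "\<And>z. z \<in> W \<Longrightarrow> f z \<noteq> \<infinity>" "x \<in> fst ` W" shows "marg W f x \<noteq> \<infinity>"
proof -
  obtain y where y: "(x, y) \<in> W" using assms(2) by auto
  then have "marg W f x \<le> f (x, y)" unfolding marg_def by (intro INF_lower) auto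
  then show ?thesis using assms(1)[OF y] by auto
qed

text \<open>Kept apart because it serves twice: for an arbitrary \<open>f\<close>, and for
  \<open>f = u\<close>, whose marginal becomes the exhaustion of the projection.\<close>

lemma real_minimum_principle_aux:
  fixes F :: "((real^'n) \<times> 'n real_jet) set" and \<Omega> :: "(real^('n::finite + 'm::finite)) set"
  assumes F: "real_primitive_subequation X F" "negativity X F" "convex_fibres X F" "constant_coefficient X F"
    and \<Omega>: "vec_fst ` \<Omega> \<subseteq> X" "open \<Omega>" "connected_fibres \<Omega>"
    and u: "continuous_on \<Omega> u" "exhaustive \<Omega> u" "real_subharmonic (real_product F real_convexity_subequation) \<Omega> (\<lambda>z. ereal (u z))"
    and f: "real_subharmonic (real_product F real_convexity_subequation) \<Omega> f"
  shows "real_subharmonic F (vec_fst ` \<Omega>) (marginal \<Omega> f)"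
proof -
  define W where "W = split_set \<Omega>"
  define v where "v = split_fun u"
  have W: "open W" and D: "fst ` W = vec_fst ` \<Omega>" unfolding W_def by (auto simp: fst_split_set open_split_set \<Omega>)
  have v: "continuous_on W v" unfolding v_def W_def by (rule continuous_on_split[OF u(1)])
  have comp: "compact {z \<in> W. v z \<le> K}" for K
    unfolding v_def W_def by (rule compact_sublevel_split[OF exhaustive_compact_sublevel[OF u(2,1)]])
  have veq: "split_fun (\<lambda>z. ereal (u z)) = (\<lambda>z. ereal (v z))" by (auto simp: split_fun_def v_def)
  have vfib: "fibre_sub W (\<lambda>z. ereal (v z))"
    using real_product_fibre_sub[OF u(3)] unfolding veq W_def .
  have fW: "usc_on W (split_fun f)" "\<And>z. z \<in> W \<Longrightarrow> split_fun f z \<noteq> \<infinity>"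
    using f usc_on_split unfolding real_subharmonic_def W_def split_set_def split_fun_def by blast+
  show ?thesis unfolding marginal_split D[symmetric] W_def[symmetric]
  proof (rule real_subharmonicI[OF F(1-3)])
    show "fst ` W \<subseteq> X" using D \<Omega>(1) by simp
    show "usc_on (fst ` W) (marg W (split_fun f))" by (rule usc_on_marg[OF W fW(1)])
    show "marg W (split_fun f) x \<noteq> \<infinity>" if "x \<in> fst ` W" for x by (rule marg_finite_above[OF fW(2) that])
    fix ss b a c x1 assume a: "(a::real) \<ge> 0" and x1: "x1 \<in> fst ` W" and "half_space ss b a c (jet_fibre F x1)"
    \<comment> \<open>Constant coefficients enter here: a half-space containing one fibre contains
      them all.\<close>
    then have H: "half_space ss b a c (jet_fibre F x)" if "x \<in> vec_fst ` \<Omega>" for x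
      using F(4) \<Omega>(1) D that unfolding constant_coefficient_def by (metis subsetD)
    show "lin_sub ss b a c (fst ` W) (marg W (split_fun f))"
    proof (rule lin_sub_marg[OF W fW _ _ continuous_imp_usc_on[OF v] _ vfib a])
      show "graph_sub ss b a c W (split_fun f)" "fibre_sub W (split_fun f)"
        unfolding W_def by (auto intro!: real_product_graph_sub real_product_fibre_sub f H)
      show "graph_sub ss b a c W (\<lambda>z. ereal (v z))"
        using real_product_graph_sub[OF u(3) H] unfolding veq W_def by blast
      show "\<exists>m. \<forall>y. (x, y) \<in> W \<longrightarrow> m \<le> v (x, y)" if "x \<in> fst ` W" for x
        using marg_attained[OF v comp that] by metis
      fix x0 K assume x0: "x0 \<in> fst ` W"
      define V where "V = {y. (x0, y) \<in> W \<and> v (x0, y) < K + 1}"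
      let ?S = "{y. (x0, y) \<in> W}"
      have "convex {y \<in> ?S. v (x0, y) < K + 1}"
      proof (rule connected_fibre_convex)
        have "?S = Pair x0 -` W" by auto
        then show "open ?S" using W by (simp only:) (intro open_vimage continuous_intros)
        have "?S = slice \<Omega> x0" by (auto simp: slice_def W_def split_set_def)
        moreover have "connected (slice \<Omega> x0)" using \<Omega>(3) x0 unfolding connected_fibres_def D by blast
        ultimately show "connected ?S" by simp
        show "continuous_on ?S (\<lambda>y. v (x0, y))"
          by (rule continuous_on_compose2[OF v]) (auto intro!: continuous_intros)
        show "closed {y \<in> ?S. v (x0, y) \<le> k}" for k
        proof -
          have "{y \<in> ?S. v (x0, y) \<le> k} = Pair x0 -` {z \<in> W. v z \<le> k}" by auto
          then show ?thesis using comp[of k] by (simp only:) (intro closed_vimage compact_imp_closed continuous_intros)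
        qed
        show "v (x0, y) \<le> max (v (x0, y0)) (v (x0, y1))"
          if "closed_segment y0 y1 \<subseteq> ?S" "y \<in> closed_segment y0 y1" for y0 y1 y
          by (rule fibre_sub_quasiconvex[OF W continuous_imp_usc_on[OF v] vfib _ that(2)]) (use that in auto)
      qed
      then have "convex V" by (simp add: V_def)
      then show "\<exists>\<rho>>0. \<exists>Y M. open Y \<and> convex Y \<and> cball x0 \<rho> \<times> Y \<subseteq> W
         \<and> (\<forall>x\<in>cball x0 \<rho>. \<forall>y. (x, y) \<in> W \<and> v (x, y) \<le> K \<longrightarrow> y \<in> Y)
         \<and> (\<forall>x\<in>cball x0 \<rho>. \<forall>y\<in>Y. split_fun f (x, y) \<le> ereal M \<and> v (x, y) \<le> M)"
        using compact_sublevel_tube[OF W v comp fW, where ?x0.0 = x0 and K = K] unfolding V_def[symmetric] by blast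
    qed
  qed
qed

theorem real_minimum_principle_convex:
  fixes F :: "((real^'n) \<times> 'n real_jet) set"
  assumes F: "real_primitive_subequation X F" "negativity X F" "convex_fibres X F" "constant_coefficient X F"
  shows "real_minimum_principle TYPE('m::finite) X F"
  unfolding real_minimum_principle_def
proof (intro allI impI conjI)
  fix \<Omega> :: "(real^('n + 'm)) set"
  assume *: "vec_fst ` \<Omega> \<subseteq> X \<and> \<Omega> \<noteq> {} \<and> open \<Omega> \<and> connected \<Omega> \<and>
        real_pseudoconvex (real_product F real_convexity_subequation) \<Omega> \<and> connected_fibres \<Omega>"
  then obtain u where \<Omega>: "vec_fst ` \<Omega> \<subseteq> X" "open \<Omega>" "connected_fibres \<Omega>"
    and u: "continuous_on \<Omega> u" "exhaustive \<Omega> u" "real_subharmonic (real_product F real_convexity_subequation) \<Omega> (\<lambda>z. ereal (u z))"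
    unfolding real_pseudoconvex_def by blast
  show "real_subharmonic F (vec_fst ` \<Omega>) (marginal \<Omega> f)"
    if "real_subharmonic (real_product F real_convexity_subequation) \<Omega> f" for f
    by (rule real_minimum_principle_aux[OF F \<Omega> u that])
  define W where "W = split_set \<Omega>"
  define v where "v = split_fun u"
  define g where "g = (\<lambda>x. real_of_ereal (marg W (\<lambda>z. ereal (v z)) x))"
  have W: "open W" and D: "fst ` W = vec_fst ` \<Omega>" unfolding W_def by (auto simp: fst_split_set open_split_set \<Omega>)
  have v: "continuous_on W v" unfolding v_def W_def by (rule continuous_on_split[OF u(1)])
  have comp: "compact {z \<in> W. v z \<le> K}" for K
    unfolding v_def W_def by (rule compact_sublevel_split[OF exhaustive_compact_sublevel[OF u(2,1)]])
  have veq: "split_fun (\<lambda>z. ereal (u z)) = (\<lambda>z. ereal (v z))" by (auto simp: split_fun_def v_def)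
  have proj: "continuous_on (vec_fst ` \<Omega>) g" "exhaustive (vec_fst ` \<Omega>) g"
    "\<And>x. x \<in> vec_fst ` \<Omega> \<Longrightarrow> marg W (\<lambda>z. ereal (v z)) x = ereal (g x)"
    using projected_exhaustion[OF W v comp] unfolding g_def D by auto
  have oD: "open (vec_fst ` \<Omega>)" using open_image_fst[OF W] D by simp
  have sub: "real_subharmonic F (vec_fst ` \<Omega>) (marg W (\<lambda>z. ereal (v z)))"
    using real_minimum_principle_aux[OF F \<Omega> u u(3)] unfolding marginal_split veq W_def .
  have "real_subharmonic F (vec_fst ` \<Omega>) (\<lambda>x. ereal (g x))"
    unfolding real_subharmonic_def
  proof (intro conjI ballI allI impI)
    show "usc_on (vec_fst ` \<Omega>) (\<lambda>x. ereal (g x))" by (rule continuous_imp_usc_on[OF proj(1)])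
    fix x p A assume x: "x \<in> vec_fst ` \<Omega>" and j: "upper_contact_jet (\<lambda>x. ereal (g x)) x p A"
    \<comment> \<open>The agreement is local: off the projection the marginal is an infimum over the
      empty set, while \<open>g\<close> is 0 there. Openness of the projection makes the germs
      equal.\<close>
    have ev: "\<forall>\<^sub>F y in nhds x. marg W (\<lambda>z. ereal (v z)) y = ereal (g y)"
      using eventually_nhds_in_open[OF oD x] by eventually_elim (rule proj(3))
    have "upper_contact_jet (marg W (\<lambda>z. ereal (v z))) x p A"
      using j eventually_elim2[OF ev, where R = "\<lambda>y. marg W (\<lambda>z. ereal (v z)) y \<le> ereal (g x) + ereal (p \<bullet> (y - x) + 1/2 * ((y - x) \<bullet> (A *v (y - x))))"]
      unfolding upper_contact_jet_def proj(3)[OF x] by auto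
    then have "(real_of_ereal (marg W (\<lambda>z. ereal (v z)) x), p, A) \<in> jet_fibre F x"
      using sub x unfolding real_subharmonic_def by blast
    then show "(real_of_ereal (ereal (g x)), p, A) \<in> jet_fibre F x" unfolding proj(3)[OF x] .
  qed auto
  then show "real_pseudoconvex F (vec_fst ` \<Omega>)"
    unfolding real_pseudoconvex_def using oD proj(1,2) by blast
qed

section \<open>Complex jets\<close>

lemma inner_complex_cnj: "(x::complex) \<bullet> y = Re (cnj x * y)"
  by (simp add: inner_complex_def)

lemma PosC_iff: "A \<in> PosC \<longleftrightarrow> A \<in> Herm \<and> (\<forall>v. 0 \<le> v \<bullet> (A *v v))"
  by (simp add: PosC_def inner_vec_def inner_complex_cnj)

lemma inner_adjoint_matrix: "v \<bullet> (adjoint_matrix G *v w) = (G *v v) \<bullet> w"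
proof -
  have "v \<bullet> (adjoint_matrix G *v w) = (\<Sum>i\<in>UNIV. \<Sum>j\<in>UNIV. Re (cnj (v $ i) * (cnj (G $ j $ i) * w $ j)))"
    by (simp only: inner_vec_def inner_complex_cnj matrix_vector_mult_def vec_lambda_beta adjoint_matrix_def
        sum_distrib_left Re_sum)
  also have "\<dots> = (\<Sum>j\<in>UNIV. \<Sum>i\<in>UNIV. Re (cnj (G $ j $ i * v $ i) * w $ j))"
    by (subst sum.swap) (simp add: mult_ac)
  also have "\<dots> = (G *v v) \<bullet> w"
    by (simp only: inner_vec_def inner_complex_cnj matrix_vector_mult_def vec_lambda_beta
        sum_distrib_right Re_sum cnj_sum)
  finally show ?thesis .
qed

lemma complex_graph_pullback_quadratic:
  fixes A :: "complex^('n::finite + 'm::finite)^('n + 'm)" and \<Gamma> :: "complex^'n^'m"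
  assumes "A \<in> Herm"
  shows "s \<bullet> ((block_11 A + block_12 A ** \<Gamma> + adjoint_matrix \<Gamma> ** adjoint_matrix (block_12 A)
        + adjoint_matrix \<Gamma> ** block_22 A ** \<Gamma>) *v s) = vec_pair s (\<Gamma> *v s) \<bullet> (A *v vec_pair s (\<Gamma> *v s))"
proof -
  have "cnj (A $ i $ j) = A $ j $ i" for i j
    using assms unfolding Herm_def adjoint_matrix_def by (metis (mono_tags, lifting) mem_Collect_eq vec_lambda_beta)
  then have 21: "block_21 A = adjoint_matrix (block_12 A)"
    unfolding block_21_def block_12_def adjoint_matrix_def by (simp add: vec_eq_iff)
  show ?thesis unfolding mult_vec_pair inner_vec_pair 21
    by (simp add: matrix_vector_mult_add_rdistrib inner_add_right inner_add_left matrix_vector_mul_assoc[symmetric]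
       inner_adjoint_matrix inner_commute)
qed

section \<open>Hermitian forms as real quadratic forms\<close>

lemma complexify_realify [simp]: "complexify (realify z) = z"
  by (simp add: complexify_def realify_def vec_eq_iff complex_eq_iff)

lemma realify_complexify [simp]: "realify (complexify v) = v"
proof -
  have "realify (complexify v) = vec_pair (vec_fst v) (vec_snd v)"
    by (simp add: complexify_def realify_def)
  then show ?thesis by simp
qed

lemma linear_complexify: "linear complexify"
  by (auto simp: linear_iff complexify_def vec_eq_iff vec_fst_def vec_snd_def complex_eq_iff)

lemma linear_realify: "linear realify"
  by (auto simp: linear_iff realify_def vec_pair_def vec_eq_iff split: sum.split)

lemma inner_realify: "realify v \<bullet> realify w = v \<bullet> w"
  unfolding realify_def inner_vec_pair by (simp add: inner_vec_def inner_complex_def sum.distrib)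

lemma inner_complexify: "complexify p \<bullet> w = p \<bullet> realify w"
  by (metis inner_realify realify_complexify)

text \<open>\<open>complex_part\<close> keeps the part of \<open>A\<close> invariant under
  multiplication by \<open>\<i>\<close>; the complementary part changes sign between
  \<open>v\<close> and \<open>\<i> *s v\<close> and drops out of the average.\<close>

lemma complex_part_quadratic:
  fixes A :: "real^('n::finite + 'n)^('n + 'n)"
  shows "v \<bullet> (complex_part A *v v) = (realify v \<bullet> (A *v realify v) + realify (\<i> *s v) \<bullet> (A *v realify (\<i> *s v))) / 2"
proof -
  have q: "w \<bullet> (A *v w) = (\<Sum>i\<in>UNIV. \<Sum>j\<in>UNIV.
      vec_fst w $ i * block_11 A $ i $ j * vec_fst w $ j + vec_fst w $ i * block_12 A $ i $ j * vec_snd w $ j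
      + vec_snd w $ i * block_21 A $ i $ j * vec_fst w $ j + vec_snd w $ i * block_22 A $ i $ j * vec_snd w $ j)" for w
    by (simp add: inner_matrix_vector sum_UNIV_Plus sum.distrib vec_fst_def vec_snd_def
        block_11_def block_12_def block_21_def block_22_def)
  have "v \<bullet> (complex_part A *v v) = (\<Sum>i\<in>UNIV. \<Sum>j\<in>UNIV. Re (cnj (v $ i) * (complex_part A $ i $ j * v $ j)))"
    by (simp only: inner_vec_def inner_complex_cnj matrix_vector_mult_def vec_lambda_beta sum_distrib_left Re_sum)
  then show ?thesis
    unfolding q sum_divide_distrib sum.distrib[symmetric]
    by (simp add: realify_def complex_part_def algebra_simps add_divide_distrib diff_divide_distrib)
qed

lemma complex_part_Herm: "A \<in> Sym \<Longrightarrow> complex_part A \<in> Herm"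
proof -
  assume "A \<in> Sym"
  then have "A $ i $ j = A $ j $ i" for i j
    unfolding Sym_def transpose_def by (metis (mono_tags, lifting) mem_Collect_eq vec_lambda_beta)
  then show ?thesis
    by (auto simp: Herm_def adjoint_matrix_def complex_part_def vec_eq_iff complex_eq_iff
        block_11_def block_12_def block_21_def block_22_def field_simps)
qed

text \<open>The real matrix of the complex-linear map \<open>M\<close>. It is a right inverse of
  \<open>complex_part\<close>, so a functional on hermitian matrices can be decomposed through
  symmetric ones.\<close>

definition real_form :: "complex^'n^'n \<Rightarrow> real^('n + 'n)^('n + 'n)" where
  "real_form M = (\<chi> k l. case k of
      Inl i \<Rightarrow> (case l of Inl j \<Rightarrow> Re (M $ i $ j) | Inr j \<Rightarrow> - Im (M $ i $ j))
    | Inr i \<Rightarrow> (case l of Inl j \<Rightarrow> Im (M $ i $ j) | Inr j \<Rightarrow> Re (M $ i $ j)))"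

lemma complex_part_real_form: "complex_part (real_form M) = M"
  by (simp add: complex_part_def real_form_def vec_eq_iff complex_eq_iff
      block_11_def block_12_def block_21_def block_22_def)

lemma real_form_Sym: "M \<in> Herm \<Longrightarrow> real_form M \<in> Sym"
proof -
  assume "M \<in> Herm"
  then have M: "M $ j $ i = cnj (M $ i $ j)" for i j
    unfolding Herm_def adjoint_matrix_def by (metis (mono_tags, lifting) mem_Collect_eq vec_lambda_beta)
  have 1: "Re (M $ j $ i) = Re (M $ i $ j)" "Im (M $ j $ i) = - Im (M $ i $ j)" "- Im (M $ j $ i) = Im (M $ i $ j)" for i j
    by (subst M, simp)+
  show ?thesis by (auto simp: Sym_def transpose_def real_form_def vec_eq_iff split: sum.split intro: 1)
qed

lemma real_form_quadratic: "s \<bullet> (real_form M *v s) = complexify s \<bullet> (M *v complexify s)"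
proof -
  have "s \<bullet> (real_form M *v s) = (\<Sum>i\<in>UNIV. \<Sum>j\<in>UNIV.
      vec_fst s $ i * Re (M $ i $ j) * vec_fst s $ j - vec_fst s $ i * Im (M $ i $ j) * vec_snd s $ j
      + vec_snd s $ i * Im (M $ i $ j) * vec_fst s $ j + vec_snd s $ i * Re (M $ i $ j) * vec_snd s $ j)"
    by (simp add: inner_matrix_vector sum_UNIV_Plus sum.distrib sum_subtractf vec_fst_def vec_snd_def real_form_def sum_negf)
  moreover have "complexify s \<bullet> (M *v complexify s) =
      (\<Sum>i\<in>UNIV. \<Sum>j\<in>UNIV. Re (cnj (complexify s $ i) * (M $ i $ j * complexify s $ j)))"
    by (simp only: inner_vec_def inner_complex_cnj matrix_vector_mult_def vec_lambda_beta sum_distrib_left Re_sum)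
  ultimately show ?thesis by (simp add: complexify_def algebra_simps)
qed

lemma linear_complex_part: "linear (complex_part :: real^('n::finite + 'n)^('n + 'n) \<Rightarrow> complex^'n^'n)"
  by (auto simp: linear_iff complex_part_def vec_eq_iff complex_eq_iff
      block_11_def block_12_def block_21_def block_22_def algebra_simps)

text \<open>The adjoint of \<open>complex_part\<close> carries \<open>S\<close> to a real
  functional, nonnegative on the rank-one matrices \<open>outer v\<close> because their complex part
  is semipositive. The real directions found for it are read as complex vectors.\<close>

lemma psd_complex_functional:
  fixes S :: "complex^'n^'n"
  assumes "\<And>R. R \<in> PosC \<Longrightarrow> 0 \<le> S \<bullet> R"
  obtains ss where "\<And>M. M \<in> Herm \<Longrightarrow> S \<bullet> M = (\<Sum>s\<leftarrow>ss. s \<bullet> (M *v s))"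
proof -
  define S2 where "S2 = adjoint complex_part S"
  have S2: "S2 \<bullet> A = S \<bullet> complex_part A" for A :: "real^('n::finite + 'n)^('n + 'n)"
    unfolding S2_def using adjoint_works[OF linear_complex_part, of A S] by (simp add: inner_commute)
  have "complex_part (outer v) \<in> PosC" for v :: "real^('n + 'n)"
    unfolding PosC_iff complex_part_quadratic outer_mult
    using outer_Pos[of v] by (auto intro!: complex_part_Herm simp: Pos_def)
  then have "0 \<le> v \<bullet> (S2 *v v)" for v
    unfolding inner_outer[symmetric] S2 using assms by blast
  then obtain ss where ss: "\<And>A. A \<in> Sym \<Longrightarrow> S2 \<bullet> A = (\<Sum>s\<leftarrow>ss. s \<bullet> (A *v s))"
    using psd_functional_sum_of_squares by blast
  show ?thesis
  proof (rule that[of "map complexify ss"])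
    fix M :: "complex^'n^'n" assume M: "M \<in> Herm"
    have "S \<bullet> M = S2 \<bullet> real_form M" unfolding S2 complex_part_real_form ..
    also have "\<dots> = (\<Sum>s\<leftarrow>ss. s \<bullet> (real_form M *v s))" by (rule ss[OF real_form_Sym[OF M]])
    finally show "S \<bullet> M = (\<Sum>s\<leftarrow>map complexify ss. s \<bullet> (M *v s))" by (simp add: real_form_quadratic o_def)
  qed
qed

lemma complex_jet_separation:
  fixes F0 :: "'n::finite complex_jet set"
  assumes F: "closed F0" "convex F0" "\<And>r p A. (r, p, A) \<in> F0 \<Longrightarrow> A \<in> Herm"
    and neg: "\<And>r r' p A. (r, p, A) \<in> F0 \<Longrightarrow> r' \<le> r \<Longrightarrow> (r', p, A) \<in> F0"
    and pos: "\<And>r p A R. (r, p, A) \<in> F0 \<Longrightarrow> R \<in> PosC \<Longrightarrow> (r, p, A + R) \<in> F0"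
    and out: "(r0, p0, A0) \<notin> F0" "A0 \<in> Herm"
  obtains ss b a c where "a \<ge> 0" "half_space ss b a c F0"
    "(\<Sum>s\<leftarrow>ss. s \<bullet> (A0 *v s)) + p0 \<bullet> b - a * r0 < c"
proof (cases "F0 = {}")
  case True
  then show ?thesis using that[of 0 "[]" 0 1] by (simp add: half_space_def)
next
  case False
  have cone: "t *\<^sub>R R \<in> PosC" if R: "R \<in> PosC" "t \<ge> 0" for t and R :: "complex^'n^'n"
  proof -
    have "(t *\<^sub>R R) *v v = t *\<^sub>R (R *v v)" for v
      by (simp add: matrix_vector_mult_def vec_eq_iff scaleR_sum_right)
    then have "v \<bullet> ((t *\<^sub>R R) *v v) = t * (v \<bullet> (R *v v))" for v by simp
    moreover have "t *\<^sub>R R \<in> Herm"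
      using R by (auto simp: PosC_iff Herm_def adjoint_matrix_def vec_eq_iff)
    ultimately show ?thesis using R by (simp add: PosC_iff)
  qed
  obtain a b S c where *: "a \<ge> 0" "\<forall>R\<in>PosC. S \<bullet> R \<ge> 0"
    "\<forall>r p A. (r, p, A) \<in> F0 \<longrightarrow> c \<le> S \<bullet> A + p \<bullet> b - a * r" "S \<bullet> A0 + p0 \<bullet> b - a * r0 < c"
    by (rule jet_separation[OF F(1,2) False neg pos cone out(1)])
  obtain ss where ss: "\<And>A. A \<in> Herm \<Longrightarrow> S \<bullet> A = (\<Sum>s\<leftarrow>ss. s \<bullet> (A *v s))"
    using psd_complex_functional[of S] *(2) by metis
  have "half_space ss b a c F0"
    unfolding half_space_def using *(3) ss[OF F(3)] by fastforce
  then show ?thesis using that *(1,4) ss[OF out(2)] by auto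
qed

lemma linear_ii: "linear (\<lambda>v :: complex^'n. \<i> *s v)"
  by (auto simp: linear_iff vec_eq_iff algebra_simps)

text \<open>The hermitian part of the Hessian appears as the mean of \<open>Q\<close> over a vector
  and its \<open>\<i>\<close>-multiple, and the slopes \<open>G\<close> are complex-linear. This is
  what the complex product gives directly, before the passage to real slopes.\<close>

definition cgraph_sub ::
  "(complex^'n) list \<Rightarrow> complex^'n \<Rightarrow> real \<Rightarrow> real \<Rightarrow> ((complex^'n) \<times> (complex^'m)) set \<Rightarrow> ((complex^'n) \<times> (complex^'m) \<Rightarrow> ereal) \<Rightarrow> bool" where
  "cgraph_sub ss b a c W f \<longleftrightarrow>
     (\<forall>z\<in>W. \<forall>\<phi> P Q G. touches f z \<phi> \<longrightarrow> jet2 \<phi> z P Q \<longrightarrow>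
        c \<le> (\<Sum>s\<leftarrow>ss. (Q (s, G *v s) + Q (\<i> *s s, \<i> *s (G *v s))) / 2) + P (b, G *v b) - a * real_of_ereal (f z))"

definition cfibre_sub :: "((complex^'n) \<times> (complex^'m)) set \<Rightarrow> ((complex^'n) \<times> (complex^'m) \<Rightarrow> ereal) \<Rightarrow> bool" where
  "cfibre_sub W f \<longleftrightarrow>
     (\<forall>z\<in>W. \<forall>\<phi> P Q w. touches f z \<phi> \<longrightarrow> jet2 \<phi> z P Q \<longrightarrow> 0 \<le> Q (0, w) + Q (0, \<i> *s w))"

lemma touches_complexify:
  fixes f :: "complex^'n \<Rightarrow> ereal"
  assumes t: "touches f z \<phi>"
  shows "touches (f \<circ> complexify) (realify z) (\<lambda>v. \<phi> (complexify v))"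
  using touches_comp_linear[OF _ linear_complexify, of f "realify z" \<phi>] t by (simp add: o_def)

lemma complex_subharmonic_jet:
  fixes f :: "complex^'n \<Rightarrow> ereal"
  assumes f: "complex_subharmonic G \<Omega> f" and z: "z \<in> \<Omega>" and t: "touches f z \<phi>" and j: "jet2 \<phi> z P Q" and \<epsilon>: "\<epsilon> > 0"
  obtains p M where "(real_of_ereal (f z), p, M) \<in> jet_fibre G z" "M \<in> Herm" "\<And>v. p \<bullet> v = P v"
    "\<And>v. v \<bullet> (M *v v) = (Q v + Q (\<i> *s v)) / 2 + \<epsilon> * (v \<bullet> v)"
proof -
  have jc: "jet2 (\<lambda>v. \<phi> (complexify v)) (realify z) (\<lambda>v. P (complexify v)) (\<lambda>v. Q (complexify v))"
    by (rule jet2_comp_linear[OF _ linear_complexify]) (simp add: j)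
  obtain p A where pA: "upper_contact_jet (f \<circ> complexify) (realify z) p A" "\<And>v. p \<bullet> v = P (complexify v)"
      "\<And>v. v \<bullet> (A *v v) = Q (complexify v) + \<epsilon> * (v \<bullet> v)"
    using touches_upper_contact_jet[OF touches_complexify[OF t] jc \<epsilon>] by blast
  have "(real_of_ereal (f z), complexify p, complex_part A) \<in> jet_fibre G z"
    using f z pA(1) unfolding complex_subharmonic_def by blast
  moreover have "complex_part A \<in> Herm" using pA(1) by (simp add: upper_contact_jet_def complex_part_Herm)
  moreover have "complexify p \<bullet> v = P v" for v unfolding inner_complexify pA(2) by simp
  moreover have "v \<bullet> (complex_part A *v v) = (Q v + Q (\<i> *s v)) / 2 + \<epsilon> * (v \<bullet> v)" for v
  proof -
    have "(\<i> *s v) \<bullet> (\<i> *s v) = v \<bullet> v" by (simp add: inner_vec_def inner_complex_def algebra_simps)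
    then show ?thesis unfolding complex_part_quadratic pA(3) inner_realify by (simp add: field_simps)
  qed
  ultimately show ?thesis using that by blast
qed

lemma scale_vec_pair: "c *s vec_pair v w = vec_pair (c *s v) (c *s w)"
  by (auto simp: vec_pair_def vec_eq_iff split: sum.split)

lemma complex_product_cgraph_sub:
  fixes F :: "((complex^'n) \<times> 'n complex_jet) set" and \<Omega> :: "(complex^('n::finite + 'm::finite)) set"
  assumes f: "complex_subharmonic (complex_product F complex_convexity_subequation) \<Omega> f"
    and H: "\<And>x. x \<in> vec_fst ` \<Omega> \<Longrightarrow> half_space ss b a c (jet_fibre F x)"
  shows "cgraph_sub ss b a c (split_set \<Omega>) (split_fun f)"
  unfolding cgraph_sub_def
proof (intro ballI allI impI)
  fix z \<phi> P Q and G :: "complex^'n^'m"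
  assume z: "z \<in> split_set \<Omega>" and t: "touches (split_fun f) z \<phi>" and J: "jet2 \<phi> z P Q"
  let ?Z = "vec_pair (fst z) (snd z)"
  have Z: "?Z \<in> \<Omega>" using z by (simp add: split_set_def)
  then have x: "fst z \<in> vec_fst ` \<Omega>" by (metis image_eqI vec_fst_pair)
  let ?R = "(\<Sum>s\<leftarrow>ss. (Q (s, G *v s) + Q (\<i> *s s, \<i> *s (G *v s))) / 2) + P (b, G *v b) - a * real_of_ereal (split_fun f z)"
  show "c \<le> ?R"
  proof (rule le_limit_eps)
    fix \<epsilon> :: real assume \<epsilon>: "\<epsilon> > 0"
    obtain p M where pM: "(real_of_ereal (f ?Z), p, M) \<in> jet_fibre (complex_product F complex_convexity_subequation) ?Z"
      "M \<in> Herm" "\<And>v. p \<bullet> v = P (vec_fst v, vec_snd v)"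
      "\<And>v. v \<bullet> (M *v v) = (Q (vec_fst v, vec_snd v) + Q (vec_fst (\<i> *s v), vec_snd (\<i> *s v))) / 2 + \<epsilon> * (v \<bullet> v)"
      using complex_subharmonic_jet[OF f Z touches_split[OF t J] \<epsilon>] by blast
    have "complex_graph_pullback G (real_of_ereal (f ?Z), p, M) \<in> jet_fibre F (fst z)"
      using pM(1) unfolding complex_product_def jet_fibre_def by auto
    then have "c \<le> (\<Sum>s\<leftarrow>ss. s \<bullet> ((block_11 M + block_12 M ** G + adjoint_matrix G ** adjoint_matrix (block_12 M)
        + adjoint_matrix G ** block_22 M ** G) *v s)) + (vec_fst p + adjoint_matrix G *v vec_snd p) \<bullet> b
        - a * real_of_ereal (f ?Z)"
      using H[OF x] unfolding half_space_def complex_graph_pullback_def by auto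
    also have "(\<Sum>s\<leftarrow>ss. s \<bullet> ((block_11 M + block_12 M ** G + adjoint_matrix G ** adjoint_matrix (block_12 M)
        + adjoint_matrix G ** block_22 M ** G) *v s))
       = (\<Sum>s\<leftarrow>ss. (Q (s, G *v s) + Q (\<i> *s s, \<i> *s (G *v s))) / 2) + \<epsilon> * (\<Sum>s\<leftarrow>ss. vec_pair s (G *v s) \<bullet> vec_pair s (G *v s))"
      unfolding complex_graph_pullback_quadratic[OF pM(2)] pM(4) scale_vec_pair
      by (simp add: sum_list_addf sum_list_const_mult)
    also have "(vec_fst p + adjoint_matrix G *v vec_snd p) \<bullet> b = p \<bullet> vec_pair b (G *v b)"
      unfolding inner_vec_pair inner_add_left using inner_adjoint_matrix[of b G "vec_snd p"] by (simp add: inner_commute)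
    finally show "c \<le> ?R + \<epsilon> * (\<Sum>s\<leftarrow>ss. vec_pair s (G *v s) \<bullet> vec_pair s (G *v s))"
      unfolding pM(3) by (simp add: split_fun_def)
  qed (auto intro!: sum_list_nonneg)
qed

lemma complex_product_cfibre_sub:
  fixes F :: "((complex^'n) \<times> 'n complex_jet) set" and \<Omega> :: "(complex^('n::finite + 'm::finite)) set"
  assumes f: "complex_subharmonic (complex_product F complex_convexity_subequation) \<Omega> f"
  shows "cfibre_sub (split_set \<Omega>) (split_fun f)"
  unfolding cfibre_sub_def
proof (intro ballI allI impI)
  fix z \<phi> P Q and w :: "complex^'m"
  assume z: "z \<in> split_set \<Omega>" and t: "touches (split_fun f) z \<phi>" and J: "jet2 \<phi> z P Q"
  let ?Z = "vec_pair (fst z) (snd z)"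
  have Z: "?Z \<in> \<Omega>" using z by (simp add: split_set_def)
  show "0 \<le> Q (0, w) + Q (0, \<i> *s w)"
  proof (rule le_limit_eps)
    fix \<epsilon> :: real assume \<epsilon>: "\<epsilon> > 0"
    obtain p M where pM: "(real_of_ereal (f ?Z), p, M) \<in> jet_fibre (complex_product F complex_convexity_subequation) ?Z"
      "M \<in> Herm" "\<And>v. p \<bullet> v = P (vec_fst v, vec_snd v)"
      "\<And>v. v \<bullet> (M *v v) = (Q (vec_fst v, vec_snd v) + Q (vec_fst (\<i> *s v), vec_snd (\<i> *s v))) / 2 + \<epsilon> * (v \<bullet> v)"
      using complex_subharmonic_jet[OF f Z touches_split[OF t J] \<epsilon>] by blast
    from pM(1) have "block_22 M \<in> PosC"
      unfolding complex_product_def complex_fibre_pullback_def complex_convexity_subequation_def jet_fibre_def by auto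
    then have "0 \<le> w \<bullet> (block_22 M *v w)" by (simp add: PosC_iff)
    also have "\<dots> = vec_pair 0 w \<bullet> (M *v vec_pair 0 w)"
      unfolding mult_vec_pair inner_vec_pair by (simp add: inner_commute)
    also have "\<dots> = (Q (0, w) + Q (0, \<i> *s w)) / 2 + \<epsilon> * (vec_pair 0 w \<bullet> (vec_pair 0 w :: complex^('n + 'm)))"
      unfolding pM(4) scale_vec_pair by simp
    finally have fin: "0 \<le> (Q (0, w) + Q (0, \<i> *s w)) / 2 + \<epsilon> * (vec_pair 0 w \<bullet> (vec_pair 0 w :: complex^('n + 'm)))" .
    have "0 \<le> (q + q') / 2 + \<epsilon> * k \<Longrightarrow> 0 \<le> q + q' + \<epsilon> * (2 * k)" for q q' k :: real
      by (simp add: field_simps)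
    from this[OF fin]
    show "0 \<le> Q (0, w) + Q (0, \<i> *s w) + \<epsilon> * (2 * (vec_pair 0 w \<bullet> (vec_pair 0 w :: complex^('n + 'm))))" .
  qed simp
qed

lemma closed_Herm: "closed (Herm :: (complex^'n^'n) set)"
proof -
  have "Herm = {A :: complex^'n^'n. \<forall>i j. cnj (A $ j $ i) = A $ i $ j}"
    by (auto simp: Herm_def adjoint_matrix_def vec_eq_iff)
  show ?thesis unfolding \<open>Herm = _\<close> by (intro closed_Collect_all closed_Collect_eq continuous_intros)
qed

lemma complex_jet_fibre_closed:
  assumes "closedin (top_of_set (complex_jets X)) F" "x \<in> X"
  shows "closed (jet_fibre F x)" "\<And>r p A. (r, p, A) \<in> jet_fibre F x \<Longrightarrow> A \<in> Herm"
proof -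
  obtain C where C: "closed C" "F = C \<inter> complex_jets X" using assms(1) unfolding closedin_closed by auto
  have "jet_fibre F x = Pair x -` C \<inter> (UNIV \<times> UNIV \<times> Herm)"
    using C assms(2) by (auto simp: jet_fibre_def complex_jets_def)
  moreover have "closed (Pair x -` C)" by (intro closed_vimage C continuous_intros)
  ultimately show "closed (jet_fibre F x)" by (simp add: closed_Int closed_Times closed_Herm)
  show "A \<in> Herm" if "(r, p, A) \<in> jet_fibre F x" for r p A
    using that C by (auto simp: jet_fibre_def complex_jets_def)
qed

text \<open>A hermitian second derivative is the mean of two real ones; the factor
  \<open>1 / sqrt 2\<close> turns the mean into a plain sum, so the real theory applies to the
  doubled list.\<close>

definition complex_directions :: "(complex^'n) list \<Rightarrow> (complex^'n) list" where
  "complex_directions ss = map (\<lambda>s. (1 / sqrt 2) *\<^sub>R s) ss @ map (\<lambda>s. (1 / sqrt 2) *\<^sub>R (\<i> *s s)) ss"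

lemma sum_complex_directions:
  assumes "quadform Q" "linear L"
  shows "(\<Sum>s\<leftarrow>complex_directions ss. (Q (s, L s) :: real)) = (\<Sum>s\<leftarrow>ss. (Q (s, L s) + Q (\<i> *s s, L (\<i> *s s))) / 2)"
proof -
  have *: "Q ((1 / sqrt 2) *\<^sub>R s, L ((1 / sqrt 2) *\<^sub>R s)) = Q (s, L s) / 2" for s
  proof -
    have "((1 / sqrt 2) *\<^sub>R s, L ((1 / sqrt 2) *\<^sub>R s)) = (1 / sqrt 2) *\<^sub>R (s, L s)"
      by (simp add: linear_cmul[OF assms(2)])
    then show ?thesis using quadform_scaleR[OF assms(1), of "1 / sqrt 2" "(s, L s)"] by (simp add: power_divide)
  qed
  show ?thesis unfolding complex_directions_def
    by (simp add: o_def * sum_list_addf[symmetric] add_divide_distrib)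
qed

lemma complex_subharmonicI:
  fixes F :: "((complex^'n) \<times> 'n complex_jet) set"
  assumes F: "complex_primitive_subequation X F" "negativity X F" "convex_fibres X F" and D: "D \<subseteq> X"
    and g: "usc_on D g" "\<And>x. x \<in> D \<Longrightarrow> g x \<noteq> \<infinity>"
    and sub: "\<And>ss b a c x. a \<ge> 0 \<Longrightarrow> x \<in> D \<Longrightarrow> half_space ss b a c (jet_fibre F x) \<Longrightarrow>
        lin_sub (complex_directions ss) b a c D g"
  shows "complex_subharmonic F D g"
  unfolding complex_subharmonic_def
proof (intro conjI ballI allI impI)
  fix x p A assume x: "x \<in> D" and j: "upper_contact_jet (g \<circ> complexify) (realify x) p A"
  have xX: "x \<in> X" using x D by blast
  note cl = complex_jet_fibre_closed[OF _ xX]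
  have Fc: "closedin (top_of_set (complex_jets X)) F" using F(1) by (simp add: complex_primitive_subequation_def)
  have A: "A \<in> Sym" using j by (simp add: upper_contact_jet_def)
  show "(real_of_ereal (g x), complexify p, complex_part A) \<in> jet_fibre F x"
  proof (rule ccontr)
    assume out: "(real_of_ereal (g x), complexify p, complex_part A) \<notin> jet_fibre F x"
    obtain ss b a c where H: "a \<ge> 0" "half_space ss b a c (jet_fibre F x)"
      "(\<Sum>s\<leftarrow>ss. s \<bullet> (complex_part A *v s)) + complexify p \<bullet> b - a * real_of_ereal (g x) < c"
    proof (rule complex_jet_separation[OF cl(1)[OF Fc] _ cl(2)[OF Fc] _ _ out])
      show "convex (jet_fibre F x)" using F(3) xX by (simp add: convex_fibres_def)
      show "(r', p, A) \<in> jet_fibre F x" if "(r, p, A) \<in> jet_fibre F x" "r' \<le> r" for r r' p A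
        using F(2) xX that unfolding negativity_def by blast
      show "(r, p, A + R) \<in> jet_fibre F x" if "(r, p, A) \<in> jet_fibre F x" "R \<in> PosC" for r p A R
        using F(1) xX that unfolding complex_primitive_subequation_def by blast
      show "complex_part A \<in> Herm" by (rule complex_part_Herm[OF A])
    qed
    have sub': "lin_sub (complex_directions ss) b a c D g" by (rule sub[OF H(1) x H(2)])
    have "(g \<circ> complexify) (realify x) \<noteq> \<infinity>" using g(2)[OF x] by simp
    note t = upper_contact_jet_touches[OF j this]
    let ?\<phi> = "\<lambda>y. p \<bullet> (y - realify x) + (1/2) * ((y - realify x) \<bullet> (A *v (y - realify x)))"
    have "touches (\<lambda>y. (g \<circ> complexify) (realify y)) x (\<lambda>y. ?\<phi> (realify y))"
      by (rule touches_comp_linear[OF t(1) linear_realify])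
    then have "touches g x (\<lambda>y. ?\<phi> (realify y))" by simp
    moreover have "jet2 (\<lambda>y. ?\<phi> (realify y)) x (\<lambda>v. p \<bullet> realify v) (\<lambda>v. realify v \<bullet> (A *v realify v))"
      by (rule jet2_comp_linear[OF t(2) linear_realify])
    ultimately have "c \<le> (\<Sum>s\<leftarrow>complex_directions ss. realify s \<bullet> (A *v realify s)) + p \<bullet> realify b - a * real_of_ereal (g x)"
      using sub' x unfolding lin_sub_def by blast
    also have "(\<Sum>s\<leftarrow>complex_directions ss. realify s \<bullet> (A *v realify s)) = (\<Sum>s\<leftarrow>ss. s \<bullet> (complex_part A *v s))"
    proof -
      \<comment> \<open>The real second factor is a dummy that brings the form into the shape of
        \<open>sum_complex_directions\<close>, applied with the zero map.\<close>
      have "quadform (\<lambda>z::(complex^'n) \<times> real. realify (fst z) \<bullet> (A *v realify (fst z)))"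
        by (rule quadform_inner[of "\<lambda>z. realify (fst z)" "\<lambda>z. A *v realify (fst z)"])
           (auto intro: linear_compose[OF linear_fst linear_realify, unfolded o_def]
             linear_compose[OF linear_compose[OF linear_fst linear_realify] matrix_vector_mul_linear, unfolded o_def])
      from sum_complex_directions[OF this linear_zero] show ?thesis unfolding complex_part_quadratic by simp
    qed
    finally show False using H(3) unfolding inner_complexify by simp
  qed
qed (use g in auto)

section \<open>Torus orbits and logarithmic coordinates\<close>

text \<open>The orbit relation of the torus expressed through moduli, which avoids choosing
  angles.\<close>

definition same_modulus :: "complex^'m \<Rightarrow> complex^'m \<Rightarrow> bool" where
  "same_modulus w w' \<longleftrightarrow> (\<forall>j. norm (w $ j) = norm (w' $ j))"

lemma same_modulus_torus:
  assumes "same_modulus w w'" obtains \<theta> where "w' = torus_act \<theta> w"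
proof
  \<comment> \<open>At a zero coordinate the value of \<open>Arg\<close> is immaterial, since both
    vectors vanish there.\<close>
  show "w' = torus_act (\<chi> j. Arg (w' $ j) - Arg (w $ j)) w"
  proof -
    have "w' $ j = cis (Arg (w' $ j) - Arg (w $ j)) * w $ j" for j
    proof -
      have "cis (Arg (w' $ j) - Arg (w $ j)) * w $ j = cis (Arg (w' $ j)) * (norm (w $ j) * (cis (- Arg (w $ j)) * cis (Arg (w $ j))))"
        by (subst rcis_cmod_Arg[symmetric, of "w $ j"]) (simp add: rcis_def cis_mult mult_ac)
      also have "\<dots> = rcis (norm (w' $ j)) (Arg (w' $ j))"
        using assms by (simp add: same_modulus_def cis_mult rcis_def mult_ac)
      finally show ?thesis by (simp add: rcis_cmod_Arg)
    qed
    then show ?thesis by (simp add: torus_act_def vec_eq_iff)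
  qed
qed

definition orbit_closed :: "((complex^'n) \<times> (complex^'m)) set \<Rightarrow> bool" where
  "orbit_closed W \<longleftrightarrow> (\<forall>z w w'. (z, w) \<in> W \<longrightarrow> same_modulus w w' \<longrightarrow> (z, w') \<in> W)"

definition orbit_invariant :: "((complex^'n) \<times> (complex^'m)) set \<Rightarrow> ((complex^'n) \<times> (complex^'m) \<Rightarrow> 'b) \<Rightarrow> bool" where
  "orbit_invariant W f \<longleftrightarrow> (\<forall>z w w'. (z, w) \<in> W \<longrightarrow> same_modulus w w' \<longrightarrow> f (z, w') = f (z, w))"

lemma orbit_closed_split: "torus_invariant_set \<Omega> \<Longrightarrow> orbit_closed (split_set \<Omega>)"
  unfolding orbit_closed_def torus_invariant_set_def split_set_def by (auto elim!: same_modulus_torus)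

lemma orbit_invariant_split: "torus_invariant_fun \<Omega> f \<Longrightarrow> orbit_invariant (split_set \<Omega>) (split_fun f)"
  unfolding orbit_invariant_def torus_invariant_fun_def split_set_def split_fun_def by (auto elim!: same_modulus_torus)

definition cexp :: "real^'m \<Rightarrow> complex^'m" where
  "cexp s = (\<chi> j. of_real (exp (s $ j)))"

definition logabs :: "complex^'m \<Rightarrow> real^'m" where
  "logabs w = (\<chi> j. ln (norm (w $ j)))"

lemma logabs_cexp [simp]: "logabs (cexp s) = s"
  by (simp add: logabs_def cexp_def vec_eq_iff)

lemma same_modulus_cexp_logabs: "(\<And>j. w $ j \<noteq> 0) \<Longrightarrow> same_modulus w (cexp (logabs w))"
  by (simp add: same_modulus_def cexp_def logabs_def)

lemma continuous_on_cexp [continuous_intros]: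
  "continuous_on S f \<Longrightarrow> continuous_on S (\<lambda>x. cexp (f x))"
  unfolding cexp_def by (intro continuous_intros)

text \<open>These coordinates see the points without zero coordinates; the others are recovered by
  density.\<close>

definition log_set :: "((complex^'n) \<times> (complex^'m)) set \<Rightarrow> ((complex^'n) \<times> (real^'m)) set" where
  "log_set W = {z. (fst z, cexp (snd z)) \<in> W}"

lemma open_log_set: "open W \<Longrightarrow> open (log_set W)"
  unfolding log_set_def vimage_def[symmetric] by (intro open_vimage continuous_intros)

lemma jet2_sum:
  assumes "finite I" "\<And>i. i \<in> I \<Longrightarrow> jet2 (F i) z (P i) (Q i)"
  shows "jet2 (\<lambda>x. \<Sum>i\<in>I. F i x) z (\<lambda>v. \<Sum>i\<in>I. P i v) (\<lambda>v. \<Sum>i\<in>I. Q i v)"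
  using assms
proof (induction I rule: finite_induct)
  case empty show ?case using jet2_const[of 0 z] by simp
next
  case (insert i I)
  then show ?case using jet2_add[OF insert.prems[of i] insert.IH] by simp
qed

text \<open>Directions are written as \<open>w $ j * \<gamma> j\<close>, so that the jet can be read
  off from \<open>ln |w (1 + \<gamma>)| = ln |w| + Re \<gamma> - Re (\<gamma>^2) / 2 + ...\<close>.
  The second-order part changes sign under \<open>\<gamma> \<mapsto> \<i> \<gamma>\<close>, because
  \<open>ln |w|\<close> is pluriharmonic.\<close>

lemma jet2_logabs:
  fixes w :: "complex^'m"
  assumes w: "\<And>j. w $ j \<noteq> 0"
  obtains P Q where "jet2 logabs w P Q"
    "\<And>\<gamma> j. P (\<chi> j. w $ j * \<gamma> j) $ j = Re (\<gamma> j)" "\<And>\<gamma> j. Q (\<chi> j. w $ j * \<gamma> j) $ j = - Re (\<gamma> j * \<gamma> j)"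
proof -
  define r where "r = (\<lambda>j. (norm (w $ j))\<^sup>2)"
  have r: "r j > 0" for j using w by (simp add: r_def)
  define p where "p = (\<lambda>j v. (1/2) * (1 / r j * (2 * (w $ j \<bullet> v $ j))))"
  define q where "q = (\<lambda>j v. (1/2) * (1 / r j * (2 * (w $ j \<bullet> (0::complex)) + 2 * (norm (v $ j))\<^sup>2) + (- 1 / (r j)\<^sup>2) * (2 * (w $ j \<bullet> v $ j))\<^sup>2))"
  have j1: "jet2 (\<lambda>w. (1/2) * ln ((norm (w $ j))\<^sup>2)) w (p j) (q j)" for j
  proof -
    have A: "jet2 (\<lambda>w. (norm (w $ j))\<^sup>2) w (\<lambda>v. 2 * (w $ j \<bullet> v $ j)) (\<lambda>v. 2 * (w $ j \<bullet> 0) + 2 * (norm (v $ j))\<^sup>2)"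
      by (rule jet2_norm2_comp[OF jet2_linear]) (auto simp: linear_iff)
    have "\<forall>\<^sub>F y in nhds (r j). y \<in> {0<..}" using r[of j] by (intro eventually_nhds_in_open) auto
    then have "\<forall>\<^sub>F y in nhds (r j). (ln has_real_derivative 1 / y) (at y)"
      by eventually_elim (auto intro!: derivative_eq_intros)
    moreover have "((\<lambda>y. 1 / y) has_real_derivative - 1 / (r j)\<^sup>2) (at (r j))"
      using r[of j] by (auto intro!: derivative_eq_intros simp: power2_eq_square divide_simps)
    ultimately have "jet2 ln (r j) (\<lambda>h. 1 / r j * h) (\<lambda>h. - 1 / (r j)\<^sup>2 * h\<^sup>2)"
      by (rule jet2_real)
    then have B: "jet2 ln ((norm (w $ j))\<^sup>2) (\<lambda>h. 1 / r j * h) (\<lambda>h. - 1 / (r j)\<^sup>2 * h\<^sup>2)"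
      by (simp add: r_def)
    show ?thesis unfolding p_def q_def by (rule jet2_cmult[OF jet2_comp[OF A B]])
  qed
  have eq: "(logabs :: complex^'m \<Rightarrow> real^'m) = (\<lambda>w. \<Sum>j\<in>UNIV. ((1/2) * ln ((norm (w $ j))\<^sup>2)) *\<^sub>R axis j (1::real))"
  proof (rule ext)
    fix w :: "complex^'m"
    \<comment> \<open>Zero coordinates are covered by the convention
      \<open>ln 0 = 0\<close>.\<close>
    have "(1/2) * ln ((norm (w $ j))\<^sup>2) = ln (norm (w $ j))" for j
      by (cases "w $ j = 0") (auto simp: ln_realpow)
    then show "logabs w = (\<Sum>j\<in>UNIV. ((1/2) * ln ((norm (w $ j))\<^sup>2)) *\<^sub>R axis j (1::real))"
      using basis_expansion[of "logabs w"] by (simp add: logabs_def scalar_mult_eq_scaleR)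
  qed
  have comp: "(\<Sum>j\<in>UNIV. g j *\<^sub>R axis j (1::real)) $ i = g i" for g :: "'m \<Rightarrow> real" and i
    by (simp add: axis_def if_distrib cong: if_cong)
  show ?thesis
  proof (rule that[of "\<lambda>v. \<Sum>j\<in>UNIV. p j v *\<^sub>R axis j 1" "\<lambda>v. \<Sum>j\<in>UNIV. q j v *\<^sub>R axis j 1"])
    show "jet2 logabs w (\<lambda>v. \<Sum>j\<in>UNIV. p j v *\<^sub>R axis j 1) (\<lambda>v. \<Sum>j\<in>UNIV. q j v *\<^sub>R axis j 1)"
      unfolding eq by (intro jet2_sum jet2_scaleR_left j1) auto
    fix \<gamma> :: "'m \<Rightarrow> complex" and j
    have i: "w $ j \<bullet> (w $ j * \<gamma> j) = r j * Re (\<gamma> j)"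
    proof -
      have "r j = (Re (w $ j))\<^sup>2 + (Im (w $ j))\<^sup>2" by (simp add: r_def cmod_power2)
      then show ?thesis by (simp add: inner_complex_def algebra_simps power2_eq_square)
    qed
    show "(\<Sum>j\<in>UNIV. p j (\<chi> j. w $ j * \<gamma> j) *\<^sub>R axis j 1) $ j = Re (\<gamma> j)"
      unfolding comp using r[of j] by (simp add: p_def i)
    have n: "(norm (w $ j * \<gamma> j))\<^sup>2 = r j * ((Re (\<gamma> j))\<^sup>2 + (Im (\<gamma> j))\<^sup>2)"
      by (simp add: norm_mult power_mult_distrib r_def cmod_power2)
    have "q j (\<chi> j. w $ j * \<gamma> j) = (Re (\<gamma> j))\<^sup>2 + (Im (\<gamma> j))\<^sup>2 - 2 * (Re (\<gamma> j))\<^sup>2"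
      unfolding q_def vec_lambda_beta i n using r[of j] by (simp add: field_simps power2_eq_square)
    then show "(\<Sum>j\<in>UNIV. q j (\<chi> j. w $ j * \<gamma> j) *\<^sub>R axis j 1) $ j = - Re (\<gamma> j * \<gamma> j)"
      unfolding comp by (simp add: power2_eq_square)
  qed
qed

text \<open>The test function is pulled back by \<open>(z, w) \<mapsto> (z, ln |w|)\<close>; by
  invariance \<open>f\<close> is unchanged when the coordinates of \<open>w\<close> are replaced by
  their moduli. The chain rule adds \<open>P\<close> applied to the second derivative of
  \<open>logabs\<close>, and this term cancels between a direction and its
  \<open>\<i>\<close>-multiple.\<close>

lemma touches_log:
  assumes W: "open W" "orbit_closed W" and f: "orbit_invariant W f"
    and z: "(z, cexp s) \<in> W" and t: "touches (\<lambda>x. f (fst x, cexp (snd x))) (z, s) \<phi>" and J: "jet2 \<phi> (z, s) P Q"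
  obtains \<Phi> PP QQ where "touches f (z, cexp s) \<Phi>" "jet2 \<Phi> (z, cexp s) PP QQ"
    "\<forall>v \<gamma>. PP (v, \<chi> j. cexp s $ j * \<gamma> j) = P (v, \<chi> j. Re (\<gamma> j))"
    "\<forall>v \<gamma>. QQ (v, \<chi> j. cexp s $ j * \<gamma> j) + QQ (\<i> *s v, \<i> *s (\<chi> j. cexp s $ j * \<gamma> j))
       = Q (v, \<chi> j. Re (\<gamma> j)) + Q (\<i> *s v, \<chi> j. Re (\<i> * \<gamma> j))"
proof -
  let ?w = "cexp s"
  have w: "?w $ j \<noteq> 0" for j by (simp add: cexp_def)
  obtain Pl Ql where l: "jet2 logabs ?w Pl Ql" "\<And>\<gamma> j. Pl (\<chi> j. ?w $ j * \<gamma> j) $ j = Re (\<gamma> j)"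
    "\<And>\<gamma> j. Ql (\<chi> j. ?w $ j * \<gamma> j) $ j = - Re (\<gamma> j * \<gamma> j)"
    using jet2_logabs[of ?w] w by blast
  define m where "m = (\<lambda>x::(complex^'a) \<times> (complex^'b). (fst x, 0) + (0, logabs (snd x)))"
  have m1: "jet2 (\<lambda>x::(complex^'a) \<times> (complex^'b). (fst x, 0::real^'b)) (z, ?w) (\<lambda>v. (fst v, 0)) (\<lambda>v. 0)"
    by (rule jet2_linear) (auto simp: linear_iff)
  have "jet2 (\<lambda>x::(complex^'a) \<times> (complex^'b). logabs (snd x)) (z, ?w) (\<lambda>v. Pl (snd v)) (\<lambda>v. Ql (snd v))"
    by (rule jet2_comp_linear[OF _ linear_snd]) (simp add: l(1))
  then have m2: "jet2 (\<lambda>x::(complex^'a) \<times> (complex^'b). (0::complex^'a, logabs (snd x))) (z, ?w) (\<lambda>v. (0, Pl (snd v))) (\<lambda>v. (0, Ql (snd v)))"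
    by (rule jet2_linear_left) (auto simp: linear_iff)
  have jm: "jet2 m (z, ?w) (\<lambda>v. (fst v, 0) + (0, Pl (snd v))) (\<lambda>v. 0 + (0, Ql (snd v)))"
    unfolding m_def by (rule jet2_add[OF m1 m2])
  have mz: "m (z, ?w) = (z, s)" by (simp add: m_def)
  have P: "linear P" using J by (simp add: jet2_def)
  define PP where "PP = (\<lambda>v. P ((fst v, 0) + (0, Pl (snd v))))"
  define QQ where "QQ = (\<lambda>v. P (0 + (0, Ql (snd v))) + Q ((fst v, 0) + (0, Pl (snd v))))"
  have jP: "jet2 (\<lambda>x. \<phi> (m x)) (z, ?w) PP QQ"
    unfolding PP_def QQ_def by (rule jet2_comp[OF jm]) (simp add: mz J)
  have Pl: "Pl (\<chi> j. ?w $ j * \<gamma> j) = (\<chi> j. Re (\<gamma> j))" for \<gamma> using l(2) by (simp add: vec_eq_iff)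
  have ig: "\<i> *s (\<chi> j. ?w $ j * \<gamma> j) = (\<chi> j. ?w $ j * (\<i> * \<gamma> j))" for \<gamma> by (simp add: vec_eq_iff mult_ac)
  have Ql: "Ql (\<chi> j. ?w $ j * \<gamma> j) + Ql (\<chi> j. ?w $ j * (\<i> * \<gamma> j)) = 0" for \<gamma>
    using l(3)[of \<gamma>] l(3)[of "\<lambda>j. \<i> * \<gamma> j"] by (simp add: vec_eq_iff)
  have "touches f (z, ?w) (\<lambda>x. \<phi> (m x))"
  proof -
    have oU: "open {x :: (complex^'a) \<times> (complex^'b). \<forall>j. snd x $ j \<noteq> 0}"
    proof -
      have "{x :: (complex^'a) \<times> (complex^'b). \<forall>j. snd x $ j \<noteq> 0} = (\<Inter>j. {x. snd x $ j \<noteq> 0})" by auto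
      moreover have "open {x :: (complex^'a) \<times> (complex^'b). snd x $ j \<noteq> 0}" for j
        by (intro open_Collect_neq continuous_intros)
      ultimately show ?thesis by (auto intro!: open_INT)
    qed
    have "continuous_on {x :: (complex^'a) \<times> (complex^'b). \<forall>j. snd x $ j \<noteq> 0} m"
      unfolding m_def logabs_def by (intro continuous_intros) auto
    then have "isCont m (z, ?w)"
      using w unfolding continuous_on_eq_continuous_at[OF oU] by auto
    then have "filterlim m (nhds (m (z, ?w))) (nhds (z, ?w))"
      unfolding isCont_def using tendsto_at_iff_tendsto_nhds by blast
    then have lim: "filterlim m (nhds (z, s)) (nhds (z, ?w))" unfolding mz .
    have "\<forall>\<^sub>F y in nhds (z, s). f (fst y, cexp (snd y)) \<le> f (z, ?w) + ereal (\<phi> y - \<phi> (z, s))"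
      using t unfolding touches_def by simp
    then have ev1: "\<forall>\<^sub>F x in nhds (z, ?w). f (fst (m x), cexp (snd (m x))) \<le> f (z, ?w) + ereal (\<phi> (m x) - \<phi> (z, s))"
      using lim unfolding filterlim_iff by blast
    have "open (W \<inter> {x. \<forall>j. snd x $ j \<noteq> 0})" by (rule open_Int[OF W(1) oU])
    then have ev2: "\<forall>\<^sub>F x in nhds (z, ?w). x \<in> W \<inter> {x. \<forall>j. snd x $ j \<noteq> 0}"
      by (rule eventually_nhds_in_open) (use z w in auto)
    show ?thesis unfolding touches_def
    proof
      show "\<bar>f (z, ?w)\<bar> \<noteq> \<infinity>" using t unfolding touches_def by simp
      show "\<forall>\<^sub>F x in nhds (z, ?w). f x \<le> f (z, ?w) + ereal (\<phi> (m x) - \<phi> (m (z, ?w)))"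
        using ev1 ev2
      proof eventually_elim
        case (elim x)
        have "f (fst x, cexp (logabs (snd x))) = f (fst x, snd x)"
        proof -
          have "(fst x, snd x) \<in> W" "same_modulus (snd x) (cexp (logabs (snd x)))"
            using elim(2) by (auto intro: same_modulus_cexp_logabs)
          then show ?thesis using f unfolding orbit_invariant_def by blast
        qed
        then show ?case using elim(1) unfolding mz by (simp add: m_def)
      qed
    qed
  qed
  moreover have "PP (v, \<chi> j. ?w $ j * \<gamma> j) = P (v, \<chi> j. Re (\<gamma> j))" for v \<gamma> by (simp add: PP_def Pl)
  moreover have "QQ (v, \<chi> j. ?w $ j * \<gamma> j) + QQ (\<i> *s v, \<i> *s (\<chi> j. ?w $ j * \<gamma> j))
       = Q (v, \<chi> j. Re (\<gamma> j)) + Q (\<i> *s v, \<chi> j. Re (\<i> * \<gamma> j))" for v \<gamma>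
  proof -
    have "P (0, Ql (\<chi> j. ?w $ j * \<gamma> j)) + P (0, Ql (\<chi> j. ?w $ j * (\<i> * \<gamma> j))) = P 0"
      unfolding linear_add[OF P, symmetric] add_Pair Ql by (simp add: zero_prod_def)
    then show ?thesis unfolding ig by (simp add: QQ_def Pl linear_0[OF P])
  qed
  ultimately show ?thesis using that[OF _ jP] by blast
qed

lemma graph_sub_log:
  assumes W: "open W" "orbit_closed W" and f: "orbit_invariant W f" and sub: "cgraph_sub ss b a c W f"
  shows "graph_sub (complex_directions ss) b a c (log_set W) (\<lambda>x. f (fst x, cexp (snd x)))"
  unfolding graph_sub_def
proof (intro ballI allI impI)
  fix x \<phi> P Q and \<Gamma> :: "complex^'a \<Rightarrow> real^'b"
  assume x: "x \<in> log_set W" and t: "touches (\<lambda>x. f (fst x, cexp (snd x))) x \<phi>" and J: "jet2 \<phi> x P Q" and \<Gamma>: "linear \<Gamma>"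
  obtain z s where xz: "x = (z, s)" by (cases x)
  have zW: "(z, cexp s) \<in> W" using x by (simp add: log_set_def xz)
  obtain \<Phi> PP QQ where \<Phi>: "touches f (z, cexp s) \<Phi>" "jet2 \<Phi> (z, cexp s) PP QQ"
    "\<forall>v \<gamma>. PP (v, \<chi> j. cexp s $ j * \<gamma> j) = P (v, \<chi> j. Re (\<gamma> j))"
    "\<forall>v \<gamma>. QQ (v, \<chi> j. cexp s $ j * \<gamma> j) + QQ (\<i> *s v, \<i> *s (\<chi> j. cexp s $ j * \<gamma> j))
       = Q (v, \<chi> j. Re (\<gamma> j)) + Q (\<i> *s v, \<chi> j. Re (\<i> * \<gamma> j))"
    by (rule touches_log[OF W f zW t[unfolded xz] J[unfolded xz]])
  \<comment> \<open>\<open>\<gamma> v = \<Gamma> v - \<i> \<Gamma> (\<i> v)\<close> is the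
    complex-linear map with real part \<open>\<Gamma>\<close>. The factor \<open>cexp s $ j\<close>
    in \<open>G\<close> converts logarithmic directions into directions at
    \<open>cexp s\<close>.\<close>
  define \<gamma> where "\<gamma> = (\<lambda>v j. Complex (\<Gamma> v $ j) (- \<Gamma> (\<i> *s v) $ j))"
  define G :: "complex^'a^'b" where "G = (\<chi> j k. cexp s $ j * \<gamma> (axis k 1) j)"
  have G: "G *v v = (\<chi> j. cexp s $ j * \<gamma> v j)" for v
  proof -
    have L: "linear (\<lambda>v. \<gamma> v j)" for j
      unfolding \<gamma>_def
      by (auto simp: linear_iff complex_eq_iff linear_add[OF \<Gamma>] linear_cmul[OF \<Gamma>]
          linear_add[OF linear_ii] linear_cmul[OF linear_ii])
    have C: "\<gamma> (\<i> *s v) j = \<i> * \<gamma> v j" for v j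
    proof -
      have "\<i> *s (\<i> *s v) = - v" by (simp add: vec_eq_iff mult.assoc[symmetric])
      then show ?thesis by (simp add: \<gamma>_def complex_eq_iff linear_neg[OF \<Gamma>])
    qed
    have Cc: "\<gamma> (y *s v) j = y * \<gamma> v j" for y v j
    proof -
      have "y *s v = Re y *\<^sub>R v + Im y *\<^sub>R (\<i> *s v)" by (simp add: vec_eq_iff complex_eq_iff)
      then show ?thesis by (simp add: linear_add[OF L] linear_cmul[OF L] C) (simp add: complex_eq_iff)
    qed
    have "\<gamma> v j = (\<Sum>k\<in>UNIV. v $ k * \<gamma> (axis k 1) j)" for j
    proof -
      have "\<gamma> v j = \<gamma> (\<Sum>k\<in>UNIV. v $ k *s axis k 1) j" by (simp only: basis_expansion)
      also have "\<dots> = (\<Sum>k\<in>UNIV. \<gamma> (v $ k *s axis k 1) j)" by (rule linear_sum[OF L])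
      finally show ?thesis by (simp add: Cc)
    qed
    then show ?thesis by (simp add: G_def matrix_vector_mult_def vec_eq_iff sum_distrib_left mult_ac)
  qed
  have Re\<gamma>: "(\<chi> j. Re (\<gamma> v j)) = \<Gamma> v" "(\<chi> j. Re (\<i> * \<gamma> v j)) = \<Gamma> (\<i> *s v)" for v by (auto simp: \<gamma>_def vec_eq_iff)
  have "c \<le> (\<Sum>s'\<leftarrow>ss. (QQ (s', G *v s') + QQ (\<i> *s s', \<i> *s (G *v s'))) / 2) + PP (b, G *v b) - a * real_of_ereal (f (z, cexp s))"
    using sub zW \<Phi>(1,2) unfolding cgraph_sub_def by blast
  also have "\<dots> = (\<Sum>s'\<leftarrow>ss. (Q (s', \<Gamma> s') + Q (\<i> *s s', \<Gamma> (\<i> *s s'))) / 2) + P (b, \<Gamma> b) - a * real_of_ereal (f (z, cexp s))"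
    unfolding G \<Phi>(3)[rule_format] \<Phi>(4)[rule_format] Re\<gamma> ..
  also have "(\<Sum>s'\<leftarrow>ss. (Q (s', \<Gamma> s') + Q (\<i> *s s', \<Gamma> (\<i> *s s'))) / 2) = (\<Sum>s'\<leftarrow>complex_directions ss. Q (s', \<Gamma> s'))"
    using J \<Gamma> by (simp add: sum_complex_directions jet2_def)
  finally show "c \<le> (\<Sum>s'\<leftarrow>complex_directions ss. Q (s', \<Gamma> s')) + P (b, \<Gamma> b) - a * real_of_ereal (f (fst x, cexp (snd x)))"
    by (simp add: xz)
qed

lemma fibre_sub_log:
  assumes W: "open W" "orbit_closed W" and f: "orbit_invariant W f" and sub: "cfibre_sub W f"
  shows "fibre_sub (log_set W) (\<lambda>x. f (fst x, cexp (snd x)))"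
  unfolding fibre_sub_def
proof (intro ballI allI impI)
  fix x \<phi> P Q and \<sigma> :: "real^'b"
  assume x: "x \<in> log_set W" and t: "touches (\<lambda>x. f (fst x, cexp (snd x))) x \<phi>" and J: "jet2 \<phi> x P Q"
  obtain z s where xz: "x = (z, s)" by (cases x)
  have zW: "(z, cexp s) \<in> W" using x by (simp add: log_set_def xz)
  obtain \<Phi> PP QQ where \<Phi>: "touches f (z, cexp s) \<Phi>" "jet2 \<Phi> (z, cexp s) PP QQ" and
    "\<forall>v \<gamma>. PP (v, \<chi> j. cexp s $ j * \<gamma> j) = P (v, \<chi> j. Re (\<gamma> j))" and \<Phi>3: "\<forall>v \<gamma>. QQ (v, \<chi> j. cexp s $ j * \<gamma> j) + QQ (\<i> *s v, \<i> *s (\<chi> j. cexp s $ j * \<gamma> j))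
       = Q (v, \<chi> j. Re (\<gamma> j)) + Q (\<i> *s v, \<chi> j. Re (\<i> * \<gamma> j))"
    by (rule touches_log[OF W f zW t[unfolded xz] J[unfolded xz]])
  \<comment> \<open>A real logarithmic direction: its \<open>\<i>\<close>-multiple is tangent to the
    orbit and maps to 0 in the real coordinates, so only \<open>Q (0, \<sigma>)\<close>
    survives.\<close>
  define \<eta> where "\<eta> = (\<chi> j. cexp s $ j * of_real (\<sigma> $ j))"
  have "0 \<le> QQ (0, \<eta>) + QQ (0, \<i> *s \<eta>)" using sub zW \<Phi>(1,2) unfolding cfibre_sub_def by blast
  moreover have "\<i> *s (0 :: complex^'a) = 0" by (simp add: vec_eq_iff)
  ultimately have "0 \<le> Q (0, \<chi> j. \<sigma> $ j) + Q (0, \<chi> j. 0)"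
    using \<Phi>3[rule_format, of 0 "\<lambda>j. of_real (\<sigma> $ j)"] by (simp add: \<eta>_def)
  moreover have "Q (0, \<chi> j. 0) = 0"
    using quadform_zero[of Q] J by (simp add: jet2_def zero_vec_def[symmetric] zero_prod_def[symmetric])
  ultimately show "0 \<le> Q (0, \<sigma>)" by simp
qed

section \<open>Symmetrization over the torus\<close>

lemma same_modulus_refl [simp]: "same_modulus w w"
  by (simp add: same_modulus_def)

lemma same_modulus_sym: "same_modulus w w' \<Longrightarrow> same_modulus w' w"
  by (simp add: same_modulus_def)

lemma same_modulus_torus_act: "same_modulus w (torus_act \<theta> w)"
  by (simp add: same_modulus_def torus_act_def norm_mult)

lemma torus_act_inverse [simp]: "torus_act (- \<theta>) (torus_act \<theta> w) = w"
  by (simp add: torus_act_def vec_eq_iff mult.assoc[symmetric] cis_mult)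

lemma linear_torus_act: "linear (torus_act \<theta>)"
  by (auto simp: linear_iff torus_act_def vec_eq_iff algebra_simps)

lemma compact_orbit: "compact {w'. same_modulus w w'}" for w :: "complex^'m"
  unfolding compact_eq_bounded_closed
proof
  show "bounded {w'. same_modulus w w'}" unfolding bounded_iff
  proof (intro exI ballI)
    fix w' assume "w' \<in> {w'. same_modulus w w'}"
    then show "norm w' \<le> norm w"
      by (intro norm_le_componentwise_cart) (simp add: same_modulus_def)
  qed
  have "{w'. same_modulus w w'} = {w'. \<forall>j. norm (w $ j) = norm (w' $ j)}" by (simp add: same_modulus_def)
  moreover have "closed {w'. \<forall>j. norm (w $ j) = norm (w' $ j)}"
    by (intro closed_Collect_all closed_Collect_eq continuous_intros)
  ultimately show "closed {w'. same_modulus w w'}" by simp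
qed

text \<open>Combine the moduli of \<open>w\<close> with the arguments of \<open>w1\<close>, using
  argument 0 where \<open>w1\<close> vanishes. In each coordinate the distance to \<open>w1\<close>
  is then the difference of the moduli of \<open>w\<close> and \<open>w0\<close>, which the triangle
  inequality bounds.\<close>

lemma orbit_near:
  fixes w w0 w1 :: "complex^'m"
  assumes "same_modulus w0 w1"
  obtains w' where "same_modulus w w'" "norm (w' - w1) \<le> norm (w - w0)"
proof
  define w' where "w' = (\<chi> j. if w1 $ j = 0 then of_real (norm (w $ j)) else w1 $ j * of_real (norm (w $ j) / norm (w1 $ j)))"
  show "same_modulus w w'" by (simp add: same_modulus_def w'_def norm_mult norm_divide)
  show "norm (w' - w1) \<le> norm (w - w0)"
  proof (rule norm_le_componentwise_cart)
    fix j
    have "norm ((w' - w1) $ j) = \<bar>norm (w $ j) - norm (w1 $ j)\<bar>"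
    proof (cases "w1 $ j = 0")
      case False
      have "(w' - w1) $ j = w1 $ j * of_real (norm (w $ j) / norm (w1 $ j) - 1)"
        using False by (simp add: w'_def algebra_simps)
      then have "norm ((w' - w1) $ j) = norm (w1 $ j) * \<bar>norm (w $ j) / norm (w1 $ j) - 1\<bar>"
        by (simp only: norm_mult norm_of_real)
      also have "\<dots> = \<bar>norm (w1 $ j) * (norm (w $ j) / norm (w1 $ j) - 1)\<bar>" by (simp add: abs_mult)
      also have "norm (w1 $ j) * (norm (w $ j) / norm (w1 $ j) - 1) = norm (w $ j) - norm (w1 $ j)"
        using False by (simp add: field_simps)
      finally show ?thesis .
    qed (simp add: w'_def)
    also have "\<dots> = \<bar>norm (w $ j) - norm (w0 $ j)\<bar>" using assms by (simp add: same_modulus_def)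
    also have "\<dots> \<le> norm ((w - w0) $ j)" by (simp add: norm_triangle_ineq3)
    finally show "norm ((w' - w1) $ j) \<le> norm ((w - w0) $ j)" .
  qed
qed

text \<open>The given exhaustion need not be invariant under the torus. The supremum over the
  compact orbit is; it lies above \<open>u\<close>, hence is still exhaustive, and it inherits the
  viscosity inequalities because it is attained.\<close>

definition orbit_sup :: "((complex^'n) \<times> (complex^'m) \<Rightarrow> real) \<Rightarrow> (complex^'n) \<times> (complex^'m) \<Rightarrow> real" where
  "orbit_sup u x = (SUP w'\<in>{w'. same_modulus (snd x) w'}. u (fst x, w'))"

lemma orbit_sup_attained:
  assumes u: "continuous_on W u" and W: "orbit_closed W" and z: "(z, w) \<in> W"
  obtains w' where "same_modulus w w'" "orbit_sup u (z, w) = u (z, w')"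
    "\<And>w''. same_modulus w w'' \<Longrightarrow> u (z, w'') \<le> u (z, w')"
proof -
  let ?O = "{w'. same_modulus w w'}"
  have "continuous_on ?O (\<lambda>w'. u (z, w'))"
    by (rule continuous_on_compose2[OF u]) (use W z in \<open>auto simp: orbit_closed_def intro!: continuous_intros\<close>)
  moreover have "w \<in> ?O" by simp
  ultimately obtain w' where w': "w' \<in> ?O" "\<forall>w''\<in>?O. u (z, w'') \<le> u (z, w')"
    using continuous_attains_sup[OF compact_orbit[of w]] by blast
  have "orbit_sup u (z, w) = u (z, w')" unfolding orbit_sup_def fst_conv snd_conv
    by (rule cSup_eq_maximum) (use w' in auto)
  then show ?thesis using that w' by blast
qed

lemma orbit_sup_ge:
  assumes "continuous_on W u" "orbit_closed W" "(z, w) \<in> W" "same_modulus w w'"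
  shows "u (z, w') \<le> orbit_sup u (z, w)"
  using orbit_sup_attained[OF assms(1-3)] assms(4) by metis

lemma orbit_sup_invariant: "orbit_invariant W (orbit_sup u)"
proof -
  have "{w''. same_modulus w' w''} = {w''. same_modulus w w''}" if "same_modulus w w'" for w w' :: "complex^'b"
    using that by (auto simp: same_modulus_def)
  then show ?thesis by (simp add: orbit_invariant_def orbit_sup_def)
qed

text \<open>From below, \<open>orbit_near\<close> moves a maximizer over \<open>x0\<close> to the
  orbit of a nearby point. From above, \<open>u < a\<close> holds on a uniform neighbourhood of the
  compact orbit, and nearby orbits lie in it.\<close>

lemma continuous_on_orbit_sup:
  assumes W: "open W" "orbit_closed W" and u: "continuous_on W u"
  shows "continuous_on W (orbit_sup u)"
  unfolding continuous_on_eq_continuous_at[OF W(1)]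
proof
  fix x0 assume x0: "x0 \<in> W"
  obtain z0 w0 where xzw: "x0 = (z0, w0)" by (cases x0)
  let ?v = "orbit_sup u"
  show "isCont ?v x0" unfolding isCont_def
  proof (rule order_tendstoI)
    fix a assume a: "a < ?v x0"
    obtain w1 where w1: "same_modulus w0 w1" "?v x0 = u (z0, w1)"
      using orbit_sup_attained[OF u W(2), of z0 w0] x0 unfolding xzw by metis
    have w1W: "(z0, w1) \<in> W" using W(2) x0 w1 unfolding xzw orbit_closed_def by blast
    have "isCont u (z0, w1)" using u w1W unfolding continuous_on_eq_continuous_at[OF W(1)] by blast
    then have "\<forall>\<^sub>F x in nhds (z0, w1). a < u x"
      using a w1(2) unfolding isCont_def tendsto_at_iff_tendsto_nhds by (auto dest: order_tendstoD(1))
    then obtain d where d: "d > 0" "\<And>x. dist x (z0, w1) < d \<Longrightarrow> a < u x" unfolding eventually_nhds_metric by blast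
    have "\<forall>\<^sub>F x in nhds x0. x \<in> W" using W(1) x0 by (rule eventually_nhds_in_open)
    moreover have "\<forall>\<^sub>F x in nhds x0. dist x x0 < d" using d(1) unfolding eventually_nhds_metric by blast
    ultimately have "\<forall>\<^sub>F x in nhds x0. a < ?v x"
    proof eventually_elim
      case (elim x)
      obtain z w where x: "x = (z, w)" by (cases x)
      obtain w' where w': "same_modulus w w'" "norm (w' - w1) \<le> norm (w - w0)" using orbit_near[OF w1(1)] by blast
      have "dist (z, w') (z0, w1) \<le> dist (z, w) (z0, w0)"
        unfolding dist_Pair_Pair using w'(2) by (simp add: dist_norm power_mono)
      then have "a < u (z, w')" using elim by (intro d(2)) (simp add: x xzw)
      also have "\<dots> \<le> ?v x" unfolding x by (rule orbit_sup_ge[OF u W(2) _ w'(1)]) (use elim x in simp)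
      finally show ?case .
    qed
    then show "\<forall>\<^sub>F x in at x0. a < ?v x" using eventually_nhds_conv_at by blast
  next
    fix a assume a: "?v x0 < a"
    define C where "C = {z0} \<times> {w'. same_modulus w0 w'}"
    have C: "compact C" unfolding C_def by (intro compact_Times compact_orbit) auto
    have oT: "open {x \<in> W. ereal (u x) < ereal a}" by (rule open_sublevel[OF W(1) continuous_imp_usc_on[OF u]])
    have "C \<subseteq> {x \<in> W. ereal (u x) < ereal a}"
    proof
      fix x assume "x \<in> C"
      then obtain w' where x: "x = (z0, w')" "same_modulus w0 w'" by (auto simp: C_def)
      then have "x \<in> W" using W(2) x0 unfolding orbit_closed_def xzw by blast
      moreover have "u x \<le> ?v x0" unfolding x(1) xzw by (rule orbit_sup_ge[OF u W(2) _ x(2)]) (use x0 xzw in simp)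
      ultimately show "x \<in> {x \<in> W. ereal (u x) < ereal a}" using a by simp
    qed
    then obtain e where e: "e > 0" "(\<Union>x\<in>C. cball x e) \<subseteq> {x \<in> W. ereal (u x) < ereal a}"
      using compact_subset_open_imp_cball_epsilon_subset[OF C oT] by blast
    have "\<forall>\<^sub>F x in nhds x0. x \<in> W" using W(1) x0 by (rule eventually_nhds_in_open)
    moreover have "\<forall>\<^sub>F x in nhds x0. dist x x0 < e" using e(1) unfolding eventually_nhds_metric by blast
    ultimately have "\<forall>\<^sub>F x in nhds x0. ?v x < a"
    proof eventually_elim
      case (elim x)
      obtain z w where x: "x = (z, w)" by (cases x)
      obtain w' where w': "same_modulus w w'" "?v x = u (z, w')"
        using orbit_sup_attained[OF u W(2), of z w] elim unfolding x by metis
      obtain w'' where w'': "same_modulus w0 w''" "norm (w'' - w') \<le> norm (w0 - w)" using orbit_near[OF w'(1)] by blast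
      have "dist (z0, w'') (z, w') \<le> dist (z0, w0) (z, w)"
        unfolding dist_Pair_Pair using w''(2) by (simp add: dist_norm power_mono)
      also have "\<dots> < e" using elim by (simp add: x xzw dist_commute)
      finally have "(z, w') \<in> cball (z0, w'') e" by simp
      moreover have "(z0, w'') \<in> C" using w'' by (simp add: C_def)
      ultimately have "(z, w') \<in> {x \<in> W. ereal (u x) < ereal a}" using e(2) by blast
      then show ?case using w'(2) by simp
    qed
    then show "\<forall>\<^sub>F x in at x0. ?v x < a" using eventually_nhds_conv_at by blast
  qed
qed

lemma compact_sublevel_orbit_sup:
  assumes W: "open W" "orbit_closed W" and u: "continuous_on W u" and comp: "compact {x \<in> W. u x \<le> K}"
  shows "compact {x \<in> W. orbit_sup u x \<le> K}"
proof -
  define C where "C = {x \<in> W. u x \<le> K}"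
  have "continuous_on C (orbit_sup u)"
    by (rule continuous_on_subset[OF continuous_on_orbit_sup[OF W u]]) (auto simp: C_def)
  then have "closedin (top_of_set C) (C \<inter> orbit_sup u -` {..K})"
    by (intro continuous_closedin_preimage) auto
  then have "compact (C \<inter> orbit_sup u -` {..K})" using comp closedin_compact unfolding C_def by blast
  moreover have "u x \<le> orbit_sup u x" if "x \<in> W" for x
    using orbit_sup_ge[OF u W(2), of "fst x" "snd x" "snd x"] that by simp
  then have "C \<inter> orbit_sup u -` {..K} = {x \<in> W. orbit_sup u x \<le> K}" unfolding C_def by force
  ultimately show ?thesis by simp
qed

text \<open>At the rotation \<open>\<theta>\<close> realizing the supremum, \<open>u\<close> is
  dominated by \<open>orbit_sup u\<close> composed with the inverse rotation, with equality at the
  point; a test function for the supremum becomes one for \<open>u\<close> after rotation.\<close>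

lemma touches_orbit_sup:
  assumes W: "open W" "orbit_closed W" and u: "continuous_on W u" and z: "(z, w) \<in> W"
    and t: "touches (\<lambda>x. ereal (orbit_sup u x)) (z, w) \<phi>" and J: "jet2 \<phi> (z, w) P Q"
  obtains \<theta> where "(z, torus_act \<theta> w) \<in> W" "orbit_sup u (z, w) = u (z, torus_act \<theta> w)"
    "touches (\<lambda>x. ereal (u x)) (z, torus_act \<theta> w) (\<lambda>x. \<phi> (fst x, torus_act (- \<theta>) (snd x)))"
    "jet2 (\<lambda>x. \<phi> (fst x, torus_act (- \<theta>) (snd x))) (z, torus_act \<theta> w)
       (\<lambda>v. P (fst v, torus_act (- \<theta>) (snd v))) (\<lambda>v. Q (fst v, torus_act (- \<theta>) (snd v)))"
proof -
  obtain w' where w': "same_modulus w w'" "orbit_sup u (z, w) = u (z, w')"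
    using orbit_sup_attained[OF u W(2) z] by metis
  obtain \<theta> where \<theta>: "w' = torus_act \<theta> w" using same_modulus_torus[OF w'(1)] by blast
  have w'W: "(z, w') \<in> W" using W(2) z w'(1) unfolding orbit_closed_def by blast
  let ?R = "\<lambda>x::(complex^'a) \<times> (complex^'b). (fst x, torus_act (- \<theta>) (snd x))"
  have R: "linear ?R"
    using linear_torus_act[of "- \<theta>"] by (auto simp: linear_iff)
  have Rw: "?R (z, w') = (z, w)" by (simp add: \<theta>)
  have "touches (\<lambda>x. ereal (orbit_sup u (?R x))) (z, w') (\<lambda>x. \<phi> (?R x))"
    by (rule touches_comp_linear[OF _ R]) (simp only: Rw t)
  then have "\<forall>\<^sub>F x in nhds (z, w'). orbit_sup u (?R x) \<le> orbit_sup u (z, w) + (\<phi> (?R x) - \<phi> (z, w))"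
    unfolding touches_real Rw .
  moreover have "\<forall>\<^sub>F x in nhds (z, w'). x \<in> W" using W(1) w'W by (rule eventually_nhds_in_open)
  ultimately have "\<forall>\<^sub>F x in nhds (z, w'). u x \<le> u (z, w') + (\<phi> (?R x) - \<phi> (?R (z, w')))"
  proof eventually_elim
    case (elim x)
    have sm: "same_modulus (torus_act (- \<theta>) (snd x)) (snd x)" by (rule same_modulus_sym[OF same_modulus_torus_act])
    have "(fst x, snd x) \<in> W" using elim by simp
    then have "?R x \<in> W" using W(2) same_modulus_torus_act unfolding orbit_closed_def by blast
    then have "u (fst x, snd x) \<le> orbit_sup u (?R x)" using orbit_sup_ge[OF u W(2) _ sm] by blast
    then show ?case using elim(1) unfolding Rw w'(2)[symmetric] by simp
  qed
  then have "touches (\<lambda>x. ereal (u x)) (z, w') (\<lambda>x. \<phi> (?R x))" unfolding touches_real .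
  moreover have "jet2 (\<lambda>x. \<phi> (?R x)) (z, w') (\<lambda>v. P (?R v)) (\<lambda>v. Q (?R v))"
    by (rule jet2_comp_linear[OF _ R]) (simp only: Rw J)
  ultimately show ?thesis using that[of \<theta>] w'W w'(2) unfolding \<theta> by blast
qed

lemma cgraph_sub_orbit_sup:
  assumes W: "open W" "orbit_closed W" and u: "continuous_on W u"
    and sub: "cgraph_sub ss b a c W (\<lambda>x. ereal (u x))"
  shows "cgraph_sub ss b a c W (\<lambda>x. ereal (orbit_sup u x))"
  unfolding cgraph_sub_def
proof (intro ballI allI impI)
  fix x \<phi> P Q and G :: "complex^'a^'b"
  assume x: "x \<in> W" and t: "touches (\<lambda>x. ereal (orbit_sup u x)) x \<phi>" and J: "jet2 \<phi> x P Q"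
  obtain z w where xzw: "x = (z, w)" by (cases x)
  obtain \<theta> where \<theta>: "(z, torus_act \<theta> w) \<in> W" "orbit_sup u (z, w) = u (z, torus_act \<theta> w)"
    "touches (\<lambda>x. ereal (u x)) (z, torus_act \<theta> w) (\<lambda>x. \<phi> (fst x, torus_act (- \<theta>) (snd x)))"
    "jet2 (\<lambda>x. \<phi> (fst x, torus_act (- \<theta>) (snd x))) (z, torus_act \<theta> w)
       (\<lambda>v. P (fst v, torus_act (- \<theta>) (snd v))) (\<lambda>v. Q (fst v, torus_act (- \<theta>) (snd v)))"
    by (rule touches_orbit_sup[OF W u x[unfolded xzw] t[unfolded xzw] J[unfolded xzw]])
  \<comment> \<open>Slopes rotate along: composition with a diagonal unitary stays complex-linear
    and cancels against the inverse rotation in the test function.\<close>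
  define G' :: "complex^'a^'b" where "G' = (\<chi> j k. cis (\<theta> $ j) * G $ j $ k)"
  have G': "G' *v s = torus_act \<theta> (G *v s)" for s
    by (simp add: G'_def torus_act_def matrix_vector_mult_def vec_eq_iff sum_distrib_left mult_ac)
  have i: "\<i> *s torus_act \<theta> y = torus_act \<theta> (\<i> *s y)" for y by (simp add: torus_act_def vec_eq_iff mult_ac)
  have "c \<le> (\<Sum>s\<leftarrow>ss. (Q (fst (s, G' *v s), torus_act (- \<theta>) (snd (s, G' *v s)))
      + Q (fst (\<i> *s s, \<i> *s (G' *v s)), torus_act (- \<theta>) (snd (\<i> *s s, \<i> *s (G' *v s))))) / 2)
      + P (fst (b, G' *v b), torus_act (- \<theta>) (snd (b, G' *v b))) - a * real_of_ereal (ereal (u (z, torus_act \<theta> w)))"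
    using sub \<theta>(1,3,4) unfolding cgraph_sub_def by blast
  then show "c \<le> (\<Sum>s\<leftarrow>ss. (Q (s, G *v s) + Q (\<i> *s s, \<i> *s (G *v s))) / 2) + P (b, G *v b)
      - a * real_of_ereal (ereal (orbit_sup u x))"
    unfolding G' i fst_conv snd_conv torus_act_inverse \<theta>(2)[symmetric] xzw[symmetric] .
qed

lemma cfibre_sub_orbit_sup:
  assumes W: "open W" "orbit_closed W" and u: "continuous_on W u"
    and sub: "cfibre_sub W (\<lambda>x. ereal (u x))"
  shows "cfibre_sub W (\<lambda>x. ereal (orbit_sup u x))"
  unfolding cfibre_sub_def
proof (intro ballI allI impI)
  fix x \<phi> P Q and y :: "complex^'b"
  assume x: "x \<in> W" and t: "touches (\<lambda>x. ereal (orbit_sup u x)) x \<phi>" and J: "jet2 \<phi> x P Q"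
  obtain z w where xzw: "x = (z, w)" by (cases x)
  obtain \<theta> where \<theta>: "(z, torus_act \<theta> w) \<in> W" "orbit_sup u (z, w) = u (z, torus_act \<theta> w)"
    "touches (\<lambda>x. ereal (u x)) (z, torus_act \<theta> w) (\<lambda>x. \<phi> (fst x, torus_act (- \<theta>) (snd x)))"
    "jet2 (\<lambda>x. \<phi> (fst x, torus_act (- \<theta>) (snd x))) (z, torus_act \<theta> w)
       (\<lambda>v. P (fst v, torus_act (- \<theta>) (snd v))) (\<lambda>v. Q (fst v, torus_act (- \<theta>) (snd v)))"
    by (rule touches_orbit_sup[OF W u x[unfolded xzw] t[unfolded xzw] J[unfolded xzw]])
  have i: "\<i> *s torus_act \<theta> y = torus_act \<theta> (\<i> *s y)" by (simp add: torus_act_def vec_eq_iff mult_ac)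
  have "0 \<le> Q (fst (0::complex^'a, torus_act \<theta> y), torus_act (- \<theta>) (snd (0::complex^'a, torus_act \<theta> y)))
      + Q (fst (0::complex^'a, \<i> *s torus_act \<theta> y), torus_act (- \<theta>) (snd (0::complex^'a, \<i> *s torus_act \<theta> y)))"
    using sub \<theta>(1,3,4) unfolding cfibre_sub_def by blast
  then show "0 \<le> Q (0, y) + Q (0, \<i> *s y)" unfolding i fst_conv snd_conv torus_act_inverse .
qed

section \<open>Fibres in logarithmic coordinates\<close>

lemma exp_between:
  fixes a b r c :: real
  assumes "0 \<le> p" "0 \<le> q" "p + q = 1" "\<bar>exp a - c\<bar> < r" "\<bar>exp b - c\<bar> < r"
  shows "\<bar>exp (p * a + q * b) - c\<bar> < r"
proof -
  have "min a b \<le> p * a + q * b" "p * a + q * b \<le> max a b"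
  proof -
    have "p * min a b + q * min a b \<le> p * a + q * b" using assms by (intro add_mono mult_left_mono) auto
    then show "min a b \<le> p * a + q * b" using assms(3) by (simp flip: distrib_right)
    have "p * a + q * b \<le> p * max a b + q * max a b" using assms by (intro add_mono mult_left_mono) auto
    then show "p * a + q * b \<le> max a b" using assms(3) by (simp flip: distrib_right)
  qed
  then have "exp (min a b) \<le> exp (p * a + q * b)" "exp (p * a + q * b) \<le> exp (max a b)" by auto
  moreover have "exp (min a b) = exp a \<or> exp (min a b) = exp b" "exp (max a b) = exp a \<or> exp (max a b) = exp b"
    by (auto simp: min_def max_def)
  ultimately show ?thesis using assms(4,5) by linarith
qed

lemma norm_cexp: "norm (cexp s $ j) = exp (s $ j)"
  by (simp add: cexp_def)

lemma norm_vec_le_sum: "norm x \<le> (\<Sum>j\<in>UNIV. norm (x $ j))"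
  unfolding norm_vec_def by (rule L2_set_le_sum) simp

text \<open>Deleting the coordinate hyperplanes and taking logarithms might disconnect the fibre, so
  a separation \<open>A\<close>, \<open>B\<close> is transported back to \<open>S\<close>. Around
  each \<open>w\<close>, also one with zero coordinates, the points with moduli within
  \<open>r\<close> of those of \<open>w\<close> have a convex nonempty logarithmic image, which for
  small \<open>r\<close> lies wholly in \<open>A\<close> or wholly in \<open>B\<close>. This splits
  \<open>S\<close> into the open sets \<open>V A\<close> and \<open>V B\<close>.\<close>

lemma connected_log_fibre:
  fixes S :: "(complex^'m) set"
  assumes S: "open S" "connected S" and orb: "\<And>w w'. w \<in> S \<Longrightarrow> same_modulus w w' \<Longrightarrow> w' \<in> S"
  shows "connected {s. cexp s \<in> S}"
proof (rule connectedI)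
  fix A B :: "(real^'m) set"
  let ?L = "{s. cexp s \<in> S}"
  assume A: "open A" and B: "open B" and neA: "A \<inter> ?L \<noteq> {}" and neB: "B \<inter> ?L \<noteq> {}"
    and dis: "A \<inter> B \<inter> ?L = {}" and cov: "?L \<subseteq> A \<union> B"
  define N where "N = (\<lambda>(w::complex^'m) r. {w' :: complex^'m. \<forall>j. \<bar>norm (w' $ j) - norm (w $ j)\<bar> < r})"
  have N_self: "w \<in> N w r" if "r > 0" for w r using that by (simp add: N_def)
  have N_open: "open (N w r)" for w r
  proof -
    have "N w r = (\<Inter>j. {w'. \<bar>norm (w' $ j) - norm (w $ j)\<bar> < r})" by (auto simp: N_def)
    moreover have "open {w' :: complex^'m. \<bar>norm (w' $ j) - norm (w $ j)\<bar> < r}" for j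
      by (intro open_Collect_less continuous_intros)
    ultimately show ?thesis by auto
  qed
  have N_half: "N w1 (r/2) \<subseteq> N w r" if w1: "w1 \<in> N w (r/2)" for w w1 r
  proof
    fix w' assume w': "w' \<in> N w1 (r/2)"
    have "\<bar>norm (w' $ j) - norm (w $ j)\<bar> < r" for j
    proof -
      have "\<bar>norm (w' $ j) - norm (w1 $ j)\<bar> < r/2" "\<bar>norm (w1 $ j) - norm (w $ j)\<bar> < r/2"
        using w' w1 by (auto simp: N_def)
      then show ?thesis by linarith
    qed
    then show "w' \<in> N w r" by (simp add: N_def)
  qed
  have N_sub: "\<exists>r>0. N w r \<subseteq> S" if w: "w \<in> S" for w
  proof -
    have "{w'. same_modulus w w'} \<subseteq> S" using orb w by blast
    then obtain e where e: "e > 0" "(\<Union>x\<in>{w'. same_modulus w w'}. cball x e) \<subseteq> S"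
      using compact_subset_open_imp_cball_epsilon_subset[OF compact_orbit S(1), of w] by blast
    \<comment> \<open>Moduli within \<open>r\<close> in each of the \<open>CARD('m)\<close>
      coordinates keep the norm distance at most \<open>e\<close>.\<close>
    define r where "r = e / real CARD('m)"
    have "N w r \<subseteq> S"
    proof
      fix w' assume w': "w' \<in> N w r"
      define w0 :: "complex^'m" where "w0 = (\<chi> j. of_real (norm (w' $ j) - norm (w $ j)))"
      define p :: "complex^'m" where "p = (\<chi> j. of_real (norm (w $ j)))"
      define p' :: "complex^'m" where "p' = (\<chi> j. of_real (norm (w' $ j)))"
      have "norm (p' - p) \<le> (\<Sum>j\<in>UNIV. norm ((p' - p) $ j))" by (rule norm_vec_le_sum)
      also have "\<dots> \<le> (\<Sum>j\<in>(UNIV::'m set). r)"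
      proof (rule sum_mono)
        fix j
        have "norm ((p' - p) $ j) = \<bar>norm (w' $ j) - norm (w $ j)\<bar>"
          unfolding p_def p'_def by (simp flip: of_real_diff)
        then show "norm ((p' - p) $ j) \<le> r" using w' by (simp add: N_def less_imp_le)
      qed
      also have "\<dots> = e" by (simp add: r_def)
      finally have "p' \<in> cball p e" by (simp add: dist_norm norm_minus_commute)
      moreover have "same_modulus w p" "same_modulus p' w'" by (auto simp: same_modulus_def p_def p'_def)
      ultimately have "p' \<in> S" using e(2) by blast
      then show "w' \<in> S" using orb \<open>same_modulus p' w'\<close> by blast
    qed
    then show ?thesis using e(1) by (intro exI[of _ r]) (simp add: r_def)
  qed
  have box: "convex {s. cexp s \<in> N w r}" for w r
  proof (rule convexI)
    fix s s' :: "real^'m" and p q :: real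
    assume s: "s \<in> {s. cexp s \<in> N w r}" "s' \<in> {s. cexp s \<in> N w r}" and p: "0 \<le> p" "0 \<le> q" "p + q = 1"
    have "\<bar>exp (p * s $ j + q * s' $ j) - norm (w $ j)\<bar> < r" for j
      by (rule exp_between[OF p]) (use s in \<open>auto simp: N_def cexp_def\<close>)
    then show "p *\<^sub>R s + q *\<^sub>R s' \<in> {s. cexp s \<in> N w r}" by (simp add: N_def cexp_def)
  qed
  have box_ne: "\<exists>s. cexp s \<in> N w r" if r: "r > 0" for w r
  proof (intro exI[of _ "\<chi> j. ln (norm (w $ j) + r/2)"])
    have "norm (w $ j) + r/2 > 0" for j using r by (simp add: add_nonneg_pos)
    then show "cexp (\<chi> j. ln (norm (w $ j) + r/2)) \<in> N w r" using r by (simp add: N_def norm_cexp)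
  qed
  define V where "V = (\<lambda>A. {w \<in> S. \<exists>r>0. N w r \<subseteq> S \<and> (\<forall>s. cexp s \<in> N w r \<longrightarrow> s \<in> A)})"
  have Vopen: "open (V A)" for A
    unfolding open_subopen[of "V A"]
  proof
    fix w assume "w \<in> V A"
    then obtain r where r: "r > 0" "N w r \<subseteq> S" "\<forall>s. cexp s \<in> N w r \<longrightarrow> s \<in> A" by (auto simp: V_def)
    have "N w (r/2) \<subseteq> V A"
    proof
      fix w1 assume w1: "w1 \<in> N w (r/2)"
      note h = N_half[OF w1]
      have "w1 \<in> N w1 (r/2)" using N_self r by simp
      then have "w1 \<in> S" using h r by blast
      then show "w1 \<in> V A" unfolding V_def using h r half_gt_zero[OF r(1)] by blast
    qed
    then show "\<exists>T. open T \<and> w \<in> T \<and> T \<subseteq> V A" using N_open N_self r by (meson half_gt_zero)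
  qed
  have cover: "w \<in> V A \<union> V B" if w: "w \<in> S" for w
  proof -
    obtain r where r: "r > 0" "N w r \<subseteq> S" using N_sub[OF w] by blast
    let ?K = "{s. cexp s \<in> N w r}"
    have K: "connected ?K" "?K \<subseteq> ?L" using convex_connected[OF box] r by auto
    then have "A \<inter> ?K = {} \<or> B \<inter> ?K = {}"
      using connectedD[OF K(1) A B] dis cov by blast
    then have "?K \<subseteq> B \<or> ?K \<subseteq> A" using K(2) cov by blast
    then show ?thesis using w r unfolding V_def by blast
  qed
  have Vdis: "V A \<inter> V B = {}"
  proof (rule ccontr)
    assume "V A \<inter> V B \<noteq> {}"
    then obtain w r1 r2 where w: "r1 > 0" "N w r1 \<subseteq> S" "\<forall>s. cexp s \<in> N w r1 \<longrightarrow> s \<in> A"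
      "r2 > 0" "\<forall>s. cexp s \<in> N w r2 \<longrightarrow> s \<in> B" by (auto simp: V_def)
    obtain s where s: "cexp s \<in> N w (min r1 r2)" using box_ne[of "min r1 r2" w] w by auto
    then have "cexp s \<in> N w r1" "cexp s \<in> N w r2" by (auto simp: N_def)
    then show False using w dis by blast
  qed
  have Vne: "V A \<inter> S \<noteq> {}" if ne: "A \<inter> ?L \<noteq> {}" "A \<inter> B \<inter> ?L = {}" "\<And>w. w \<in> S \<Longrightarrow> w \<in> V A \<union> V B" for A B
  proof -
    obtain s where s: "s \<in> A" "cexp s \<in> S" using ne by auto
    have "cexp s \<notin> V B"
    proof
      assume "cexp s \<in> V B"
      then have "s \<in> B" using N_self by (auto simp: V_def)
      then show False using ne(2) s by blast
    qed
    then show ?thesis using ne(3) s by blast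
  qed
  have "V A \<inter> S \<noteq> {}" by (rule Vne[OF neA dis cover])
  moreover have "V B \<inter> S \<noteq> {}" by (rule Vne[OF neB, of A]) (use dis cover in auto)
  ultimately show False
    using connectedD[OF S(2) Vopen[of A] Vopen[of B]] Vdis cover by blast
qed

lemma nonzero_dense:
  fixes z :: "complex^'n" and w :: "complex^'m"
  assumes O: "open T" and z: "(z, w) \<in> T"
  obtains w' where "(z, w') \<in> T" "\<And>j. w' $ j \<noteq> 0"
proof -
  obtain e where e: "e > 0" "ball (z, w) e \<subseteq> T" using O z open_contains_ball by blast
  define d where "d = e / (2 * real CARD('m))"
  have d: "d > 0" using e by (simp add: d_def)
  define w' :: "complex^'m" where "w' = (\<chi> j. if w $ j = 0 then of_real d else w $ j)"
  have "norm (w' - w) \<le> (\<Sum>j\<in>UNIV. norm ((w' - w) $ j))" by (rule norm_vec_le_sum)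
  also have "\<dots> \<le> (\<Sum>j\<in>(UNIV::'m set). d)" by (rule sum_mono) (use d in \<open>simp add: w'_def\<close>)
  also have "\<dots> = e/2" by (simp add: d_def)
  finally have "(z, w') \<in> ball (z, w) e" using e by (simp add: dist_Pair_Pair dist_norm norm_minus_commute)
  then show ?thesis using that[of w'] e d by (auto simp: w'_def)
qed

text \<open>Dropping the points with zero coordinates does not raise an infimum: by upper
  semicontinuity a strict upper bound at \<open>w\<close> persists at nearby points without zero
  coordinates, and invariance moves those to some \<open>cexp s\<close>.\<close>

lemma marg_log:
  fixes f :: "(complex^'n) \<times> (complex^'m) \<Rightarrow> ereal"
  assumes W: "open W" "orbit_closed W" and f: "orbit_invariant W f" "usc_on W f"
  shows "marg (log_set W) (\<lambda>x. f (fst x, cexp (snd x))) = marg W f" and "fst ` log_set W = fst ` W"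
proof -
  have approx: "\<exists>s. (z, cexp s) \<in> W \<and> f (z, cexp s) < a" if zw: "(z, w) \<in> W" "f (z, w) < a" for z w a
  proof -
    have "open {x \<in> W. f x < a}" by (rule open_sublevel[OF W(1) f(2)])
    moreover have "(z, w) \<in> {x \<in> W. f x < a}" using zw by simp
    ultimately obtain w' where w': "(z, w') \<in> {x \<in> W. f x < a}" "\<And>j. w' $ j \<noteq> 0" using nonzero_dense by blast
    then have "same_modulus w' (cexp (logabs w'))" by (intro same_modulus_cexp_logabs)
    then have "(z, cexp (logabs w')) \<in> W" "f (z, cexp (logabs w')) = f (z, w')"
      using W(2) f(1) w' unfolding orbit_closed_def orbit_invariant_def by blast+
    then show ?thesis using w' by (intro exI[of _ "logabs w'"]) auto
  qed
  show "marg (log_set W) (\<lambda>x. f (fst x, cexp (snd x))) = marg W f"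
  proof (rule ext, rule antisym)
    fix z
    show "marg W f z \<le> marg (log_set W) (\<lambda>x. f (fst x, cexp (snd x))) z"
      unfolding marg_def by (rule INF_mono) (auto simp: log_set_def)
    show "marg (log_set W) (\<lambda>x. f (fst x, cexp (snd x))) z \<le> marg W f z"
      unfolding marg_def
    proof (rule INF_greatest, rule dense_ge)
      fix w a assume "w \<in> {y. (z, y) \<in> W}" "f (z, w) < a"
      then obtain s where s: "(z, cexp s) \<in> W" "f (z, cexp s) < a" using approx by blast
      then show "(INF y\<in>{y. (z, y) \<in> log_set W}. f (fst (z, y), cexp (snd (z, y)))) \<le> a"
        by (intro INF_lower2[of s]) (auto simp: log_set_def)
    qed
  qed
  show "fst ` log_set W = fst ` W"
  proof (intro equalityI subsetI)
    fix z assume "z \<in> fst ` log_set W"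
    then obtain s where "(z, cexp s) \<in> W" by (auto simp: log_set_def)
    then show "z \<in> fst ` W" by force
  next
    fix z assume "z \<in> fst ` W"
    then obtain w where "(z, w) \<in> W" by auto
    then obtain w' where w': "(z, w') \<in> W" "\<And>j. w' $ j \<noteq> 0" using nonzero_dense[OF W(1)] by blast
    then have "(z, cexp (logabs w')) \<in> W"
      using W(2) same_modulus_cexp_logabs unfolding orbit_closed_def by blast
    then have "(z, logabs w') \<in> log_set W" by (simp add: log_set_def)
    then show "z \<in> fst ` log_set W" by force
  qed
qed

section \<open>The complex minimum principle\<close>

lemma orbit_invariant_ereal:
  assumes "orbit_invariant W v" shows "orbit_invariant W (\<lambda>x. ereal (v x))"
  unfolding orbit_invariant_def
proof (intro allI impI)
  fix z w w' assume "(z, w) \<in> W" "same_modulus w w'"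
  then have "v (z, w') = v (z, w)" using assms unfolding orbit_invariant_def by blast
  then show "ereal (v (z, w')) = ereal (v (z, w))" by (rule arg_cong)
qed

text \<open>As in the real case this serves both \<open>f\<close> and the exhaustion.
  \<open>v\<close> is already invariant, so both functions descend to logarithmic coordinates, where
  the real inequality for marginals applies with the doubled directions.\<close>

lemma complex_minimum_principle_aux:
  fixes F :: "((complex^'n) \<times> 'n complex_jet) set" and W :: "((complex^'n) \<times> (complex^'m)) set"
  assumes F: "complex_primitive_subequation X F" "negativity X F" "convex_fibres X F" "constant_coefficient X F"
    and W: "open W" "orbit_closed W" "fst ` W \<subseteq> X" "\<And>x. x \<in> fst ` W \<Longrightarrow> connected {w. (x, w) \<in> W}"
    and v: "continuous_on W v" "orbit_invariant W v" "\<And>K. compact {x \<in> W. v x \<le> K}" "cfibre_sub W (\<lambda>x. ereal (v x))"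
      "\<And>ss b a c. (\<And>x. x \<in> fst ` W \<Longrightarrow> half_space ss b a c (jet_fibre F x)) \<Longrightarrow> cgraph_sub ss b a c W (\<lambda>x. ereal (v x))"
    and f: "usc_on W f" "orbit_invariant W f" "\<And>x. x \<in> W \<Longrightarrow> f x \<noteq> \<infinity>" "cfibre_sub W f"
      "\<And>ss b a c. (\<And>x. x \<in> fst ` W \<Longrightarrow> half_space ss b a c (jet_fibre F x)) \<Longrightarrow> cgraph_sub ss b a c W f"
  shows "complex_subharmonic F (fst ` W) (marg W f)"
proof (rule complex_subharmonicI[OF F(1-3) W(3) usc_on_marg[OF W(1) f(1)] marg_finite_above[OF f(3)]])
  fix ss b a c x1 assume a: "(a::real) \<ge> 0" and x1: "x1 \<in> fst ` W" and "half_space ss b a c (jet_fibre F x1)"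
  then have H: "half_space ss b a c (jet_fibre F x)" if "x \<in> fst ` W" for x
    using F(4) W(3) that unfolding constant_coefficient_def by (metis subsetD)
  define L where "L = log_set W"
  define h where "h = (\<lambda>x. f (fst x, cexp (snd x)))"
  define u where "u = (\<lambda>x. v (fst x, cexp (snd x)))"
  have L: "open L" unfolding L_def by (rule open_log_set[OF W(1)])
  have m: "marg L h = marg W f" "fst ` L = fst ` W" unfolding L_def h_def by (rule marg_log[OF W(1,2) f(2,1)])+
  have LW: "(\<lambda>x. (fst x, cexp (snd x))) ` L \<subseteq> W" by (auto simp: L_def log_set_def)
  have cm: "continuous_on L (\<lambda>x. (fst x, cexp (snd x)))"
    by (intro continuous_intros)
  have u: "continuous_on L u" unfolding u_def by (rule continuous_on_compose2[OF v(1) cm LW])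
  have vinv: "orbit_invariant W (\<lambda>x. ereal (v x))" by (rule orbit_invariant_ereal[OF v(2)])
  have ufib: "fibre_sub L (\<lambda>x. ereal (u x))"
    unfolding L_def u_def by (rule fibre_sub_log[OF W(1,2) vinv v(4)])
  have "lin_sub (complex_directions ss) b a c (fst ` L) (marg L h)"
  proof (rule lin_sub_marg[OF L _ _ _ _ continuous_imp_usc_on[OF u] _ ufib a])
    show "usc_on L h" unfolding h_def by (rule usc_on_compose[OF f(1) cm LW])
    show "h x \<noteq> \<infinity>" if "x \<in> L" for x using f(3) LW that unfolding h_def by blast
    show "graph_sub (complex_directions ss) b a c L h" unfolding L_def h_def
      by (rule graph_sub_log[OF W(1,2) f(2) f(5)[OF H]])
    show "fibre_sub L h" unfolding L_def h_def by (rule fibre_sub_log[OF W(1,2) f(2,4)])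
    show "graph_sub (complex_directions ss) b a c L (\<lambda>x. ereal (u x))" unfolding L_def u_def
      by (rule graph_sub_log[OF W(1,2) vinv v(5)[OF H]])
    show "\<exists>k. \<forall>s. (x, s) \<in> L \<longrightarrow> k \<le> u (x, s)" if x: "x \<in> fst ` L" for x
    proof -
      obtain y where "\<And>y'. (x, y') \<in> W \<Longrightarrow> v (x, y) \<le> v (x, y')"
        using marg_attained[OF v(1,3), of x] x m(2) by metis
      then show ?thesis by (intro exI[of _ "v (x, y)"]) (auto simp: L_def log_set_def u_def)
    qed
    fix x0 K assume x0: "x0 \<in> fst ` L"
    define V where "V = {w. (x0, w) \<in> W \<and> v (x0, w) < K + 1}"
    \<comment> \<open>The tube is built in \<open>W\<close>, where sublevel sets of \<open>v\<close>
      are compact, and pulled back. In logarithmic coordinates they are closed but may be unbounded,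
      since moduli may tend to 0; convexity, conversely, is obtained there.\<close>
    note tube = compact_sublevel_tube[OF W(1) v(1,3) f(1,3), where ?x0.0 = x0 and K = K, folded V_def]
    define Y where "Y = {s. cexp s \<in> V}"
    have Yo: "open Y" unfolding Y_def vimage_def[symmetric] by (intro open_vimage tube(1) continuous_intros)
    let ?S = "{s. (x0, s) \<in> L}"
    have "convex {s \<in> ?S. u (x0, s) < K + 1}"
    proof (rule connected_fibre_convex)
      have "?S = Pair x0 -` L" by auto
      then show "open ?S" using L by (simp only:) (intro open_vimage continuous_intros)
      have "connected {s. cexp s \<in> {w. (x0, w) \<in> W}}"
      proof (rule connected_log_fibre)
        have "{w. (x0, w) \<in> W} = Pair x0 -` W" by auto
        then show "open {w. (x0, w) \<in> W}" using W(1) by (simp only:) (intro open_vimage continuous_intros)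
        show "connected {w. (x0, w) \<in> W}" using W(4) x0 m(2) by blast
      qed (use W(2) in \<open>auto simp: orbit_closed_def\<close>)
      then show "connected ?S" by (simp add: L_def log_set_def)
      show "continuous_on ?S (\<lambda>s. u (x0, s))"
        by (rule continuous_on_compose2[OF u]) (auto intro!: continuous_intros)
      show "closed {s \<in> ?S. u (x0, s) \<le> k}" for k
      proof -
        have "{s \<in> ?S. u (x0, s) \<le> k} = (\<lambda>s. (x0, cexp s)) -` {z \<in> W. v z \<le> k}"
          by (auto simp: L_def log_set_def u_def)
        then show ?thesis using v(3)[of k] by (simp only:) (intro closed_vimage compact_imp_closed continuous_intros)
      qed
      show "u (x0, s) \<le> max (u (x0, s0)) (u (x0, s1))"
        if "closed_segment s0 s1 \<subseteq> ?S" "s \<in> closed_segment s0 s1" for s0 s1 s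
        by (rule fibre_sub_quasiconvex[OF L continuous_imp_usc_on[OF u] ufib _ that(2)]) (use that in auto)
    qed
    moreover have "{s \<in> ?S. u (x0, s) < K + 1} = Y" by (auto simp: Y_def V_def L_def log_set_def u_def)
    ultimately have Yc: "convex Y" by simp
    obtain \<rho> M where \<rho>: "\<rho> > 0" "cball x0 \<rho> \<times> V \<subseteq> W"
      "\<And>x y. x \<in> cball x0 \<rho> \<Longrightarrow> (x, y) \<in> W \<Longrightarrow> v (x, y) \<le> K \<Longrightarrow> y \<in> V"
      "\<And>x y. x \<in> cball x0 \<rho> \<Longrightarrow> y \<in> V \<Longrightarrow> f (x, y) \<le> ereal M \<and> v (x, y) \<le> M"
      using tube(2) by blast
    have "cball x0 \<rho> \<times> Y \<subseteq> L" using \<rho>(2) by (auto simp: Y_def L_def log_set_def)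
    moreover have "\<forall>x\<in>cball x0 \<rho>. \<forall>y. (x, y) \<in> L \<and> u (x, y) \<le> K \<longrightarrow> y \<in> Y"
      using \<rho>(3) by (simp add: Y_def L_def log_set_def u_def)
    moreover have "\<forall>x\<in>cball x0 \<rho>. \<forall>y\<in>Y. h (x, y) \<le> ereal M \<and> u (x, y) \<le> M"
      using \<rho>(4) by (simp add: Y_def h_def u_def)
    ultimately show "\<exists>\<rho>>0. \<exists>Y M. open Y \<and> convex Y \<and> cball x0 \<rho> \<times> Y \<subseteq> L
         \<and> (\<forall>x\<in>cball x0 \<rho>. \<forall>y. (x, y) \<in> L \<and> u (x, y) \<le> K \<longrightarrow> y \<in> Y)
         \<and> (\<forall>x\<in>cball x0 \<rho>. \<forall>y\<in>Y. h (x, y) \<le> ereal M \<and> u (x, y) \<le> M)"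
      using \<rho>(1) Yo Yc by blast
  qed
  then show "lin_sub (complex_directions ss) b a c (fst ` W) (marg W f)" unfolding m .
qed

lemma upper_contact_jet_cong:
  assumes "\<forall>\<^sub>F y in nhds x. f y = g y" "upper_contact_jet f x p A" shows "upper_contact_jet g x p A"
proof -
  have x: "f x = g x" using assms(1) by (rule eventually_nhds_x_imp_x)
  have "\<forall>\<^sub>F y in nhds x. f y \<le> f x + ereal (p \<bullet> (y - x) + 1/2 * ((y - x) \<bullet> (A *v (y - x))))"
    using assms(2) unfolding upper_contact_jet_def by blast
  then have "\<forall>\<^sub>F y in nhds x. g y \<le> g x + ereal (p \<bullet> (y - x) + 1/2 * ((y - x) \<bullet> (A *v (y - x))))"
    using assms(1) by eventually_elim (simp add: x)
  then show ?thesis using assms(2) x unfolding upper_contact_jet_def by simp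
qed

theorem complex_minimum_principle_convex:
  fixes F :: "((complex^'n) \<times> 'n complex_jet) set"
  assumes F: "complex_primitive_subequation X F" "negativity X F" "convex_fibres X F" "constant_coefficient X F"
  shows "complex_minimum_principle TYPE('m::finite) X F"
  unfolding complex_minimum_principle_def
proof (intro allI impI conjI)
  fix \<Omega> :: "(complex^('n + 'm)) set"
  assume *: "vec_fst ` \<Omega> \<subseteq> X \<and> \<Omega> \<noteq> {} \<and> open \<Omega> \<and> connected \<Omega> \<and> torus_invariant_set \<Omega> \<and>
        complex_pseudoconvex (complex_product F complex_convexity_subequation) \<Omega> \<and> connected_fibres \<Omega>"
  then obtain u where \<Omega>: "vec_fst ` \<Omega> \<subseteq> X" "open \<Omega>" "connected_fibres \<Omega>" "torus_invariant_set \<Omega>"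
    and u: "continuous_on \<Omega> u" "exhaustive \<Omega> u" "complex_subharmonic (complex_product F complex_convexity_subequation) \<Omega> (\<lambda>z. ereal (u z))"
    unfolding complex_pseudoconvex_def by blast
  define W where "W = split_set \<Omega>"
  define u' where "u' = split_fun u"
  \<comment> \<open>The symmetrized exhaustion serves the truncation and supplies, through its
    marginal, the exhaustion of the projection.\<close>
  define v where "v = orbit_sup u'"
  have W: "open W" "orbit_closed W" and D: "fst ` W = vec_fst ` \<Omega>"
    unfolding W_def by (auto simp: fst_split_set open_split_set orbit_closed_split \<Omega>)
  have con: "connected {w. (x, w) \<in> W}" if "x \<in> fst ` W" for x
  proof -
    have "{w. (x, w) \<in> W} = slice \<Omega> x" by (auto simp: slice_def W_def split_set_def)
    moreover have "connected (slice \<Omega> x)" using \<Omega>(3) that unfolding connected_fibres_def D by blast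
    ultimately show ?thesis by simp
  qed
  have u': "continuous_on W u'" unfolding u'_def W_def by (rule continuous_on_split[OF u(1)])
  have comp': "compact {z \<in> W. u' z \<le> K}" for K
    unfolding u'_def W_def by (rule compact_sublevel_split[OF exhaustive_compact_sublevel[OF u(2,1)]])
  have ueq: "split_fun (\<lambda>z. ereal (u z)) = (\<lambda>z. ereal (u' z))" by (auto simp: split_fun_def u'_def)
  have v: "continuous_on W v" "orbit_invariant W v" "\<And>K. compact {x \<in> W. v x \<le> K}" "cfibre_sub W (\<lambda>x. ereal (v x))"
    unfolding v_def
    using continuous_on_orbit_sup[OF W u'] orbit_sup_invariant compact_sublevel_orbit_sup[OF W u' comp']
      cfibre_sub_orbit_sup[OF W u'] complex_product_cfibre_sub[OF u(3)] unfolding ueq W_def[symmetric] by blast+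
  have vg: "cgraph_sub ss b a c W (\<lambda>x. ereal (v x))"
    if "\<And>x. x \<in> fst ` W \<Longrightarrow> half_space ss b a c (jet_fibre F x)" for ss b a c
    unfolding v_def
    by (rule cgraph_sub_orbit_sup[OF W u' complex_product_cgraph_sub[OF u(3), unfolded ueq, folded W_def]])
       (use that D in auto)
  note aux = complex_minimum_principle_aux[OF F W \<Omega>(1)[folded D] con v vg, unfolded D]
  show "complex_subharmonic F (vec_fst ` \<Omega>) (marginal \<Omega> f)"
    if f: "torus_invariant_fun \<Omega> f \<and> complex_subharmonic (complex_product F complex_convexity_subequation) \<Omega> f" for f
    unfolding marginal_split W_def[symmetric]
  proof (rule aux)
    show "usc_on W (split_fun f)" using f usc_on_split unfolding complex_subharmonic_def W_def by blast
    show "split_fun f x \<noteq> \<infinity>" if "x \<in> W" for x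
      using f that unfolding complex_subharmonic_def W_def split_set_def split_fun_def by blast
    show "orbit_invariant W (split_fun f)" unfolding W_def using f by (intro orbit_invariant_split) blast
    show "cfibre_sub W (split_fun f)" unfolding W_def using f complex_product_cfibre_sub by blast
    show "cgraph_sub ss b a c W (split_fun f)"
      if "\<And>x. x \<in> vec_fst ` \<Omega> \<Longrightarrow> half_space ss b a c (jet_fibre F x)" for ss b a c
      unfolding W_def using f that by (intro complex_product_cgraph_sub) auto
  qed
  define g where "g = (\<lambda>x. real_of_ereal (marg W (\<lambda>z. ereal (v z)) x))"
  have proj: "continuous_on (vec_fst ` \<Omega>) g" "exhaustive (vec_fst ` \<Omega>) g"
    "\<And>x. x \<in> vec_fst ` \<Omega> \<Longrightarrow> marg W (\<lambda>z. ereal (v z)) x = ereal (g x)"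
    using projected_exhaustion[OF W(1) v(1,3)] unfolding g_def D by auto
  have oD: "open (vec_fst ` \<Omega>)" using open_image_fst[OF W(1)] D by simp
  have sub: "complex_subharmonic F (vec_fst ` \<Omega>) (marg W (\<lambda>z. ereal (v z)))"
  proof (rule aux)
    show "usc_on W (\<lambda>z. ereal (v z))" by (rule continuous_imp_usc_on[OF v(1)])
    show "orbit_invariant W (\<lambda>z. ereal (v z))" by (rule orbit_invariant_ereal[OF v(2)])
  qed (use v vg D in auto)
  have "complex_subharmonic F (vec_fst ` \<Omega>) (\<lambda>x. ereal (g x))"
    unfolding complex_subharmonic_def
  proof (intro conjI ballI allI impI)
    show "usc_on (vec_fst ` \<Omega>) (\<lambda>x. ereal (g x))" by (rule continuous_imp_usc_on[OF proj(1)])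
    fix x p A assume x: "x \<in> vec_fst ` \<Omega>" and j: "upper_contact_jet ((\<lambda>x. ereal (g x)) \<circ> complexify) (realify x) p A"
    have "continuous_on UNIV (complexify :: real^('n + 'n) \<Rightarrow> complex^'n)"
      by (rule linear_continuous_on) (simp add: linear_complexify linear_conv_bounded_linear[symmetric])
    then have "open (complexify -` (vec_fst ` \<Omega>))" by (rule open_vimage[OF oD])
    then have "\<forall>\<^sub>F y in nhds (realify x). y \<in> complexify -` (vec_fst ` \<Omega>)"
      by (rule eventually_nhds_in_open) (use x in simp)
    then have "\<forall>\<^sub>F y in nhds (realify x). ((\<lambda>x. ereal (g x)) \<circ> complexify) y = (marg W (\<lambda>z. ereal (v z)) \<circ> complexify) y"
      by eventually_elim (simp add: proj(3))
    from upper_contact_jet_cong[OF this j]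
    have "(real_of_ereal (marg W (\<lambda>z. ereal (v z)) x), complexify p, complex_part A) \<in> jet_fibre F x"
      using sub x unfolding complex_subharmonic_def by blast
    then show "(real_of_ereal (ereal (g x)), complexify p, complex_part A) \<in> jet_fibre F x" unfolding proj(3)[OF x] .
  qed auto
  then show "complex_pseudoconvex F (vec_fst ` \<Omega>)"
    unfolding complex_pseudoconvex_def using oD proj(1,2) by blast
qed

theorem mainTheorem1:
  shows "(\<forall>(X :: (real^'n) set) (F :: ((real^'n) \<times> 'n real_jet) set).
            open X \<and> real_primitive_subequation X F \<and> negativity X F \<and>
            convex_fibres X F \<and> constant_coefficient X F
            \<longrightarrow> real_minimum_principle TYPE('m::finite) X F)
         \<and>
         (\<forall>(X :: (complex^'n) set) (F :: ((complex^'n) \<times> 'n complex_jet) set).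
            open X \<and> complex_primitive_subequation X F \<and> negativity X F \<and>
            convex_fibres X F \<and> constant_coefficient X F
            \<longrightarrow> complex_minimum_principle TYPE('m::finite) X F)"
  using real_minimum_principle_convex complex_minimum_principle_convex by blast

end
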